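(* The construction $\mathcal P\mapsto\int\mathcal P$ (the integration of a constant-free non-symmetric categorical operad, with its structure of a split-fibered non-symmetric operadic 2-category described in the context) extends to a fully faithful functor $$\int:\ \Delta_s\text{-}\mathrm{oper}(\mathrm{Cat})\longrightarrow\mathrm{sFib}(\Delta_s)$$ from the category of constant-free non-symmetric categorical operads to the category of split-fibered non-symmetric operadic 2-categories.
   Context: **The category $\Delta_s$.** Objects: ordinals $\underline{n}=\{1<\dots<n\}$, $n\ge 1$; morphisms: order-preserving surjections. For $g:\underline{k}\to\underline{n}$ and $i\in\underline n$ the preimage $g^{-1}(i)$ is identified with an ordinal $\underline{k_i}$. For $\underline m\xrightarrow{f}\underline k\xrightarrow{g}\underline n$ let $f^i:(gf)^{-1}(i)\to g^{-1}(i)$ be the induced map. A sequence $a_1,\dots,a_k$ indexed by $\underline k$ is cut by $g$ into blocks $a^i_1,\dots,a^i_{k_i}$, $1\le i\le n$. $!_n:\underline n\to\underline 1$ is the unique map. **Operads.** A constant-free non-symmetric categorical operad $\mathcal P$ is a collection of categories $\{\mathcal P_n\}_{n\ge1}$ with functors $\mu_g:\mathcal P_n\times\mathcal P_{k_1}\times\dots\times\mathcal P_{k_n}\to\mathcal P_k$ for each $g:\underline k\to\underline n$ in $\Delta_s$ (with $\underline{k_i}=g^{-1}(i)$) and an object $e\in\mathcal P_1$ (the unit), such that, strictly (on objects and morphisms), $\mu_f(\mu_g(c,b_1,\dots,b_n),a_1,\dots,a_k)=\mu_{gf}(c,\mu_{f^1}(b_1,a^1_1,\dots,a^1_{k_1}),\dots,\mu_{f^n}(b_n,a^n_1,\dots,a^n_{k_n}))$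 for all composable $f:\underline m\to\underline k$, $g:\underline k\to\underline n$, and $\mu_{1_{\underline n}}(a,e,\dots,e)=a$, $\mu_{!_n}(e,a)=a$. A morphism of operads $F:\mathcal P\to\mathcal Q$ is a family of functors $F_n:\mathcal P_n\to\mathcal Q_n$ strictly commuting with all $\mu_g$ and preserving the unit. These form the category $\Delta_s\text{-}\mathrm{oper}(\mathrm{Cat})$. **Integration.** The 2-category $\int\mathcal P$ has: - 0-cells: pairs $[m,a]$, $m\ge1$, $a\in\mathcal P_m$. - 1-cells $[m,a]\to[k,b]$: tuples $[f;a_1,\dots,a_k;\alpha]$ with $f:\underline m\to\underline k$ in $\Delta_s$, $a_i\in\mathcal P_{f^{-1}(i)}$, and $\alpha:\mu_f(b,a_1,\dots,a_k)\to a$ in $\mathcal P_m$. - 2-cells $[f;a'_1,\dots,a'_k;\alpha']\Rightarrow[f;a''_1,\dots,a''_k;\alpha'']$: sequences $\delta=(\delta_i:a'_i\to a''_i)_{1\le i\le k}$ of morphisms of $\mathcal P_{f^{-1}(i)}$ with $\alpha''\circ\mu_f(1_b,\delta_1,\dots,\delta_k)=\alpha'$; there are no 2-cells between 1-cells with different first components. - Composition: $[g;b_1,\dots,b_n;\beta]\circ[f;a_1,\dots,a_k;\alpha]=[gf;\mu_{f^1}(b_1,a^1_1,\dots,a^1_{k_1}),\dots,\mu_{f^n}(b_n,a^n_1,\dots,a^n_{k_n});\alpha\circ\mu_f(\beta,a_1,\dots,a_k)]$; identities $[1_{\underline m};e,\dots,e;1_a]$. Vertical composition of 2-cells is componentwise;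 the horizontal composite of $(\epsilon_i)_i$ (over $g$) with $(\delta_j)_j$ (over $f$) is $(\mu_{f^i}(\epsilon_i,\delta^i_1,\dots,\delta^i_{k_i}))_i$. On morphisms, $\int F$ sends $[m,a]\mapsto[m,Fa]$, $[f;a_1,\dots,a_k;\alpha]\mapsto[f;Fa_1,\dots,Fa_k;F\alpha]$, $(\delta_i)\mapsto(F\delta_i)$. **Lax slice.** For a 2-category $\mathcal C$ and $x\in\mathcal C$, the lax slice 2-category $\mathcal C/x$ has as objects the 1-cells $\phi:y\to x$; as 1-cells $\theta\to\phi$ (for $\theta:z\to x$, $\phi:y\to x$) the pairs $(\psi,\alpha)$ with $\psi:z\to y$ and $\alpha:\phi\psi\Rightarrow\theta$ (a *lax triangle*, often denoted by $\alpha$ alone, with $d_2\alpha=\psi$, $d_1\alpha=\theta$, $d_0\alpha=\phi$); as 2-cells $(\psi',\alpha')\Rightarrow(\psi'',\alpha'')$ the 2-cells $\gamma:\psi'\Rightarrow\psi''$ with $\alpha''\circ(1_\phi\,\Box\,\gamma)=\alpha'$ ($\Box$ is horizontal composition). A 2-functor $F:\mathcal C\to\mathcal D$ induces $F/x:\mathcal C/x\to\mathcal D/Fx$; $\mathrm{dom}:\mathcal C/x\to\mathcal C$ is the domain 2-functor. **Lali-terminal.** An object $v$ of $\mathcal C$ is lali-terminal if every category $\mathcal C(x,v)$ has a terminal object and the terminal object of $\mathcal C(v,v)$ is $1_v$; it is local lali-terminal if it is lali-terminal in its connected component. **Non-symmetric operadic 2-category.** A 2-category $\mathbb O$ with: a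 2-functor $|-|:\mathbb O\to\Delta_s$ (cardinality; $\Delta_s$ has only identity 2-cells; we also write $|x|$ for the number of elements); 2-functors $\mathrm{fib}_x:\mathbb O/x\to\mathbb O^{|x|}$ for each object $x$; and a chosen local lali-terminal object $u_c$ in each connected component $c$ containing an object of non-zero cardinality. Notation: $\mathrm{fib}^i_x(\phi)=\phi_i$ are the fibers of $\phi$; for a lax triangle $\alpha:\phi\psi\Rightarrow\theta$ the induced maps are $\alpha^i=\mathrm{fib}^i_x(\alpha):\theta_i\to\phi_i$; for $x$ of non-zero cardinality in component $c$, $u_x:=u_c$ and $\epsilon_x:x\to u_c$ is the terminal object of $\mathbb O(x,u_c)$. Axioms: (i) $|-|^{|x|}\circ\mathrm{fib}_x=\mathrm{fib}_{|x|}\circ(|-|/x)$, where $\mathrm{fib}_{\underline n}:\Delta_s/\underline n\to\Delta_s^{n}$ is given by preimages $g^{-1}(i)$ and induced maps $f^i$. (ii) For every connected component $c$, $|u_c|=\underline1$, and $\mathrm{fib}_{u_c}$ is the domain functor. (iii) The fibers of each identity $1_x$ are chosen local lali-terminal objects, denoted $u^1_x,\dots,u^k_x$, where $|x|=\underline k$. (iv) For $\phi:y\to x$, the lax triangle $1_x\circ\phi\Rightarrow\phi$ given by the identity 2-cell $1_\phi$, a 1-cell $\phi\to1_x$ of $\mathbb O/x$, has $i$-th fiber $\epsilon_{\phi_i}$. (v) (Fiber axiom) For $\phi:y\to x$, the composite $(\mathbb O/x)/\phi\xrightarrow{\mathrm{fib}_x/\phi}\mathbb O^{|x|}/\mathrm{fib}_x(\phi)\cong\prod_{i}\mathbb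 O/\phi_i\xrightarrow{\prod_i\mathrm{fib}_{\phi_i}}\prod_i\mathbb O^{|\phi_i|}\cong\mathbb O^{|y|}$ equals $(\mathbb O/x)/\phi\xrightarrow{\mathrm{dom}/\phi}\mathbb O/y\xrightarrow{\mathrm{fib}_y}\mathbb O^{|y|}$, the last isomorphism coming from $|\phi_1|+\dots+|\phi_{|x|}|=|y|$. An operadic 2-functor is a 2-functor which respects the fiber 2-functors, preserves cardinality and the chosen local lali-terminal objects. **Operadic cartesian maps (over $\Delta_s$).** A 1-cell $\phi:s\to t$ of $\mathbb O$, $|t|=\underline k$, is operadic cartesian if for every $\theta:r\to t$, all maps $\psi^i:\theta_i\to\phi_i$ in $\mathbb O$ ($1\le i\le k$), and every commutative triangle $|\phi|\circ f=|\theta|$ in $\Delta_s$ with $f^i=|\psi^i|$, there is a unique lax triangle $\tilde\alpha$ in $\mathbb O$ with $d_0\tilde\alpha=\phi$, $d_1\tilde\alpha=\theta$, $\tilde\alpha^i=\psi^i$ and $|d_2\tilde\alpha|=f$. **Fibered / split-fibered.** $\mathbb O$ is fibered (over $\Delta_s$) if $|-|$ is an operadic fibration: it is surjective on connected components, and for all objects $b,a_1,\dots,a_k$ with $|b|=\underline k$ and $f:\underline m\to\underline k$ with $f^{-1}(j)=|a_j|$, there is an operadic cartesian $\tilde f$ with codomain $b$, $|\tilde f|=f$ and fibers $a_1,\dots,a_k$ (a lift of $f$). It is split-fibered if it is equipped with a choice of such lifts $\ell(f,b,a_1\cdots a_k)$ such that, for all $f:\underline m\to\underline k$, $g:\underline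 k\to\underline n$ and objects $c,b_i,a_j$ of $\mathbb O$ ($1\le i\le n$, $1\le j\le k$) for which the lifts are defined: (1) $\ell(1_{\underline n},c,u^1_c\cdots u^n_c)=1_c$; (2) $\ell(!_n,u_c,c)=\epsilon_c$; (3) $\ell\big(f,\ell_1(g,c,b_1\cdots b_n),a_1\cdots a_k\big)=\ell\big(g\circ f,c,\ell_1(f^1,b_1,a^1_1\cdots a^1_{k_1})\cdots\ell_1(f^n,b_n,a^n_1\cdots a^n_{k_n})\big)$, where $\ell_1$ denotes the domain of the lift. A morphism of split-fibered non-symmetric operadic 2-categories is an operadic 2-functor preserving the chosen operadic cartesian lifts; these form the category $\mathrm{sFib}(\Delta_s)$. **Structure on $\int\mathcal P$.** Cardinality is the projection $[m,a]\mapsto\underline m$, $[f;a_1,\dots,a_k;\alpha]\mapsto f$. The $i$-th fiber of $[g;b_1,\dots,b_n;\beta]:[k,b]\to[n,c]$ is $[g^{-1}(i),b_i]$. A lax triangle $[g;b_1,\dots,b_n;\beta]\circ[f;a_1,\dots,a_k;\alpha]\Rightarrow[h;c_1,\dots,c_n;\gamma]$ is a tuple $\delta_i:\mu_{f^i}(b_i,a^i_1,\dots,a^i_{k_i})\to c_i$ satisfying the 2-cell condition, and its $i$-th fiber is $[f^i;a^i_1,\dots,a^i_{k_i};\delta_i]$. The $i$-th fiber of a 2-cell $(\xi_1,\dots,\xi_k)$ of the lax slice is $(\xi^i_1,\dots,\xi^i_{k_i})$. The chosen lali-terminal object is $[1,e]$. The chosen lifts are $\ell(g,[n,c],[g^{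-1}(1),b_1]\cdots[g^{-1}(n),b_n])=[g;b_1,\dots,b_n;1_{\mu_g(c,b_1,\dots,b_n)}]$.
   Formalization: Axiom (ii) is required only on the full sub-2-category of the slice over u_c spanned by the terminal 1-cells ε_y (it fails for ∫P otherwise); splitting condition (3), ill-typed as displayed, is read with its left side composed with ℓ(g,c,b_1⋯b_n). *)

theory Defs
  imports "HOL-Library.FuncSet"
begin

section \<open>Categories, 2-categories and their functors\<close>

text \<open>The values of the structure functions outside the carriers are irrelevant.\<close>

record ('o, 'a) cat =
  Obj :: "'o set"
  Arr :: "'a set"
  Src :: "'a \<Rightarrow> 'o"
  Trg :: "'a \<Rightarrow> 'o"
  Idn :: "'o \<Rightarrow> 'a"
  Cmp :: "'a \<Rightarrow> 'a \<Rightarrow> 'a"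

definition category :: "('o, 'a, 'z) cat_scheme \<Rightarrow> bool" where
  "category C \<longleftrightarrow>
     (\<forall>f\<in>Arr C. Src C f \<in> Obj C \<and> Trg C f \<in> Obj C) \<and>
     (\<forall>x\<in>Obj C. Idn C x \<in> Arr C \<and> Src C (Idn C x) = x \<and> Trg C (Idn C x) = x) \<and>
     (\<forall>f\<in>Arr C. \<forall>g\<in>Arr C. Src C g = Trg C f \<longrightarrow>
        Cmp C g f \<in> Arr C \<and> Src C (Cmp C g f) = Src C f \<and> Trg C (Cmp C g f) = Trg C g) \<and>
     (\<forall>f\<in>Arr C. Cmp C f (Idn C (Src C f)) = f \<and> Cmp C (Idn C (Trg C f)) f = f) \<and>
     (\<forall>f\<in>Arr C. \<forall>g\<in>Arr C. \<forall>h\<in>Arr C. Src C g = Trg C f \<longrightarrow> Src C h = Trg C g \<longrightarrow>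
        Cmp C h (Cmp C g f) = Cmp C (Cmp C h g) f)"

definition homset :: "('o, 'a, 'z) cat_scheme \<Rightarrow> 'o \<Rightarrow> 'o \<Rightarrow> 'a set" where
  "homset C x y = {f \<in> Arr C. Src C f = x \<and> Trg C f = y}"

definition is_functor ::
  "('o, 'a, 'z) cat_scheme \<Rightarrow> ('p, 'b, 'y) cat_scheme \<Rightarrow> ('o \<Rightarrow> 'p) \<Rightarrow> ('a \<Rightarrow> 'b) \<Rightarrow> bool" where
  "is_functor C D F0 F1 \<longleftrightarrow>
     (\<forall>x\<in>Obj C. F0 x \<in> Obj D) \<and>
     (\<forall>f\<in>Arr C. F1 f \<in> Arr D \<and> Src D (F1 f) = F0 (Src C f) \<and> Trg D (F1 f) = F0 (Trg C f)) \<and>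
     (\<forall>x\<in>Obj C. F1 (Idn C x) = Idn D (F0 x)) \<and>
     (\<forall>f\<in>Arr C. \<forall>g\<in>Arr C. Src C g = Trg C f \<longrightarrow> F1 (Cmp C g f) = Cmp D (F1 g) (F1 f))"

definition fully_faithful_functor ::
  "('o, 'a, 'z) cat_scheme \<Rightarrow> ('p, 'b, 'y) cat_scheme \<Rightarrow> ('o \<Rightarrow> 'p) \<Rightarrow> ('a \<Rightarrow> 'b) \<Rightarrow> bool" where
  "fully_faithful_functor C D F0 F1 \<longleftrightarrow>
     category C \<and> category D \<and> is_functor C D F0 F1 \<and>
     (\<forall>x\<in>Obj C. \<forall>y\<in>Obj C. bij_betw F1 (homset C x y) (homset D (F0 x) (F0 y)))"

definition pair_cat :: "('o, 'a) cat \<Rightarrow> ('p, 'b) cat \<Rightarrow> ('o \<times> 'p, 'a \<times> 'b) cat" where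
  "pair_cat C D =
     \<lparr>Obj = Obj C \<times> Obj D, Arr = Arr C \<times> Arr D,
      Src = map_prod (Src C) (Src D), Trg = map_prod (Trg C) (Trg D),
      Idn = map_prod (Idn C) (Idn D),
      Cmp = (\<lambda>(g, g') (f, f'). (Cmp C g f, Cmp D g' f'))\<rparr>"

text \<open>The product of a finite list of categories.\<close>

definition list_cat :: "('o, 'a) cat list \<Rightarrow> ('o list, 'a list) cat" where
  "list_cat Cs =
     \<lparr>Obj = {xs. list_all2 (\<lambda>C x. x \<in> Obj C) Cs xs},
      Arr = {fs. list_all2 (\<lambda>C f. f \<in> Arr C) Cs fs},
      Src = map2 Src Cs, Trg = map2 Trg Cs, Idn = map2 Idn Cs,
      Cmp = (\<lambda>gs fs. map (\<lambda>i. Cmp (Cs ! i) (gs ! i) (fs ! i)) [0..<length Cs])\<rparr>"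

record ('o, 'a, 'c) twocat = "('o, 'a) cat" +
  Cell :: "'c set"
  Src2 :: "'c \<Rightarrow> 'a"
  Trg2 :: "'c \<Rightarrow> 'a"
  Idn2 :: "'a \<Rightarrow> 'c"
  VCmp :: "'c \<Rightarrow> 'c \<Rightarrow> 'c"
  HCmp :: "'c \<Rightarrow> 'c \<Rightarrow> 'c"

definition vert :: "('o, 'a, 'c, 'z) twocat_scheme \<Rightarrow> ('a, 'c) cat" where
  "vert C = \<lparr>Obj = Arr C, Arr = Cell C, Src = Src2 C, Trg = Trg2 C, Idn = Idn2 C, Cmp = VCmp C\<rparr>"

definition horiz :: "('o, 'a, 'c, 'z) twocat_scheme \<Rightarrow> ('o, 'c) cat" where
  "horiz C =
     \<lparr>Obj = Obj C, Arr = Cell C, Src = Src C \<circ> Src2 C, Trg = Trg C \<circ> Src2 C,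
      Idn = Idn2 C \<circ> Idn C, Cmp = HCmp C\<rparr>"

definition two_category :: "('o, 'a, 'c, 'z) twocat_scheme \<Rightarrow> bool" where
  "two_category C \<longleftrightarrow>
     category C \<and> category (vert C) \<and> category (horiz C) \<and>
     (\<forall>c\<in>Cell C. Src C (Src2 C c) = Src C (Trg2 C c) \<and> Trg C (Src2 C c) = Trg C (Trg2 C c)) \<and>
     (\<forall>c\<in>Cell C. \<forall>d\<in>Cell C. Src C (Src2 C d) = Trg C (Src2 C c) \<longrightarrow>
        Src2 C (HCmp C d c) = Cmp C (Src2 C d) (Src2 C c) \<and>
        Trg2 C (HCmp C d c) = Cmp C (Trg2 C d) (Trg2 C c)) \<and>
     (\<forall>f\<in>Arr C. \<forall>g\<in>Arr C. Src C g = Trg C f \<longrightarrow>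
        HCmp C (Idn2 C g) (Idn2 C f) = Idn2 C (Cmp C g f)) \<and>
     (\<forall>c\<in>Cell C. \<forall>c'\<in>Cell C. \<forall>d\<in>Cell C. \<forall>d'\<in>Cell C.
        Src2 C c' = Trg2 C c \<longrightarrow> Src2 C d' = Trg2 C d \<longrightarrow> Src C (Src2 C d) = Trg C (Src2 C c) \<longrightarrow>
        HCmp C (VCmp C d' d) (VCmp C c' c) = VCmp C (HCmp C d' c') (HCmp C d c))"

record ('o, 'a, 'c, 'p, 'b, 'd) twofun =
  T0 :: "'o \<Rightarrow> 'p"
  T1 :: "'a \<Rightarrow> 'b"
  T2 :: "'c \<Rightarrow> 'd"

definition two_functor ::
  "('o, 'a, 'c, 'z) twocat_scheme \<Rightarrow> ('p, 'b, 'd, 'y) twocat_scheme \<Rightarrow>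
   ('o, 'a, 'c, 'p, 'b, 'd) twofun \<Rightarrow> bool" where
  "two_functor C D F \<longleftrightarrow>
     is_functor C D (T0 F) (T1 F) \<and>
     is_functor (vert C) (vert D) (T1 F) (T2 F) \<and>
     is_functor (horiz C) (horiz D) (T0 F) (T2 F)"

definition tcomp ::
  "('p, 'b, 'd, 'q, 'e, 'f) twofun \<Rightarrow> ('o, 'a, 'c, 'p, 'b, 'd) twofun \<Rightarrow>
   ('o, 'a, 'c, 'q, 'e, 'f) twofun" where
  "tcomp G F = \<lparr>T0 = T0 G \<circ> T0 F, T1 = T1 G \<circ> T1 F, T2 = T2 G \<circ> T2 F\<rparr>"

text \<open>Equality of 2-functors with domain \<open>C\<close>.\<close>

definition teq ::
  "('o, 'a, 'c, 'z) twocat_scheme \<Rightarrow> ('o, 'a, 'c, 'p, 'b, 'd) twofun \<Rightarrow>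
   ('o, 'a, 'c, 'p, 'b, 'd) twofun \<Rightarrow> bool" where
  "teq C F G \<longleftrightarrow>
     (\<forall>x\<in>Obj C. T0 F x = T0 G x) \<and> (\<forall>f\<in>Arr C. T1 F f = T1 G f) \<and> (\<forall>c\<in>Cell C. T2 F c = T2 G c)"

text \<open>The canonical representative of a 2-functor with domain \<open>C\<close>.\<close>

definition trestrict ::
  "('o, 'a, 'c, 'z) twocat_scheme \<Rightarrow> ('o, 'a, 'c, 'p, 'b, 'd) twofun \<Rightarrow>
   ('o, 'a, 'c, 'p, 'b, 'd) twofun" where
  "trestrict C F =
     \<lparr>T0 = restrict (T0 F) (Obj C), T1 = restrict (T1 F) (Arr C), T2 = restrict (T2 F) (Cell C)\<rparr>"

definition pow :: "('o, 'a, 'c, 'z) twocat_scheme \<Rightarrow> nat \<Rightarrow> ('o list, 'a list, 'c list) twocat" where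
  "pow C n =
     \<lparr>Obj = {xs. length xs = n \<and> set xs \<subseteq> Obj C},
      Arr = {fs. length fs = n \<and> set fs \<subseteq> Arr C},
      Src = map (Src C), Trg = map (Trg C), Idn = map (Idn C), Cmp = map2 (Cmp C),
      Cell = {cs. length cs = n \<and> set cs \<subseteq> Cell C},
      Src2 = map (Src2 C), Trg2 = map (Trg2 C), Idn2 = map (Idn2 C),
      VCmp = map2 (VCmp C), HCmp = map2 (HCmp C)\<rparr>"

definition pow_fun ::
  "('o, 'a, 'c, 'p, 'b, 'd) twofun \<Rightarrow>
   ('o list, 'a list, 'c list, 'p list, 'b list, 'd list) twofun" where
  "pow_fun F = \<lparr>T0 = map (T0 F), T1 = map (T1 F), T2 = map (T2 F)\<rparr>"

text \<open>The isomorphism of a 2-category with its first power.\<close>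

definition singl :: "('o, 'a, 'c, 'o list, 'a list, 'c list) twofun" where
  "singl = \<lparr>T0 = (\<lambda>x. [x]), T1 = (\<lambda>f. [f]), T2 = (\<lambda>c. [c])\<rparr>"

definition full_sub :: "('o, 'a, 'c, 'z) twocat_scheme \<Rightarrow> 'o set \<Rightarrow> ('o, 'a, 'c) twocat" where
  "full_sub C S =
     \<lparr>Obj = Obj C \<inter> S, Arr = {f \<in> Arr C. Src C f \<in> S \<and> Trg C f \<in> S},
      Src = Src C, Trg = Trg C, Idn = Idn C, Cmp = Cmp C,
      Cell = {c \<in> Cell C. Src C (Src2 C c) \<in> S \<and> Trg C (Src2 C c) \<in> S},
      Src2 = Src2 C, Trg2 = Trg2 C, Idn2 = Idn2 C, VCmp = VCmp C, HCmp = HCmp C\<rparr>"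

subsection \<open>Lax slices\<close>

text \<open>\<open>Tri \<psi> \<theta> \<phi> \<alpha>\<close> is the lax triangle \<open>\<alpha>\<close> from \<open>\<phi> \<circ> \<psi>\<close> to \<open>\<theta>\<close>, a 1-cell from \<open>\<theta>\<close> to \<open>\<phi>\<close> of the slice.\<close>

datatype ('a, 'c) tri = Tri (d2: 'a) (d1: 'a) (d0: 'a) (tcell: 'c)

datatype ('a, 'c) tri2 = Tri2 (src_tri: "('a, 'c) tri") (trg_tri: "('a, 'c) tri") (cell_tri: 'c)

definition lax_triangles :: "('o, 'a, 'c, 'z) twocat_scheme \<Rightarrow> 'o \<Rightarrow> ('a, 'c) tri set" where
  "lax_triangles C x =
     {Tri \<psi> \<theta> \<phi> \<alpha> | \<psi> \<theta> \<phi> \<alpha>.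
        \<psi> \<in> Arr C \<and> \<theta> \<in> Arr C \<and> \<phi> \<in> Arr C \<and> \<alpha> \<in> Cell C \<and>
        Trg C \<theta> = x \<and> Trg C \<phi> = x \<and> Src C \<psi> = Src C \<theta> \<and> Trg C \<psi> = Src C \<phi> \<and>
        Src2 C \<alpha> = Cmp C \<phi> \<psi> \<and> Trg2 C \<alpha> = \<theta>}"

definition tri_comp ::
  "('o, 'a, 'c, 'z) twocat_scheme \<Rightarrow> ('a, 'c) tri \<Rightarrow> ('a, 'c) tri \<Rightarrow> ('a, 'c) tri" where
  "tri_comp C t s =
     Tri (Cmp C (d2 t) (d2 s)) (d1 s) (d0 t)
       (VCmp C (tcell s) (HCmp C (tcell t) (Idn2 C (d2 s))))"

definition lslice ::
  "('o, 'a, 'c, 'z) twocat_scheme \<Rightarrow> 'o \<Rightarrow> ('a, ('a, 'c) tri, ('a, 'c) tri2) twocat" where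
  "lslice C x =
     \<lparr>Obj = {\<phi> \<in> Arr C. Trg C \<phi> = x},
      Arr = lax_triangles C x,
      Src = d1, Trg = d0,
      Idn = (\<lambda>\<phi>. Tri (Idn C (Src C \<phi>)) \<phi> \<phi> (Idn2 C \<phi>)),
      Cmp = tri_comp C,
      Cell = {Tri2 s t \<gamma> | s t \<gamma>.
        s \<in> lax_triangles C x \<and> t \<in> lax_triangles C x \<and> d1 s = d1 t \<and> d0 s = d0 t \<and>
        \<gamma> \<in> Cell C \<and> Src2 C \<gamma> = d2 s \<and> Trg2 C \<gamma> = d2 t \<and>
        VCmp C (tcell t) (HCmp C (Idn2 C (d0 t)) \<gamma>) = tcell s},
      Src2 = src_tri, Trg2 = trg_tri,
      Idn2 = (\<lambda>s. Tri2 s s (Idn2 C (d2 s))),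
      VCmp = (\<lambda>\<tau> \<sigma>. Tri2 (src_tri \<sigma>) (trg_tri \<tau>) (VCmp C (cell_tri \<tau>) (cell_tri \<sigma>))),
      HCmp = (\<lambda>\<tau> \<sigma>. Tri2 (tri_comp C (src_tri \<tau>) (src_tri \<sigma>)) (tri_comp C (trg_tri \<tau>) (trg_tri \<sigma>))
                        (HCmp C (cell_tri \<tau>) (cell_tri \<sigma>)))\<rparr>"

definition dom_fun :: "('o, 'a, 'c, 'z) twocat_scheme \<Rightarrow> ('a, ('a, 'c) tri, ('a, 'c) tri2, 'o, 'a, 'c) twofun" where
  "dom_fun C = \<lparr>T0 = Src C, T1 = d2, T2 = cell_tri\<rparr>"

definition slice_fun ::
  "('o, 'a, 'c, 'p, 'b, 'd) twofun \<Rightarrow>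
   ('a, ('a, 'c) tri, ('a, 'c) tri2, 'b, ('b, 'd) tri, ('b, 'd) tri2) twofun" where
  "slice_fun F =
     \<lparr>T0 = T1 F, T1 = map_tri (T1 F) (T2 F), T2 = map_tri2 (T1 F) (T2 F)\<rparr>"

text \<open>The isomorphism between a slice of a power of a 2-category and the product of its slices.\<close>

definition unzip_tri :: "('a list, 'c list) tri \<Rightarrow> ('a, 'c) tri list" where
  "unzip_tri t =
     map (\<lambda>i. Tri (d2 t ! i) (d1 t ! i) (d0 t ! i) (tcell t ! i)) [0..<length (d0 t)]"

definition unzip_tri2 :: "('a list, 'c list) tri2 \<Rightarrow> ('a, 'c) tri2 list" where
  "unzip_tri2 \<tau> =
     map (\<lambda>i. Tri2 (unzip_tri (src_tri \<tau>) ! i) (unzip_tri (trg_tri \<tau>) ! i) (cell_tri \<tau> ! i))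
       [0..<length (d0 (src_tri \<tau>))]"

definition unzip_fun ::
  "('a list, ('a list, 'c list) tri, ('a list, 'c list) tri2,
    'a list, ('a, 'c) tri list, ('a, 'c) tri2 list) twofun" where
  "unzip_fun = \<lparr>T0 = id, T1 = unzip_tri, T2 = unzip_tri2\<rparr>"

subsection \<open>Components and lali-terminal objects\<close>

definition conn :: "('o, 'a, 'z) cat_scheme \<Rightarrow> 'o \<Rightarrow> 'o \<Rightarrow> bool" where
  "conn C x y \<longleftrightarrow>
     x \<in> Obj C \<and> y \<in> Obj C \<and> equivclp (\<lambda>p q. \<exists>f\<in>Arr C. Src C f = p \<and> Trg C f = q) x y"

definition Hom :: "('o, 'a, 'c, 'z) twocat_scheme \<Rightarrow> 'o \<Rightarrow> 'o \<Rightarrow> ('a, 'c) cat" where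
  "Hom C x y =
     \<lparr>Obj = homset C x y,
      Arr = {c \<in> Cell C. Src2 C c \<in> homset C x y \<and> Trg2 C c \<in> homset C x y},
      Src = Src2 C, Trg = Trg2 C, Idn = Idn2 C, Cmp = VCmp C\<rparr>"

definition terminal :: "('o, 'a, 'z) cat_scheme \<Rightarrow> 'o \<Rightarrow> bool" where
  "terminal C t \<longleftrightarrow> t \<in> Obj C \<and> (\<forall>x\<in>Obj C. \<exists>!f. f \<in> homset C x t)"

definition local_lali_terminal :: "('o, 'a, 'c, 'z) twocat_scheme \<Rightarrow> 'o \<Rightarrow> bool" where
  "local_lali_terminal C v \<longleftrightarrow>
     v \<in> Obj C \<and> (\<forall>x. conn C x v \<longrightarrow> (\<exists>t. terminal (Hom C x v) t)) \<and>
     terminal (Hom C v v) (Idn C v)"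


section \<open>The category of finite non-empty ordinals and order-preserving surjections\<close>

text \<open>
  The ordinal with \<open>n\<close> elements is \<open>{0,\<dots>,n-1}\<close>; accordingly all indices start at 0.
  A map with domain the ordinal \<open>m\<close> is the list of its \<open>m\<close> values.  As the maps are surjective,
  the list determines the codomain.
\<close>

definition osurj :: "nat \<Rightarrow> nat \<Rightarrow> nat list \<Rightarrow> bool" where
  "osurj m n f \<longleftrightarrow> 1 \<le> m \<and> 1 \<le> n \<and> length f = m \<and> sorted f \<and> set f = {..<n}"

definition ocod :: "nat list \<Rightarrow> nat" where
  "ocod f = card (set f)"

definition oid :: "nat \<Rightarrow> nat list" where
  "oid n = [0..<n]"

definition ocomp :: "nat list \<Rightarrow> nat list \<Rightarrow> nat list" where
  "ocomp g f = map (\<lambda>x. g ! x) f"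

definition bang :: "nat \<Rightarrow> nat list" where
  "bang n = replicate n 0"

definition preim :: "nat list \<Rightarrow> nat \<Rightarrow> nat set" where
  "preim g i = {j. j < length g \<and> g ! j = i}"

definition psize :: "nat list \<Rightarrow> nat \<Rightarrow> nat" where
  "psize g i = card (preim g i)"

text \<open>
  \<open>induced g f i\<close> is \<open>f\<^sup>i\<close>, the restriction of \<open>f\<close> to the preimage of \<open>i\<close> under \<open>g \<circ> f\<close>, with values
  in the preimage of \<open>i\<close> under \<open>g\<close>; both preimages are identified with ordinals by counting
  the smaller elements.
\<close>

definition induced :: "nat list \<Rightarrow> nat list \<Rightarrow> nat \<Rightarrow> nat list" where
  "induced g f i = map (\<lambda>x. card {j \<in> preim g i. j < x}) (nths f (preim (ocomp g f) i))"

text \<open>The \<open>i\<close>-th block of a sequence indexed by the domain of \<open>g\<close>.\<close>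

definition block :: "nat list \<Rightarrow> nat \<Rightarrow> 'x list \<Rightarrow> 'x list" where
  "block g i xs = nths xs (preim g i)"

text \<open>Only identity 2-cells: a 2-cell is the 1-cell of which it is the identity.\<close>

definition Deltas :: "(nat, nat list, nat list) twocat" where
  "Deltas =
     \<lparr>Obj = {n. 1 \<le> n}, Arr = {f. osurj (length f) (ocod f) f},
      Src = length, Trg = ocod, Idn = oid, Cmp = ocomp,
      Cell = {f. osurj (length f) (ocod f) f}, Src2 = id, Trg2 = id, Idn2 = id,
      VCmp = (\<lambda>g f. f), HCmp = ocomp\<rparr>"

definition Deltas_fib ::
  "nat \<Rightarrow> (nat list, (nat list, nat list) tri, (nat list, nat list) tri2,
           nat list, nat list list, nat list list) twofun" where
  "Deltas_fib n =
     \<lparr>T0 = (\<lambda>g. map (psize g) [0..<n]),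
      T1 = (\<lambda>t. map (induced (d0 t) (d2 t)) [0..<n]),
      T2 = (\<lambda>\<tau>. map (induced (d0 (src_tri \<tau>)) (cell_tri \<tau>)) [0..<n])\<rparr>"


section \<open>Constant-free non-symmetric categorical operads\<close>

record ('o, 'm) operad =
  Cat :: "nat \<Rightarrow> ('o, 'm) cat"
  mu0 :: "nat list \<Rightarrow> 'o \<Rightarrow> 'o list \<Rightarrow> 'o"
  mu1 :: "nat list \<Rightarrow> 'm \<Rightarrow> 'm list \<Rightarrow> 'm"
  unit :: "'o"

text \<open>\<open>fibcat P g\<close> is the product of the categories \<open>Cat P k\<^sub>i\<close> for the fibers \<open>k\<^sub>i\<close> of \<open>g\<close>.\<close>

definition fibcat :: "('o, 'm) operad \<Rightarrow> nat list \<Rightarrow> ('o list, 'm list) cat" where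
  "fibcat P g = list_cat (map (\<lambda>i. Cat P (psize g i)) [0..<ocod g])"

definition unit_arr :: "('o, 'm) operad \<Rightarrow> 'm" where
  "unit_arr P = Idn (Cat P 1) (unit P)"

definition operad :: "('o, 'm) operad \<Rightarrow> bool" where
  "operad P \<longleftrightarrow>
     (\<forall>n\<ge>1. category (Cat P n)) \<and>
     unit P \<in> Obj (Cat P 1) \<and>
     (\<forall>k n g. osurj k n g \<longrightarrow>
        is_functor (pair_cat (Cat P n) (fibcat P g)) (Cat P k)
          (\<lambda>(c, bs). mu0 P g c bs) (\<lambda>(c, bs). mu1 P g c bs)) \<and>
     (\<forall>m k n f g. osurj m k f \<longrightarrow> osurj k n g \<longrightarrow>
        (\<forall>c\<in>Obj (Cat P n). \<forall>bs\<in>Obj (fibcat P g). \<forall>xs\<in>Obj (fibcat P f).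
           mu0 P f (mu0 P g c bs) xs =
           mu0 P (ocomp g f) c
             (map (\<lambda>i. mu0 P (induced g f i) (bs ! i) (block g i xs)) [0..<n])) \<and>
        (\<forall>c\<in>Arr (Cat P n). \<forall>bs\<in>Arr (fibcat P g). \<forall>xs\<in>Arr (fibcat P f).
           mu1 P f (mu1 P g c bs) xs =
           mu1 P (ocomp g f) c
             (map (\<lambda>i. mu1 P (induced g f i) (bs ! i) (block g i xs)) [0..<n]))) \<and>
     (\<forall>n\<ge>1.
        (\<forall>a\<in>Obj (Cat P n).
           mu0 P (oid n) a (replicate n (unit P)) = a \<and> mu0 P (bang n) (unit P) [a] = a) \<and>
        (\<forall>a\<in>Arr (Cat P n).
           mu1 P (oid n) a (replicate n (unit_arr P)) = a \<and> mu1 P (bang n) (unit_arr P) [a] = a))"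

record ('o, 'm, 'p, 'n) opmap =
  O0 :: "nat \<Rightarrow> 'o \<Rightarrow> 'p"
  O1 :: "nat \<Rightarrow> 'm \<Rightarrow> 'n"

text \<open>A family of maps indexed by arities, applied to a sequence indexed by the codomain of \<open>g\<close>.\<close>

definition mapfib :: "(nat \<Rightarrow> 'x \<Rightarrow> 'y) \<Rightarrow> nat list \<Rightarrow> 'x list \<Rightarrow> 'y list" where
  "mapfib F g xs = map (\<lambda>i. F (psize g i) (xs ! i)) [0..<ocod g]"

definition operad_morphism ::
  "('o, 'm) operad \<Rightarrow> ('p, 'n) operad \<Rightarrow> ('o, 'm, 'p, 'n) opmap \<Rightarrow> bool" where
  "operad_morphism P Q F \<longleftrightarrow>
     (\<forall>n\<ge>1. is_functor (Cat P n) (Cat Q n) (O0 F n) (O1 F n)) \<and>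
     O0 F 1 (unit P) = unit Q \<and>
     (\<forall>k n g. osurj k n g \<longrightarrow>
        (\<forall>c\<in>Obj (Cat P n). \<forall>bs\<in>Obj (fibcat P g).
           O0 F k (mu0 P g c bs) = mu0 Q g (O0 F n c) (mapfib (O0 F) g bs)) \<and>
        (\<forall>c\<in>Arr (Cat P n). \<forall>bs\<in>Arr (fibcat P g).
           O1 F k (mu1 P g c bs) = mu1 Q g (O1 F n c) (mapfib (O1 F) g bs)))"

definition oprestrict ::
  "('o, 'm) operad \<Rightarrow> ('o, 'm, 'p, 'n) opmap \<Rightarrow> ('o, 'm, 'p, 'n) opmap" where
  "oprestrict P F =
     \<lparr>O0 = (\<lambda>n. restrict (O0 F n) (if 1 \<le> n then Obj (Cat P n) else {})),
      O1 = (\<lambda>n. restrict (O1 F n) (if 1 \<le> n then Arr (Cat P n) else {}))\<rparr>"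

definition opid :: "('o, 'm, 'o, 'm) opmap" where
  "opid = \<lparr>O0 = (\<lambda>n. id), O1 = (\<lambda>n. id)\<rparr>"

definition opcomp ::
  "('p, 'n, 'q, 'r) opmap \<Rightarrow> ('o, 'm, 'p, 'n) opmap \<Rightarrow> ('o, 'm, 'q, 'r) opmap" where
  "opcomp G F = \<lparr>O0 = (\<lambda>n. O0 G n \<circ> O0 F n), O1 = (\<lambda>n. O1 G n \<circ> O1 F n)\<rparr>"

text \<open>
  The category of operads whose objects and morphisms are drawn from the types \<open>'o\<close> and \<open>'m\<close>.
  An arrow records its source and target; its underlying family of maps is undefined
  outside the carriers of the source, so that equality of arrows is equality of morphisms.
\<close>

definition Oper ::
  "(('o, 'm) operad,
    ('o, 'm) operad \<times> ('o, 'm, 'o, 'm) opmap \<times> ('o, 'm) operad) cat" where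
  "Oper =
     \<lparr>Obj = {P. operad P},
      Arr = {(P, F, Q). operad P \<and> operad Q \<and> operad_morphism P Q F \<and> oprestrict P F = F},
      Src = (\<lambda>(P, F, Q). P), Trg = (\<lambda>(P, F, Q). Q),
      Idn = (\<lambda>P. (P, oprestrict P opid, P)),
      Cmp = (\<lambda>(Q, G, R) (P, F, Q'). (P, oprestrict P (opcomp G F), R))\<rparr>"


section \<open>Split-fibered non-symmetric operadic 2-categories\<close>

text \<open>
  \<open>Lali x\<close> is the chosen local lali-terminal object \<open>u\<^sub>x\<close> of the component of \<open>x\<close>, and \<open>Ter x\<close> is the
  chosen terminal object \<open>\<epsilon>\<^sub>x\<close> of the category of 1-cells from \<open>x\<close> to \<open>u\<^sub>x\<close>.
\<close>

record ('o, 'a, 'c) op2cat = "('o, 'a, 'c) twocat" +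
  Card :: "('o, 'a, 'c, nat, nat list, nat list) twofun"
  Fib :: "'o \<Rightarrow> ('a, ('a, 'c) tri, ('a, 'c) tri2, 'o list, 'a list, 'c list) twofun"
  Lali :: "'o \<Rightarrow> 'o"
  Ter :: "'o \<Rightarrow> 'a"

abbreviation ncard :: "('o, 'a, 'c, 'z) op2cat_scheme \<Rightarrow> 'o \<Rightarrow> nat" where
  "ncard \<O> x \<equiv> T0 (Card \<O>) x"

definition chosen_objects :: "('o, 'a, 'c, 'z) op2cat_scheme \<Rightarrow> 'o set" where
  "chosen_objects \<O> = Lali \<O> ` Obj \<O>"

text \<open>
  The product over \<open>i\<close> of the fiber functors of the objects \<open>\<phi>\<^sub>i\<close>, followed by the isomorphism that
  concatenates the powers.
\<close>

definition Fib_concat ::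
  "('o, 'a, 'c, 'z) op2cat_scheme \<Rightarrow> 'o list \<Rightarrow>
   ('a list, ('a, 'c) tri list, ('a, 'c) tri2 list, 'o list, 'a list, 'c list) twofun" where
  "Fib_concat \<O> ps =
     \<lparr>T0 = (\<lambda>zs. concat (map2 (\<lambda>p. T0 (Fib \<O> p)) ps zs)),
      T1 = (\<lambda>zs. concat (map2 (\<lambda>p. T1 (Fib \<O> p)) ps zs)),
      T2 = (\<lambda>zs. concat (map2 (\<lambda>p. T2 (Fib \<O> p)) ps zs))\<rparr>"

definition fiber_axiom :: "('o, 'a, 'c, 'z) op2cat_scheme \<Rightarrow> bool" where
  "fiber_axiom \<O> \<longleftrightarrow>
     (\<forall>\<phi>\<in>Arr \<O>.
        teq (lslice (lslice \<O> (Trg \<O> \<phi>)) \<phi>)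
          (tcomp (Fib_concat \<O> (T0 (Fib \<O> (Trg \<O> \<phi>)) \<phi>))
             (tcomp unzip_fun (slice_fun (Fib \<O> (Trg \<O> \<phi>)))))
          (tcomp (Fib \<O> (Src \<O> \<phi>)) (slice_fun (dom_fun \<O>))))"

text \<open>
  \<open>Fib (u\<^sub>c)\<close> is compared with the domain functor on the full sub-2-category of the slice over \<open>u\<^sub>c\<close>
  whose objects are the terminal 1-cells \<open>\<epsilon>\<^sub>y\<close>, which is isomorphic to the component \<open>c\<close> by
  the domain functor.  On the other objects of the slice the two need not agree: for the
  integration of an operad, the fiber of \<open>[!;a';\<alpha>]\<close> from \<open>[m,a]\<close> to \<open>[1,e]\<close> is \<open>[m,a']\<close>.
\<close>

definition unit_axiom :: "('o, 'a, 'c, 'z) op2cat_scheme \<Rightarrow> bool" where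
  "unit_axiom \<O> \<longleftrightarrow>
     (\<forall>v\<in>chosen_objects \<O>.
        ncard \<O> v = 1 \<and>
        teq (full_sub (lslice \<O> v) (Ter \<O> ` {y \<in> Obj \<O>. Lali \<O> y = v}))
          (Fib \<O> v) (tcomp singl (dom_fun \<O>)))"

text \<open>All cardinalities are non-zero, so there is a chosen object in every component.\<close>

definition operadic_2category :: "('o, 'a, 'c, 'z) op2cat_scheme \<Rightarrow> bool" where
  "operadic_2category \<O> \<longleftrightarrow>
     two_category \<O> \<and>
     two_functor \<O> Deltas (Card \<O>) \<and>
     (\<forall>x\<in>Obj \<O>. two_functor (lslice \<O> x) (pow \<O> (ncard \<O> x)) (Fib \<O> x)) \<and>
     (\<forall>x\<in>Obj \<O>. local_lali_terminal \<O> (Lali \<O> x) \<and> conn \<O> x (Lali \<O> x)) \<and>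
     (\<forall>x y. conn \<O> x y \<longrightarrow> Lali \<O> x = Lali \<O> y) \<and>
     (\<forall>x\<in>Obj \<O>. terminal (Hom \<O> x (Lali \<O> x)) (Ter \<O> x)) \<and>
     (\<forall>v\<in>chosen_objects \<O>. Ter \<O> v = Idn \<O> v) \<and>
     (\<forall>x\<in>Obj \<O>. teq (lslice \<O> x)
        (tcomp (pow_fun (Card \<O>)) (Fib \<O> x))
        (tcomp (Deltas_fib (ncard \<O> x)) (slice_fun (Card \<O>)))) \<and>
     unit_axiom \<O> \<and>
     (\<forall>x\<in>Obj \<O>. set (T0 (Fib \<O> x) (Idn \<O> x)) \<subseteq> chosen_objects \<O>) \<and>
     (\<forall>\<phi>\<in>Arr \<O>. T1 (Fib \<O> (Trg \<O> \<phi>)) (Tri \<phi> \<phi> (Idn \<O> (Trg \<O> \<phi>)) (Idn2 \<O> \<phi>)) =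
        map (Ter \<O>) (T0 (Fib \<O> (Trg \<O> \<phi>)) \<phi>)) \<and>
     fiber_axiom \<O>"

definition operadic_cartesian :: "('o, 'a, 'c, 'z) op2cat_scheme \<Rightarrow> 'a \<Rightarrow> bool" where
  "operadic_cartesian \<O> \<phi> \<longleftrightarrow>
     \<phi> \<in> Arr \<O> \<and>
     (\<forall>\<theta>\<in>Arr \<O>. \<forall>\<psi>s f.
        Trg \<O> \<theta> = Trg \<O> \<phi> \<longrightarrow>
        length \<psi>s = ncard \<O> (Trg \<O> \<phi>) \<longrightarrow>
        (\<forall>i<ncard \<O> (Trg \<O> \<phi>).
           \<psi>s ! i \<in> homset \<O> (T0 (Fib \<O> (Trg \<O> \<phi>)) \<theta> ! i) (T0 (Fib \<O> (Trg \<O> \<phi>)) \<phi> ! i)) \<longrightarrow>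
        osurj (ncard \<O> (Src \<O> \<theta>)) (ncard \<O> (Src \<O> \<phi>)) f \<longrightarrow>
        ocomp (T1 (Card \<O>) \<phi>) f = T1 (Card \<O>) \<theta> \<longrightarrow>
        (\<forall>i<ncard \<O> (Trg \<O> \<phi>). induced (T1 (Card \<O>) \<phi>) f i = T1 (Card \<O>) (\<psi>s ! i)) \<longrightarrow>
        (\<exists>!t. t \<in> lax_triangles \<O> (Trg \<O> \<phi>) \<and> d0 t = \<phi> \<and> d1 t = \<theta> \<and>
           T1 (Fib \<O> (Trg \<O> \<phi>)) t = \<psi>s \<and> T1 (Card \<O>) (d2 t) = f))"

definition lift_data :: "('o, 'a, 'c, 'z) op2cat_scheme \<Rightarrow> nat list \<Rightarrow> 'o \<Rightarrow> 'o list \<Rightarrow> bool" where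
  "lift_data \<O> f b as \<longleftrightarrow>
     b \<in> Obj \<O> \<and> set as \<subseteq> Obj \<O> \<and> length as = ncard \<O> b \<and>
     osurj (length f) (ncard \<O> b) f \<and> (\<forall>j<ncard \<O> b. psize f j = ncard \<O> (as ! j))"

definition is_lift ::
  "('o, 'a, 'c, 'z) op2cat_scheme \<Rightarrow> nat list \<Rightarrow> 'o \<Rightarrow> 'o list \<Rightarrow> 'a \<Rightarrow> bool" where
  "is_lift \<O> f b as \<phi> \<longleftrightarrow>
     operadic_cartesian \<O> \<phi> \<and> Trg \<O> \<phi> = b \<and> T1 (Card \<O>) \<phi> = f \<and> T0 (Fib \<O> b) \<phi> = as"

definition fibered :: "('o, 'a, 'c, 'z) op2cat_scheme \<Rightarrow> bool" where
  "fibered \<O> \<longleftrightarrow>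
     operadic_2category \<O> \<and>
     (\<forall>n\<in>Obj Deltas. \<exists>x\<in>Obj \<O>. conn Deltas (ncard \<O> x) n) \<and>
     (\<forall>f b as. lift_data \<O> f b as \<longrightarrow> (\<exists>\<phi>. is_lift \<O> f b as \<phi>))"

record ('o, 'a, 'c) sfib = "('o, 'a, 'c) op2cat" +
  Lift :: "nat list \<Rightarrow> 'o \<Rightarrow> 'o list \<Rightarrow> 'a"

text \<open>
  In the last condition, \<open>Lift f (Src (Lift g c bs)) as\<close> ends at the domain of \<open>Lift g c bs\<close> and not
  at \<open>c\<close>, so it is composed with \<open>Lift g c bs\<close>.
\<close>

definition split_fibered :: "('o, 'a, 'c) sfib \<Rightarrow> bool" where
  "split_fibered \<O> \<longleftrightarrow>
     fibered \<O> \<and>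
     (\<forall>f b as. lift_data \<O> f b as \<longrightarrow> is_lift \<O> f b as (Lift \<O> f b as)) \<and>
     (\<forall>c\<in>Obj \<O>. Lift \<O> (oid (ncard \<O> c)) c (T0 (Fib \<O> c) (Idn \<O> c)) = Idn \<O> c) \<and>
     (\<forall>c\<in>Obj \<O>. Lift \<O> (bang (ncard \<O> c)) (Lali \<O> c) [c] = Ter \<O> c) \<and>
     (\<forall>f g c bs as.
        lift_data \<O> g c bs \<longrightarrow>
        lift_data \<O> f (Src \<O> (Lift \<O> g c bs)) as \<longrightarrow>
        Cmp \<O> (Lift \<O> g c bs) (Lift \<O> f (Src \<O> (Lift \<O> g c bs)) as) =
        Lift \<O> (ocomp g f) c
          (map (\<lambda>i. Src \<O> (Lift \<O> (induced g f i) (bs ! i) (block g i as))) [0..<ncard \<O> c]))"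

text \<open>
  Preservation of the 1-cells \<open>\<epsilon>\<^sub>x\<close> is not required; in the split-fibered case it follows from the
  preservation of lifts.
\<close>

definition operadic_2functor ::
  "('o, 'a, 'c, 'z) op2cat_scheme \<Rightarrow> ('p, 'b, 'd, 'y) op2cat_scheme \<Rightarrow>
   ('o, 'a, 'c, 'p, 'b, 'd) twofun \<Rightarrow> bool" where
  "operadic_2functor \<O> \<O>' G \<longleftrightarrow>
     two_functor \<O> \<O>' G \<and>
     teq \<O> (tcomp (Card \<O>') G) (Card \<O>) \<and>
     (\<forall>x\<in>Obj \<O>. teq (lslice \<O> x)
        (tcomp (Fib \<O>' (T0 G x)) (slice_fun G)) (tcomp (pow_fun G) (Fib \<O> x))) \<and>
     (\<forall>x\<in>Obj \<O>. T0 G (Lali \<O> x) = Lali \<O>' (T0 G x))"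

definition sfib_morphism ::
  "('o, 'a, 'c) sfib \<Rightarrow> ('p, 'b, 'd) sfib \<Rightarrow> ('o, 'a, 'c, 'p, 'b, 'd) twofun \<Rightarrow> bool" where
  "sfib_morphism \<O> \<O>' G \<longleftrightarrow>
     operadic_2functor \<O> \<O>' G \<and>
     (\<forall>f b as. lift_data \<O> f b as \<longrightarrow>
        T1 G (Lift \<O> f b as) = Lift \<O>' f (T0 G b) (map (T0 G) as))"

definition tid :: "('o, 'a, 'c, 'o, 'a, 'c) twofun" where
  "tid = \<lparr>T0 = id, T1 = id, T2 = id\<rparr>"

definition SFib ::
  "(('o, 'a, 'c) sfib,
    ('o, 'a, 'c) sfib \<times> ('o, 'a, 'c, 'o, 'a, 'c) twofun \<times> ('o, 'a, 'c) sfib) cat" where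
  "SFib =
     \<lparr>Obj = {\<O>. split_fibered \<O>},
      Arr = {(\<O>, G, \<O>'). split_fibered \<O> \<and> split_fibered \<O>' \<and>
               sfib_morphism \<O> \<O>' G \<and> trestrict \<O> G = G},
      Src = (\<lambda>(\<O>, G, \<O>'). \<O>), Trg = (\<lambda>(\<O>, G, \<O>'). \<O>'),
      Idn = (\<lambda>\<O>. (\<O>, trestrict \<O> tid, \<O>)),
      Cmp = (\<lambda>(\<O>', H, \<O>'') (\<O>, G, \<U>). (\<O>, trestrict \<O> (tcomp H G), \<O>''))\<rparr>"


section \<open>Integration\<close>

text \<open>\<open>Int1 [m,a] [k,b] f as \<alpha>\<close> is the 1-cell \<open>[f;a\<^sub>1,\<dots>,a\<^sub>k;\<alpha>]\<close> from \<open>[m,a]\<close> to \<open>[k,b]\<close>.\<close>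

datatype ('o, 'm) int1 =
  Int1 (src1: "nat \<times> 'o") (trg1: "nat \<times> 'o") (imap: "nat list") (iobs: "'o list") (iarr: 'm)

datatype ('o, 'm) int2 =
  Int2 (src2: "('o, 'm) int1") (trg2: "('o, 'm) int1") (icomps: "'m list")

definition int_arrows :: "('o, 'm) operad \<Rightarrow> ('o, 'm) int1 set" where
  "int_arrows P =
     {Int1 (m, a) (k, b) f as \<alpha> | m a k b f as \<alpha>.
        a \<in> Obj (Cat P m) \<and> b \<in> Obj (Cat P k) \<and> osurj m k f \<and> as \<in> Obj (fibcat P f) \<and>
        \<alpha> \<in> homset (Cat P m) (mu0 P f b as) a}"

definition int_comp ::
  "('o, 'm) operad \<Rightarrow> ('o, 'm) int1 \<Rightarrow> ('o, 'm) int1 \<Rightarrow> ('o, 'm) int1" where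
  "int_comp P G F =
     Int1 (src1 F) (trg1 G) (ocomp (imap G) (imap F))
       (map (\<lambda>i. mu0 P (induced (imap G) (imap F) i) (iobs G ! i) (block (imap G) i (iobs F)))
          [0..<fst (trg1 G)])
       (Cmp (Cat P (fst (src1 F))) (iarr F)
          (mu1 P (imap F) (iarr G) (Idn (fibcat P (imap F)) (iobs F))))"

definition int_cells :: "('o, 'm) operad \<Rightarrow> ('o, 'm) int2 set" where
  "int_cells P =
     {Int2 s t \<delta> | s t \<delta>.
        s \<in> int_arrows P \<and> t \<in> int_arrows P \<and>
        src1 s = src1 t \<and> trg1 s = trg1 t \<and> imap s = imap t \<and>
        \<delta> \<in> homset (fibcat P (imap s)) (iobs s) (iobs t) \<and>
        Cmp (Cat P (fst (src1 t))) (iarr t)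
          (mu1 P (imap t) (Idn (Cat P (fst (trg1 t))) (snd (trg1 t))) \<delta>) = iarr s}"

definition int_fib_tri ::
  "(('o, 'm) int1, ('o, 'm) int2) tri \<Rightarrow> ('o, 'm) int1 list" where
  "int_fib_tri t =
     map (\<lambda>i. Int1 (psize (imap (d1 t)) i, iobs (d1 t) ! i) (psize (imap (d0 t)) i, iobs (d0 t) ! i)
                (induced (imap (d0 t)) (imap (d2 t)) i)
                (block (imap (d0 t)) i (iobs (d2 t)))
                (icomps (tcell t) ! i))
       [0..<fst (trg1 (d0 t))]"

definition integ :: "('o, 'm) operad \<Rightarrow> (nat \<times> 'o, ('o, 'm) int1, ('o, 'm) int2) sfib" where
  "integ P =
     \<lparr>Obj = {(m, a). 1 \<le> m \<and> a \<in> Obj (Cat P m)},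
      Arr = int_arrows P, Src = src1, Trg = trg1,
      Idn = (\<lambda>(m, a). Int1 (m, a) (m, a) (oid m) (replicate m (unit P)) (Idn (Cat P m) a)),
      Cmp = int_comp P,
      Cell = int_cells P, Src2 = src2, Trg2 = trg2,
      Idn2 = (\<lambda>s. Int2 s s (Idn (fibcat P (imap s)) (iobs s))),
      VCmp = (\<lambda>d c. Int2 (src2 c) (trg2 d)
        (Cmp (fibcat P (imap (src2 c))) (icomps d) (icomps c))),
      HCmp = (\<lambda>d c. Int2 (int_comp P (src2 d) (src2 c)) (int_comp P (trg2 d) (trg2 c))
        (map (\<lambda>i. mu1 P (induced (imap (src2 d)) (imap (src2 c)) i) (icomps d ! i)
                    (block (imap (src2 d)) i (icomps c)))
           [0..<fst (trg1 (src2 d))])),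
      Card = \<lparr>T0 = fst, T1 = imap, T2 = (\<lambda>c. imap (src2 c))\<rparr>,
      Fib = (\<lambda>x.
        \<lparr>T0 = (\<lambda>\<phi>. map (\<lambda>i. (psize (imap \<phi>) i, iobs \<phi> ! i)) [0..<fst (trg1 \<phi>)]),
         T1 = int_fib_tri,
         T2 = (\<lambda>\<tau>. map (\<lambda>i. Int2 (int_fib_tri (src_tri \<tau>) ! i) (int_fib_tri (trg_tri \<tau>) ! i)
                              (block (imap (d0 (src_tri \<tau>))) i (icomps (cell_tri \<tau>))))
                  [0..<fst (trg1 (d0 (src_tri \<tau>)))])\<rparr>),
      Lali = (\<lambda>x. (1, unit P)),
      Ter = (\<lambda>(m, a). Int1 (m, a) (1, unit P) (bang m) [a] (Idn (Cat P m) a)),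
      Lift = (\<lambda>g (n, c) bs.
        Int1 (length g, mu0 P g c (map snd bs)) (n, c) g (map snd bs)
          (Idn (Cat P (length g)) (mu0 P g c (map snd bs))))\<rparr>"

definition integ_map ::
  "('o, 'm, 'p, 'n) opmap \<Rightarrow>
   (nat \<times> 'o, ('o, 'm) int1, ('o, 'm) int2, nat \<times> 'p, ('p, 'n) int1, ('p, 'n) int2) twofun" where
  "integ_map F =
     (let F0 = (\<lambda>(m, a). (m, O0 F m a));
          F1 = (\<lambda>s. Int1 (F0 (src1 s)) (F0 (trg1 s)) (imap s)
                      (mapfib (O0 F) (imap s) (iobs s)) (O1 F (fst (src1 s)) (iarr s)))
      in \<lparr>T0 = F0, T1 = F1,
          T2 = (\<lambda>c. Int2 (F1 (src2 c)) (F1 (trg2 c)) (mapfib (O1 F) (imap (src2 c)) (icomps c)))\<rparr>)"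

definition integ_arr ::
  "('o, 'm) operad \<times> ('o, 'm, 'p, 'n) opmap \<times> ('p, 'n) operad \<Rightarrow>
   (nat \<times> 'o, ('o, 'm) int1, ('o, 'm) int2) sfib \<times>
   (nat \<times> 'o, ('o, 'm) int1, ('o, 'm) int2, nat \<times> 'p, ('p, 'n) int1, ('p, 'n) int2) twofun \<times>
   (nat \<times> 'p, ('p, 'n) int1, ('p, 'n) int2) sfib" where
  "integ_arr = (\<lambda>(P, F, Q). (integ P, trestrict (integ P) (integ_map F), integ Q))"

end

theory Submission
  imports Defs
begin

text \<open>
  An order-preserving surjection cuts its domain into consecutive intervals, the \<open>i\<close>-th one starting
  at \<open>off f i\<close>.  All identities between induced maps and blocks reduce to
  \<open>off (g \<circ> f) i = off f (off g i)\<close>, and with them the axioms of the 2-category \<open>\<integral>P\<close> and of its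
  fibers reduce to functoriality and associativity of the operad composition, applied to whole
  sequences at once.  A chosen lift is cartesian because the 2-cell condition of a lax triangle
  over it determines the missing morphism \<open>\<alpha>\<close>.

  For fullness, a morphism \<open>G\<close> of split-fibered 2-categories is given on objects by maps \<open>F\<^sub>n\<close>, and on
  morphisms \<open>\<alpha>\<close> of \<open>P\<^sub>n\<close> one reads off \<open>F\<^sub>n \<alpha>\<close> from the image of \<open>[1;e,\<dots>,e;\<alpha>]\<close>.  Every 1-cell factors as
  \<open>[f;a\<^sub>1,\<dots>,a\<^sub>k;\<alpha>] = [f;a\<^sub>1,\<dots>,a\<^sub>k;1] \<circ> [1;e,\<dots>,e;\<alpha>]\<close> with first factor a lift, and the fibers of a
  2-cell \<open>\<delta>\<close>, viewed as a lax triangle \<open>s \<circ> 1 \<Rightarrow> t\<close>, are the 1-cells \<open>[1;e,\<dots>,e;\<delta>\<^sub>i]\<close>; so \<open>G\<close> is determined by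
  \<open>F\<close>.  That \<open>F\<close> preserves \<open>\<mu>\<close> on morphisms follows from
  \<open>\<mu>(\<gamma>,\<delta>) = \<mu>(\<gamma>,1) \<circ> \<mu>(1,\<delta>)\<close>: the first factor occurs in a composite of 1-cells with a lift, the
  second in the condition for a 2-cell into a lift.
\<close>

section \<open>Order-preserving surjections of finite ordinals\<close>

text \<open>The operadic structure is what keeps unary 1-cells unary under \<open>G\<close>:
  preservation of cardinality keeps the surjection an identity, preservation of fibers makes the
  objects over it images under \<open>F\<close>, and preservation of the chosen object
  \<open>[1,e]\<close> keeps them units. That \<open>F\<close> respects \<mu> on objects says that
  \<open>G\<close> preserves the domains of chosen lifts. A unary 1-cell runs against its morphism,
  so the order of composition is reversed in passing to 1-cells and reversed back when \<alpha> is
  read off. An obstacle of a different kind is that structure functions are arbitrary outside the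
  carriers. Equality of 2-functors therefore means agreement on the carrier (\<open>teq\<close>),
  arrows of both categories are restricted representatives, and many lemmas only record that images
  and fibers stay in carriers. Objects and morphisms of an operad satisfy the same combinatorial
  laws, so these are proved once for an abstract family of sets. A morphism of operads is visible in
  the unary 1-cells, which gives faithfulness.\<close>

definition off :: "nat list \<Rightarrow> nat \<Rightarrow> nat" where
  "off f i = card {j. j < length f \<and> f ! j < i}"

text \<open>Positions cut out by a threshold in a sorted list form such an initial segment; with
  this, counting them and comparing with the count become the same thing.\<close>

lemma down_closed_eq_lessThan:
  fixes S :: "nat set"
  assumes "finite S" "\<And>x y. y \<in> S \<Longrightarrow> x \<le> y \<Longrightarrow> x \<in> S"
  shows "S = {..<card S}"
proof (cases "S = {}")
  case False
  have "S = {..Max S}"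
    using assms(1) assms(2)[OF Max_in[OF assms(1) False]] by auto
  then show ?thesis
    by (metis card_atMost lessThan_Suc_atMost)
qed simp

text \<open>By sortedness the positions with value below \<open>i\<close> form an initial segment,
  and \<open>off f i\<close> is its length. Offsets are mostly handled through this equivalence
  rather than through the cardinality in their definition.\<close>

lemma less_off_iff:
  assumes "sorted f" "x < length f"
  shows "x < off f i \<longleftrightarrow> f ! x < i"
proof -
  let ?S = "{j. j < length f \<and> f ! j < i}"
  have "?S = {..<card ?S}"
  proof (rule down_closed_eq_lessThan)
    fix x y assume "y \<in> ?S" "x \<le> y"
    then show "x \<in> ?S"
      using sorted_nth_mono[OF assms(1), of x y] by auto
  qed simp
  then have "x \<in> ?S \<longleftrightarrow> x < off f i"
    unfolding off_def by blast
  then show ?thesis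
    using assms(2) by simp
qed

lemma off_le_length: "off f i \<le> length f"
proof -
  have "card {j. j < length f \<and> f ! j < i} \<le> card {..<length f}"
    by (rule card_mono) auto
  then show ?thesis
    by (simp add: off_def)
qed

lemma off_0 [simp]: "off f 0 = 0"
  by (simp add: off_def)

lemma off_mono: "i \<le> j \<Longrightarrow> off f i \<le> off f j"
  unfolding off_def by (rule card_mono) auto

text \<open>Converse of \<open>less_off_iff\<close>: if the two candidates differed, the smaller one
  would be a position on which the two equivalences disagree.\<close>

lemma off_eqI:
  assumes "sorted f" "k \<le> length f" "\<And>x. x < length f \<Longrightarrow> x < k \<longleftrightarrow> f ! x < i"
  shows "off f i = k"
proof (rule ccontr)
  assume "off f i \<noteq> k"
  then consider "off f i < k" | "k < off f i"
    by linarith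
  then show False
  proof cases
    case 1
    then show False
      using assms(2) assms(3)[of "off f i"] less_off_iff[OF assms(1), of "off f i" i] by auto
  next
    case 2
    then show False
      using assms(3)[of k] less_off_iff[OF assms(1), of k i] off_le_length[of f i] by auto
  qed
qed

lemma osurjD:
  assumes "osurj m n f"
  shows "1 \<le> m" "1 \<le> n" "length f = m" "sorted f" "set f = {..<n}" "ocod f = n"
  using assms by (auto simp: osurj_def ocod_def)

lemma osurj_nth: "osurj m n f \<Longrightarrow> x < m \<Longrightarrow> f ! x < n"
  using osurjD(3,5) nth_mem by blast

lemma osurj_ocod: "osurj m n f \<Longrightarrow> osurj (length f) (ocod f) f"
  using osurjD by fastforce

text \<open>From \<open>n\<close> on every value lies below the threshold. For \<open>i = n\<close>
  this is the end of the last interval.\<close>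

lemma off_cod:
  assumes "osurj m n f" "n \<le> i" shows "off f i = m"
proof (rule off_eqI)
  note D = osurjD[OF assms(1)]
  show "sorted f" "m \<le> length f"
    using D by auto
  show "x < m \<longleftrightarrow> f ! x < i" if "x < length f" for x
    using that assms(2) osurj_nth[OF assms(1), of x] by (simp add: D(3))
qed

lemma preim_off:
  assumes "sorted f" shows "preim f i = {off f i..<off f (Suc i)}"
proof -
  have "x \<in> preim f i \<longleftrightarrow> off f i \<le> x \<and> x < off f (Suc i)" for x
  proof (cases "x < length f")
    case True
    then show ?thesis
      unfolding preim_def mem_Collect_eq not_less[symmetric] less_off_iff[OF assms True]
      by (simp add: less_Suc_eq) linarith
  next
    case False
    then show ?thesis
      using off_le_length[of f "Suc i"] by (simp add: preim_def)
  qed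
  then show ?thesis by (intro set_eqI) simp
qed

lemma psize_off: "sorted f \<Longrightarrow> psize f i = off f (Suc i) - off f i"
  by (simp add: psize_def preim_off)

lemma off_Suc: "sorted f \<Longrightarrow> off f (Suc i) = off f i + psize f i"
  using off_mono[of i "Suc i" f] by (simp add: psize_off)

lemma psize_pos: "osurj m n f \<Longrightarrow> i < n \<Longrightarrow> 1 \<le> psize f i"
proof -
  assume f: "osurj m n f" and "i < n"
  then have "i \<in> set f" by (simp add: osurjD(5)[OF f])
  then obtain x where "x < length f" "f ! x = i"
    by (auto simp: in_set_conv_nth)
  then have "x \<in> preim f i" by (simp add: preim_def)
  moreover have "finite (preim f i)" by (simp add: preim_def)
  ultimately show ?thesis
    unfolding psize_def by (metis One_nat_def Suc_leI card_gt_0_iff empty_iff)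
qed

lemma off_add_less:
  assumes f: "osurj m n f" and i: "i < n" and j: "j < psize f i"
  shows "off f i + j < m" "f ! (off f i + j) = i"
proof -
  have s: "sorted f" using f by (rule osurjD)
  have "off f i + j \<in> preim f i"
    using j off_Suc[OF s, of i] by (simp add: preim_off[OF s])
  then show "off f i + j < m" "f ! (off f i + j) = i"
    by (auto simp: preim_def osurjD(3)[OF f])
qed

text \<open>The induction removes the last element, because \<open>nths_append\<close> shifts the
  index set only for the appended part.\<close>

lemma nths_atLeastLessThan:
  "b \<le> length xs \<Longrightarrow> nths xs {a..<b} = map ((!) xs) [a..<b]"
proof (induction xs arbitrary: a b rule: rev_induct)
  case Nil
  then show ?case by simp
next
  case (snoc x xs)
  show ?case
  proof (cases "b \<le> length xs")
    case True
    then show ?thesis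
      using snoc by (auto simp: nths_append nth_append nths_def)
  next
    case False
    then have b: "b = Suc (length xs)" using snoc.prems by simp
    \<comment> \<open>\<open>nths\<close> pairs entries with positions below
      \<open>length xs\<close>, so the extra index \<open>length xs\<close> selects nothing.\<close>
    have eq: "nths xs {a..<Suc (length xs)} = nths xs {a..<length xs}"
      unfolding nths_def by (rule arg_cong[where f="map fst"], rule filter_cong) (auto dest: set_zip_rightD)
    show ?thesis
      using snoc.IH[of "length xs" a]
      by (auto simp: nths_append eq b nth_append cong: map_cong)
  qed
qed

lemma block_off:
  assumes "sorted f" "length xs = length f"
  shows "block f i xs = map (\<lambda>j. xs ! (off f i + j)) [0..<psize f i]"
proof -
  have "block f i xs = map ((!) xs) [off f i..<off f (Suc i)]"
    using assms off_le_length[of f "Suc i"] by (simp add: block_def preim_off nths_atLeastLessThan)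
  also have "\<dots> = map (\<lambda>j. xs ! (off f i + j)) [0..<psize f i]"
    using assms(1) by (intro nth_equalityI) (auto simp: psize_off)
  finally show ?thesis .
qed

lemma length_block: "sorted f \<Longrightarrow> length xs = length f \<Longrightarrow> length (block f i xs) = psize f i"
  by (simp add: block_off)

lemma nth_block:
  "sorted f \<Longrightarrow> length xs = length f \<Longrightarrow> j < psize f i \<Longrightarrow> block f i xs ! j = xs ! (off f i + j)"
  by (simp add: block_off)

section \<open>Composites, induced maps and their offsets\<close>

lemma length_ocomp [simp]: "length (ocomp g f) = length f"
  by (simp add: ocomp_def)

lemma nth_ocomp [simp]: "x < length f \<Longrightarrow> ocomp g f ! x = g ! (f ! x)"
  by (simp add: ocomp_def)

lemma osurj_ocomp:
  assumes f: "osurj m k f" and g: "osurj k n g" shows "osurj m n (ocomp g f)"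
proof -
  have "sorted (ocomp g f)"
    using osurjD[OF f] osurjD[OF g] osurj_nth[OF f]
    by (auto simp: sorted_iff_nth_mono)
  moreover have "set (ocomp g f) = {..<n}"
    using osurjD(3,5)[OF f] osurjD(3,5)[OF g]
    by (simp add: ocomp_def) (metis lessThan_atLeast0 nth_image le_refl take_all)
  ultimately show ?thesis
    using osurjD[OF f] osurjD[OF g] by (simp add: osurj_def)
qed

text \<open>Applying \<open>less_off_iff\<close> twice: \<open>x\<close> lies before
  \<open>off f (off g i)\<close> iff \<open>f ! x\<close> lies before \<open>off g i\<close> iff
  \<open>g ! (f ! x) < i\<close>.\<close>

lemma off_ocomp:
  assumes f: "osurj m k f" and g: "osurj k n g"
  shows "off (ocomp g f) i = off f (off g i)"
  using off_le_length osurjD[OF osurj_ocomp[OF f g]] osurj_nth[OF f] osurjD[OF f] osurjD[OF g]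
  by (intro off_eqI) (auto simp: less_off_iff)

lemma psize_ocomp:
  assumes f: "osurj m k f" and g: "osurj k n g"
  shows "psize (ocomp g f) i = off f (off g (Suc i)) - off f (off g i)"
  using osurjD(4)[OF osurj_ocomp[OF f g]] by (simp add: psize_off off_ocomp[OF f g])

text \<open>Counting the elements of the interval starting at \<open>off g i\<close> that lie below
  a value of the block amounts to subtracting \<open>off g i\<close>. So an induced map is
  \<open>f\<close> with its argument shifted by \<open>off f (off g i)\<close> and its value by
  \<open>off g i\<close>; later identities are checked in this form.\<close>

lemma induced_off:
  assumes f: "osurj m k f" and g: "osurj k n g"
  shows "induced g f i = map (\<lambda>j. f ! (off f (off g i) + j) - off g i) [0..<psize (ocomp g f) i]"
proof -
  have sg: "sorted g" and sgf: "sorted (ocomp g f)"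
    using osurjD(4)[OF g] osurjD(4)[OF osurj_ocomp[OF f g]] by auto
  have c: "card {j \<in> preim g i. j < x} = x - off g i" if "x < off g (Suc i)" for x
  proof -
    have "{j \<in> preim g i. j < x} = {off g i..<x}"
      using that by (auto simp: preim_off[OF sg])
    then show ?thesis by simp
  qed
  \<comment> \<open>\<open>c\<close> is valid only up to the end of the block, so the values of
    \<open>f\<close> on this stretch must be shown to stay below it.\<close>
  have v: "f ! (off f (off g i) + j) < off g (Suc i)" if "j < psize (ocomp g f) i" for j
  proof -
    have "off f (off g i) + j < off f (off g (Suc i))"
      using that by (simp add: psize_ocomp[OF f g])
    then show ?thesis
      using less_off_iff[of f _ "off g (Suc i)"] osurjD(4)[OF f] off_le_length[of f]
      by (meson le_trans not_le)
  qed
  have "nths f (preim (ocomp g f) i) = map (\<lambda>j. f ! (off f (off g i) + j)) [0..<psize (ocomp g f) i]"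
    using block_off[OF sgf, of f i] by (simp add: block_def off_ocomp[OF f g])
  then show ?thesis
    using c v by (simp add: induced_def)
qed

lemma length_induced:
  "osurj m k f \<Longrightarrow> osurj k n g \<Longrightarrow> length (induced g f i) = psize (ocomp g f) i"
  by (simp add: induced_off)

lemma nth_induced:
  "osurj m k f \<Longrightarrow> osurj k n g \<Longrightarrow> j < psize (ocomp g f) i \<Longrightarrow>
    induced g f i ! j = f ! (off f (off g i) + j) - off g i"
  by (simp add: induced_off)

lemma add_less_off:
  assumes f: "osurj m k f" and g: "osurj k n g" and j: "j < psize (ocomp g f) i"
  shows "off f (off g i) + j < m" "off g i \<le> f ! (off f (off g i) + j)"
    "f ! (off f (off g i) + j) < off g (Suc i)"
proof -
  have l: "off f (off g i) + j < off f (off g (Suc i))"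
    using j by (simp add: psize_ocomp[OF f g])
  then show *: "off f (off g i) + j < m"
    using off_le_length[of f "off g (Suc i)"] osurjD(3)[OF f] by linarith
  show "off g i \<le> f ! (off f (off g i) + j)" "f ! (off f (off g i) + j) < off g (Suc i)"
    using less_off_iff[of f "off f (off g i) + j"] l * osurjD(3,4)[OF f]
    by (metis not_less le_add1)+
qed

lemma osurj_induced:
  assumes f: "osurj m k f" and g: "osurj k n g" and i: "i < n"
  shows "osurj (psize (ocomp g f) i) (psize g i) (induced g f i)"
proof -
  note fD = osurjD[OF f] and gD = osurjD[OF g]
  have gf: "osurj m n (ocomp g f)" using f g by (rule osurj_ocomp)
  have "sorted (induced g f i)"
    using add_less_off[OF f g] fD
    by (auto simp: sorted_iff_nth_mono length_induced[OF f g] nth_induced[OF f g] intro!: diff_le_mono)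
  moreover have "set (induced g f i) = {..<psize g i}"
  proof (intro equalityI subsetI)
    fix x assume "x \<in> set (induced g f i)"
    then obtain j where "j < psize (ocomp g f) i" "x = f ! (off f (off g i) + j) - off g i"
      by (auto simp: induced_off[OF f g])
    then show "x \<in> {..<psize g i}"
      using add_less_off[OF f g, of j i] by (auto simp: psize_off[OF gD(4)])
  next
    fix x assume "x \<in> {..<psize g i}"
    then have x: "off g i + x < off g (Suc i)" by (simp add: psize_off[OF gD(4)])
    \<comment> \<open>Surjectivity: a preimage \<open>y\<close> of \<open>off g i + x\<close> under
      \<open>f\<close> lies in the stretch over the block by \<open>less_off_iff\<close>, and its
      distance from the start of that stretch is the wanted index.\<close>
    then have "off g i + x \<in> set f"
      using off_le_length[of g "Suc i"] fD gD by simp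
    then obtain y where y: "y < length f" "f ! y = off g i + x"
      by (auto simp: in_set_conv_nth)
    then have "off f (off g i) \<le> y" "y < off f (off g (Suc i))"
      using less_off_iff[OF fD(4) y(1), of "off g i"] less_off_iff[OF fD(4) y(1), of "off g (Suc i)"] x
      by auto
    then have "y - off f (off g i) < psize (ocomp g f) i"
      "f ! (off f (off g i) + (y - off f (off g i))) - off g i = x"
      using y by (auto simp: psize_ocomp[OF f g])
    then show "x \<in> set (induced g f i)"
      by (metis length_induced[OF f g] nth_induced[OF f g] nth_mem)
  qed
  ultimately show ?thesis
    using psize_pos[OF gf i] psize_pos[OF g i] by (simp add: osurj_def length_induced[OF f g])
qed

text \<open>The case \<open>j = psize g i\<close> is included because the size of a block is
  computed from the offsets at \<open>j\<close> and \<open>Suc j\<close>, also for the last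
  block.\<close>

lemma off_induced:
  assumes f: "osurj m k f" and g: "osurj k n g" and i: "i < n" and j: "j \<le> psize g i"
  shows "off (induced g f i) j = off f (off g i + j) - off f (off g i)"
proof (rule off_eqI)
  note I = osurj_induced[OF f g i]
  show "sorted (induced g f i)" using I by (rule osurjD)
  have "off g i + j \<le> off g (Suc i)"
    using j by (simp add: off_Suc osurjD(4)[OF g])
  then show "off f (off g i + j) - off f (off g i) \<le> length (induced g f i)"
    by (simp add: length_induced[OF f g] psize_ocomp[OF f g] diff_le_mono off_mono)
  fix x assume "x < length (induced g f i)"
  then have x: "x < psize (ocomp g f) i" by (simp add: length_induced[OF f g])
  show "x < off f (off g i + j) - off f (off g i) \<longleftrightarrow> induced g f i ! x < j"
    using add_less_off[OF f g x] less_off_iff[of f "off f (off g i) + x" "off g i + j"] osurjD(3,4)[OF f]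
    by (auto simp: nth_induced[OF f g x])
qed

lemma psize_induced:
  assumes f: "osurj m k f" and g: "osurj k n g" and i: "i < n" and j: "j < psize g i"
  shows "psize (induced g f i) j = psize f (off g i + j)"
  using off_induced[OF f g i, of j] off_induced[OF f g i, of "Suc j"] j
    off_mono[of "off g i" "off g i + j" f] off_Suc[OF osurjD(4)[OF f], of "off g i + j"]
    off_Suc[OF osurjD(4)[OF osurj_induced[OF f g i]], of j]
  by simp

text \<open>Starts of blocks inside a fiber, counted from the start of the fiber, are starts of
  blocks of the whole map. This turns nested cutting into a single one.\<close>

lemma off_off_induced:
  assumes f: "osurj m k f" and g: "osurj k n g" and i: "i < n" and j: "j \<le> psize g i"
  shows "off (ocomp g f) i + off (induced g f i) j = off f (off g i + j)"
  using off_mono[of "off g i" "off g i + j" f]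
  by (simp add: off_ocomp[OF f g] off_induced[OF f g i j])

section \<open>Functoriality of fibers and nested cutting\<close>

lemma ocomp_assoc: "osurj m k f \<Longrightarrow> osurj k n g \<Longrightarrow> ocomp h (ocomp g f) = ocomp (ocomp h g) f"
  using osurj_nth[of m k f] by (intro nth_equalityI) (auto dest!: osurjD(3))

text \<open>On the right the first map subtracts \<open>off (ocomp h g) i\<close> from its value and
  the second adds \<open>off g (off h i)\<close> to its argument; by \<open>off_ocomp\<close> the
  two shifts cancel.\<close>

lemma induced_ocomp:
  assumes f: "osurj m k f" and g: "osurj k n g" and h: "osurj n p h" and i: "i < p"
  shows "induced h (ocomp g f) i = ocomp (induced h g i) (induced (ocomp h g) f i)"
proof -
  note gf = osurj_ocomp[OF f g] and hg = osurj_ocomp[OF g h]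
  have a: "ocomp h (ocomp g f) = ocomp (ocomp h g) f" using f g by (rule ocomp_assoc)
  show ?thesis
  proof (rule nth_equalityI)
    show "length (induced h (ocomp g f) i) = length (ocomp (induced h g i) (induced (ocomp h g) f i))"
      by (simp add: length_induced[OF gf h] length_induced[OF f hg] a)
    fix x assume "x < length (induced h (ocomp g f) i)"
    then have x: "x < psize (ocomp h (ocomp g f)) i" and x': "x < psize (ocomp (ocomp h g) f) i"
      by (simp_all add: length_induced[OF gf h] a)
    have y: "induced (ocomp h g) f i ! x < psize (ocomp h g) i"
      using osurj_nth[OF osurj_induced[OF f hg i] x'] .
    have z: "off f (off (ocomp h g) i) + x < m" "off (ocomp h g) i \<le> f ! (off f (off (ocomp h g) i) + x)"
      using add_less_off[OF f hg x'] by auto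
    show "induced h (ocomp g f) i ! x = ocomp (induced h g i) (induced (ocomp h g) f i) ! x"
      using x x' y z
      by (simp add: length_induced[OF f hg] nth_induced[OF gf h] nth_induced[OF g h]
          nth_induced[OF f hg] off_ocomp[OF f g] off_ocomp[OF g h] osurjD(3)[OF f])
  qed
qed

text \<open>The fiber axiom for ordinals: a fiber of a fiber is a fiber, with its index counted from
  the start of the outer block. The starting points agree by \<open>off_off_induced\<close>, applied
  once to \<open>g\<close> and \<open>h\<close> and once to \<open>f\<close> and
  \<open>ocomp h g\<close>.\<close>

lemma induced_induced:
  assumes f: "osurj m k f" and g: "osurj k n g" and h: "osurj n p h" and i: "i < p"
    and j: "j < psize h i"
  shows "induced (induced h g i) (induced (ocomp h g) f i) j = induced g f (off h i + j)"
proof -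
  note gf = osurj_ocomp[OF f g] and hg = osurj_ocomp[OF g h]
  note I = osurj_induced[OF f hg i] and J = osurj_induced[OF g h i]
  have a: "ocomp h (ocomp g f) = ocomp (ocomp h g) f" using f g by (rule ocomp_assoc)
  have c: "ocomp (induced h g i) (induced (ocomp h g) f i) = induced h (ocomp g f) i"
    by (rule induced_ocomp[OF f g h i, symmetric])
  have l: "psize (induced h (ocomp g f) i) j = psize (ocomp g f) (off h i + j)"
    by (rule psize_induced[OF gf h i j])
  have oj: "off (induced h g i) j \<le> psize (ocomp h g) i"
    using off_le_length[of "induced h g i" j] by (simp add: length_induced[OF g h])
  have o: "off (ocomp h g) i + off (induced h g i) j = off g (off h i + j)"
    by (rule off_off_induced[OF g h i]) (use j in simp)
  show ?thesis
  proof (rule nth_equalityI)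
    show "length (induced (induced h g i) (induced (ocomp h g) f i) j) = length (induced g f (off h i + j))"
      by (simp add: length_induced[OF I J] length_induced[OF f g] c l)
    fix x assume "x < length (induced (induced h g i) (induced (ocomp h g) f i) j)"
    then have x: "x < psize (ocomp (induced h g i) (induced (ocomp h g) f i)) j"
      and x': "x < psize (ocomp g f) (off h i + j)"
      by (simp_all add: length_induced[OF I J] c l)
    have s: "off (ocomp (ocomp h g) f) i + off (induced (ocomp h g) f i) (off (induced h g i) j) =
        off f (off g (off h i + j))"
      using off_off_induced[OF f hg i oj] o by simp
    have b: "off (induced (ocomp h g) f i) (off (induced h g i) j) + x < psize (ocomp (ocomp h g) f) i"
      using add_less_off(1)[OF I J x] .
    show "induced (induced h g i) (induced (ocomp h g) f i) j ! x = induced g f (off h i + j) ! x"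
      using s o by (simp add: nth_induced[OF I J x] nth_induced[OF f g x'] nth_induced[OF f hg b]
          off_ocomp[OF f hg] add.assoc[symmetric])
  qed
qed

text \<open>Counterpart of \<open>induced_induced\<close> for sequences; the positions agree by
  \<open>off_off_induced\<close>.\<close>

lemma block_block:
  assumes f: "osurj m k f" and g: "osurj k n g" and i: "i < n" and j: "j < psize g i"
    and xs: "length xs = m"
  shows "block (induced g f i) j (block (ocomp g f) i xs) = block f (off g i + j) xs"
proof (rule nth_equalityI)
  note gf = osurj_ocomp[OF f g] and I = osurj_induced[OF f g i]
  have l: "length (block (ocomp g f) i xs) = length (induced g f i)"
    using osurjD[OF gf] xs by (simp add: length_block length_induced[OF f g])
  show "length (block (induced g f i) j (block (ocomp g f) i xs)) = length (block f (off g i + j) xs)"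
    using l osurjD[OF gf] osurjD[OF f] osurjD[OF I] xs
    by (simp add: length_block psize_induced[OF f g i j])
  fix x assume "x < length (block (induced g f i) j (block (ocomp g f) i xs))"
  then have x: "x < psize (induced g f i) j" "x < psize f (off g i + j)"
    using l osurjD[OF I] by (simp_all add: length_block psize_induced[OF f g i j])
  have b: "off (induced g f i) j + x < psize (ocomp g f) i"
    using off_add_less(1)[OF I j x(1)] .
  show "block (induced g f i) j (block (ocomp g f) i xs) ! x = block f (off g i + j) xs ! x"
    using l osurjD[OF gf] osurjD[OF f] osurjD[OF I] xs x b
      off_off_induced[OF f g i, of j] j
    by (simp add: nth_block add.assoc[symmetric])
qed

lemma block_map: "block g i (map F xs) = map F (block g i xs)"
  by (simp add: block_def nths_map)

text \<open>The intervals from \<open>off f i\<close> to \<open>off f (Suc i)\<close> tile the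
  domain. The induction is on the number \<open>l\<close> of blocks taken, with running total
  \<open>off f l\<close>; by \<open>off_cod\<close> all blocks together reach
  \<open>m\<close>.\<close>

lemma concat_blocks:
  assumes "osurj m n f"
  shows "concat (map (\<lambda>i. map (\<lambda>j. F (off f i + j)) [0..<psize f i]) [0..<n]) = map F [0..<m]"
proof -
  have "concat (map (\<lambda>i. map (\<lambda>j. F (off f i + j)) [0..<psize f i]) [0..<l]) = map F [0..<off f l]" for l
  proof (induction l)
    case (Suc l)
    have "map F [off f l..<off f l + psize f l] = map (\<lambda>j. F (off f l + j)) [0..<psize f l]"
      by (intro nth_equalityI) auto
    then show ?case
      using Suc by (simp add: off_Suc[OF osurjD(4)[OF assms]] upt_add_eq_append[of 0 "off f l" "psize f l"])
  qed simp
  then show ?thesis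
    using off_cod[OF assms, of n] by simp
qed

section \<open>Identities and maps to the one-point ordinal\<close>

lemma osurj_oid: "1 \<le> n \<Longrightarrow> osurj n n (oid n)"
  by (auto simp: osurj_def oid_def)

lemma osurj_bang: "1 \<le> n \<Longrightarrow> osurj n 1 (bang n)"
  by (auto simp: osurj_def bang_def)

lemma osurj_to_1:
  assumes "osurj m 1 f" shows "f = bang m"
proof -
  have "x = 0" if "x \<in> set f" for x
    using that osurjD(5)[OF assms] by auto
  then show ?thesis
    unfolding bang_def by (intro replicate_eqI osurjD(3)[OF assms])
qed

lemma ocomp_oid_left: "osurj m n f \<Longrightarrow> ocomp (oid n) f = f"
  by (intro nth_equalityI) (use osurj_nth[of m n f] osurjD(3)[of m n f] in \<open>auto simp: oid_def\<close>)

lemma ocomp_oid_right: "osurj m n f \<Longrightarrow> ocomp f (oid m) = f"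
  by (intro nth_equalityI) (auto simp: oid_def dest: osurjD(3))

lemma ocomp_bang: "osurj m n f \<Longrightarrow> ocomp (bang n) f = bang m"
  by (intro nth_equalityI) (use osurj_nth[of m n f] osurjD(3)[of m n f] in \<open>auto simp: bang_def\<close>)

lemma off_oid: "i \<le> n \<Longrightarrow> off (oid n) i = i"
  by (intro off_eqI) (auto simp: oid_def)

lemma psize_oid: "i < n \<Longrightarrow> psize (oid n) i = 1"
  using off_oid[of i n] off_oid[of "Suc i" n] by (subst psize_off) (auto simp: oid_def)

lemma psize_bang: "psize (bang n) 0 = n"
proof -
  have "preim (bang n) 0 = {..<n}"
    by (auto simp: preim_def bang_def)
  then show ?thesis by (simp add: psize_def)
qed

text \<open>The fiber of an identity over \<open>i\<close> is a point, so the induced map is the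
  unique map to it.\<close>

lemma induced_oid_left:
  assumes f: "osurj m n f" and i: "i < n"
  shows "induced (oid n) f i = bang (psize f i)"
proof -
  have "osurj (psize f i) 1 (induced (oid n) f i)"
    using osurj_induced[OF f osurj_oid i] osurjD(2)[OF f] psize_oid[OF i]
    by (simp add: ocomp_oid_left[OF f])
  then show ?thesis by (rule osurj_to_1)
qed

lemma induced_oid_right:
  assumes f: "osurj m n f" and i: "i < n"
  shows "induced f (oid m) i = oid (psize f i)"
proof -
  have "off f i \<le> m" using off_le_length[of f i] by (simp add: osurjD(3)[OF f])
  then show ?thesis
    using osurjD(1)[OF f] off_add_less(1)[OF f i]
    by (intro nth_equalityI)
       (auto simp: length_induced[OF osurj_oid f] nth_induced[OF osurj_oid f] ocomp_oid_right[OF f]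
          off_oid, auto simp: oid_def)
qed

lemma induced_bang:
  assumes f: "osurj m n f" shows "induced (bang n) f 0 = f"
  using osurjD(2,3)[OF f]
  by (intro nth_equalityI)
     (auto simp: length_induced[OF f osurj_bang] nth_induced[OF f osurj_bang] ocomp_bang[OF f] psize_bang)

lemma block_oid: "length xs = n \<Longrightarrow> i < n \<Longrightarrow> block (oid n) i xs = [xs ! i]"
  by (subst block_off) (auto simp: oid_def[symmetric] psize_oid off_oid, auto simp: oid_def)

lemma block_bang: "length xs = n \<Longrightarrow> block (bang n) 0 xs = xs"
  by (subst block_off) (auto simp: psize_bang, auto simp: bang_def intro: nth_equalityI)

lemma block_replicate:
  assumes f: "osurj m n f" and i: "i < n"
  shows "block f i (replicate m x) = replicate (psize f i) x"
  using osurjD[OF f] off_add_less(1)[OF f i] by (intro nth_equalityI) (auto simp: length_block nth_block)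

section \<open>Compositions of sequences in an operad\<close>

text \<open>The product of the sets \<open>X\<close> over the fibers of \<open>f\<close>, where
  \<open>X\<close> stands for the objects or the morphisms of an operad in each arity. By
  \<open>Obj_fibcat\<close> and \<open>Arr_fibcat\<close> these products are the carriers of
  \<open>fibcat\<close>.\<close>

definition tup :: "(nat \<Rightarrow> 'x set) \<Rightarrow> nat list \<Rightarrow> 'x list \<Rightarrow> bool" where
  "tup X f xs \<longleftrightarrow> length xs = ocod f \<and> (\<forall>i<ocod f. xs ! i \<in> X (psize f i))"

text \<open>The tuple of inner composites in the associativity law. It is at once the tuple of a
  composite 1-cell (with \<open>mu0\<close>) and that of a horizontal composite of 2-cells (with
  \<open>mu1\<close>).\<close>

definition mul :: "(nat list \<Rightarrow> 'x \<Rightarrow> 'x list \<Rightarrow> 'x) \<Rightarrow> nat list \<Rightarrow> nat list \<Rightarrow> 'x list \<Rightarrow> 'x list \<Rightarrow> 'x list" where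
  "mul \<mu> g f bs xs = map (\<lambda>i. \<mu> (induced g f i) (bs ! i) (block g i xs)) [0..<ocod g]"

lemma length_mul [simp]: "length (mul \<mu> g f bs xs) = ocod g"
  by (simp add: mul_def)

lemma nth_mul: "i < ocod g \<Longrightarrow> mul \<mu> g f bs xs ! i = \<mu> (induced g f i) (bs ! i) (block g i xs)"
  by (simp add: mul_def)

lemma tup_length: "osurj m n f \<Longrightarrow> tup X f xs \<Longrightarrow> length xs = n"
  using osurjD(6) by (simp add: tup_def)

lemma tup_block:
  assumes f: "osurj m k f" and g: "osurj k n g" and i: "i < n" and xs: "tup X f xs"
  shows "tup X (induced g f i) (block g i xs)"
proof -
  have l: "length xs = length g"
    using tup_length[OF f xs] osurjD[OF g] by simp
  show ?thesis
    unfolding tup_def osurjD(6)[OF osurj_induced[OF f g i]]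
  proof (intro conjI allI impI)
    show "length (block g i xs) = psize g i"
      using l osurjD[OF g] by (simp add: length_block)
    fix j assume j: "j < psize g i"
    show "block g i xs ! j \<in> X (psize (induced g f i) j)"
      using l osurjD[OF g] osurjD(6)[OF f] off_add_less[OF g i j] j xs
      by (simp add: nth_block psize_induced[OF f g i j] tup_def)
  qed
qed

text \<open>Both the objects and the morphisms of an operad form such a structure.\<close>

locale set_operad =
  fixes X :: "nat \<Rightarrow> 'x set" and \<mu> :: "nat list \<Rightarrow> 'x \<Rightarrow> 'x list \<Rightarrow> 'x" and e :: 'x
  assumes mu_closed: "osurj k n g \<Longrightarrow> c \<in> X n \<Longrightarrow> tup X g bs \<Longrightarrow> \<mu> g c bs \<in> X k"
    and e_closed: "e \<in> X 1"
    and mu_assoc: "osurj m k f \<Longrightarrow> osurj k n g \<Longrightarrow> c \<in> X n \<Longrightarrow> tup X g bs \<Longrightarrow> tup X f xs \<Longrightarrow>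
      \<mu> f (\<mu> g c bs) xs = \<mu> (ocomp g f) c (mul \<mu> g f bs xs)"
    and mu_unit_right: "1 \<le> n \<Longrightarrow> a \<in> X n \<Longrightarrow> \<mu> (oid n) a (replicate n e) = a"
    and mu_unit_left: "1 \<le> n \<Longrightarrow> a \<in> X n \<Longrightarrow> \<mu> (bang n) e [a] = a"
begin

lemma tup_replicate: "1 \<le> n \<Longrightarrow> tup X (oid n) (replicate n e)"
  using osurjD(6)[OF osurj_oid] e_closed by (simp add: tup_def psize_oid)

lemma tup_bang: "1 \<le> n \<Longrightarrow> tup X (bang n) [a] \<longleftrightarrow> a \<in> X n"
  using osurjD(6)[OF osurj_bang] by (simp add: tup_def psize_bang)

lemma tup_nth: "osurj m n f \<Longrightarrow> tup X f xs \<Longrightarrow> i < n \<Longrightarrow> xs ! i \<in> X (psize f i)"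
  using osurjD(6) by (simp add: tup_def)

lemma mul_closed:
  assumes f: "osurj m k f" and g: "osurj k n g" and bs: "tup X g bs" and xs: "tup X f xs"
  shows "tup X (ocomp g f) (mul \<mu> g f bs xs)"
  unfolding tup_def
  using osurjD(6)[OF g] osurjD(6)[OF osurj_ocomp[OF f g]] tup_nth[OF g bs]
    mu_closed[OF osurj_induced[OF f g] _ tup_block[OF f g _ xs]]
  by (simp add: nth_mul)

text \<open>Restricting to a fiber of \<open>h\<close> commutes with forming composites, entry by
  entry by \<open>induced_induced\<close> and \<open>block_block\<close>. This makes taking fibers
  compatible with the composition of 1-cells and of 2-cells.\<close>

lemma block_mul:
  assumes f: "osurj m k f" and g: "osurj k n g" and h: "osurj n p h" and i: "i < p"
    and bs: "length bs = n" and xs: "length xs = k"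
  shows "block h i (mul \<mu> g f bs xs) =
    mul \<mu> (induced h g i) (induced (ocomp h g) f i) (block h i bs) (block (ocomp h g) i xs)"
proof (rule nth_equalityI)
  note hg = osurj_ocomp[OF g h]
  note o = osurjD(6)[OF osurj_induced[OF g h i]]
  have l: "length (mul \<mu> g f bs xs) = length h"
    using osurjD[OF g] osurjD[OF h] by simp
  show "length (block h i (mul \<mu> g f bs xs)) = length (mul \<mu> (induced h g i) (induced (ocomp h g) f i)
      (block h i bs) (block (ocomp h g) i xs))"
    using l o osurjD[OF h] by (simp add: length_block)
  fix j assume "j < length (block h i (mul \<mu> g f bs xs))"
  then have j: "j < psize h i"
    using l osurjD[OF h] by (simp add: length_block)
  show "block h i (mul \<mu> g f bs xs) ! j = mul \<mu> (induced h g i) (induced (ocomp h g) f i)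
      (block h i bs) (block (ocomp h g) i xs) ! j"
    using l o j osurjD[OF h] osurjD[OF g] bs off_add_less(1)[OF h i j]
    by (simp add: nth_block nth_mul induced_induced[OF f g h i j] block_block[OF g h i j xs])
qed

text \<open>In coordinate \<open>i\<close> this is the associativity law of the operad inside the
  fiber over \<open>i\<close>, once \<open>block_mul\<close> and \<open>induced_ocomp\<close> have
  rewritten the right-hand side.\<close>

lemma mul_assoc:
  assumes f: "osurj m k f" and g: "osurj k n g" and h: "osurj n p h"
    and cs: "tup X h cs" and bs: "tup X g bs" and xs: "tup X f xs"
  shows "mul \<mu> (ocomp h g) f (mul \<mu> h g cs bs) xs = mul \<mu> h (ocomp g f) cs (mul \<mu> g f bs xs)"
proof (rule nth_equalityI)
  note hg = osurj_ocomp[OF g h]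
  note o = osurjD(6)[OF h] osurjD(6)[OF hg]
  show "length (mul \<mu> (ocomp h g) f (mul \<mu> h g cs bs) xs) =
      length (mul \<mu> h (ocomp g f) cs (mul \<mu> g f bs xs))"
    using o by simp
  fix i assume "i < length (mul \<mu> (ocomp h g) f (mul \<mu> h g cs bs) xs)"
  then have i: "i < p" using o by simp
  show "mul \<mu> (ocomp h g) f (mul \<mu> h g cs bs) xs ! i =
      mul \<mu> h (ocomp g f) cs (mul \<mu> g f bs xs) ! i"
    using i o tup_length[OF g bs] tup_length[OF f xs]
    by (simp add: nth_mul block_mul[OF f g h i] induced_ocomp[OF f g h i]
        mu_assoc[OF osurj_induced[OF f hg i] osurj_induced[OF g h i] tup_nth[OF h cs i]
          tup_block[OF g h i bs] tup_block[OF f hg i xs]])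
qed

text \<open>Fibers of an identity are points and the induced maps are \<open>bang\<close>, so each
  coordinate is a left unit law; in \<open>mul_unit_right\<close> the induced maps are identities
  and each coordinate is a right unit law.\<close>

lemma mul_unit_left:
  assumes f: "osurj m n f" and xs: "tup X f xs"
  shows "mul \<mu> (oid n) f (replicate n e) xs = xs"
proof (rule nth_equalityI)
  have o: "ocod (oid n) = n" using osurjD[OF f] by (simp add: osurjD(6)[OF osurj_oid])
  note l = tup_length[OF f xs]
  show "length (mul \<mu> (oid n) f (replicate n e) xs) = length xs" using o l by simp
  fix i assume "i < length (mul \<mu> (oid n) f (replicate n e) xs)"
  then have i: "i < n" using o by simp
  show "mul \<mu> (oid n) f (replicate n e) xs ! i = xs ! i"
    using o i l mu_unit_left[OF psize_pos[OF f i] tup_nth[OF f xs i]]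
    by (simp add: nth_mul block_oid induced_oid_left[OF f])
qed

lemma mul_unit_right:
  assumes f: "osurj m n f" and xs: "tup X f xs"
  shows "mul \<mu> f (oid m) xs (replicate m e) = xs"
  using osurjD(6)[OF f] tup_length[OF f xs] mu_unit_right[OF psize_pos[OF f] tup_nth[OF f xs]]
  by (intro nth_equalityI) (auto simp: nth_mul block_replicate[OF f] induced_oid_right[OF f])

lemma mul_bang:
  assumes f: "osurj m n f" and xs: "tup X f xs"
  shows "mul \<mu> (bang n) f [x] xs = [\<mu> f x xs]"
proof -
  have "ocod (bang n) = 1" using osurjD[OF f] by (simp add: osurjD(6)[OF osurj_bang])
  then show ?thesis
    using tup_length[OF f xs] by (simp add: mul_def induced_bang[OF f] block_bang)
qed

end

section \<open>Categories and functors in terms of hom-sets\<close>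

lemma homsetD:
  assumes "f \<in> homset C x y" shows "f \<in> Arr C" "Src C f = x" "Trg C f = y"
  using assms by (auto simp: homset_def)

lemma Arr_homset: "f \<in> Arr C \<Longrightarrow> f \<in> homset C (Src C f) (Trg C f)"
  by (simp add: homset_def)

text \<open>Stated for members of hom-sets, so that composability is carried along with each
  morphism and the rules can be chained.\<close>

lemma categoryD:
  assumes "category C"
  shows homset_Obj: "f \<in> homset C x y \<Longrightarrow> x \<in> Obj C \<and> y \<in> Obj C"
    and Idn_homset: "x \<in> Obj C \<Longrightarrow> Idn C x \<in> homset C x x"
    and Cmp_homset: "f \<in> homset C x y \<Longrightarrow> g \<in> homset C y z \<Longrightarrow> Cmp C g f \<in> homset C x z"
    and Cmp_Idn_right: "f \<in> homset C x y \<Longrightarrow> Cmp C f (Idn C x) = f"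
    and Cmp_Idn_left: "f \<in> homset C x y \<Longrightarrow> Cmp C (Idn C y) f = f"
    and Cmp_assoc: "f \<in> homset C x y \<Longrightarrow> g \<in> homset C y z \<Longrightarrow> h \<in> homset C z w \<Longrightarrow>
      Cmp C h (Cmp C g f) = Cmp C (Cmp C h g) f"
  using assms unfolding category_def homset_def by auto

lemma categoryI:
  assumes "\<And>f. f \<in> Arr C \<Longrightarrow> Src C f \<in> Obj C \<and> Trg C f \<in> Obj C"
    and "\<And>x. x \<in> Obj C \<Longrightarrow> Idn C x \<in> homset C x x"
    and "\<And>f g x y z. f \<in> homset C x y \<Longrightarrow> g \<in> homset C y z \<Longrightarrow> Cmp C g f \<in> homset C x z"
    and "\<And>f x y. f \<in> homset C x y \<Longrightarrow> Cmp C f (Idn C x) = f"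
    and "\<And>f x y. f \<in> homset C x y \<Longrightarrow> Cmp C (Idn C y) f = f"
    and "\<And>f g h x y z w. f \<in> homset C x y \<Longrightarrow> g \<in> homset C y z \<Longrightarrow> h \<in> homset C z w \<Longrightarrow>
      Cmp C h (Cmp C g f) = Cmp C (Cmp C h g) f"
  shows "category C"
  unfolding category_def
  using assms(1) assms(2-6)[unfolded homset_def] by auto

lemma is_functorD:
  assumes "is_functor C D F0 F1"
  shows functor_Obj: "x \<in> Obj C \<Longrightarrow> F0 x \<in> Obj D"
    and functor_homset: "f \<in> homset C x y \<Longrightarrow> F1 f \<in> homset D (F0 x) (F0 y)"
    and functor_Idn: "x \<in> Obj C \<Longrightarrow> F1 (Idn C x) = Idn D (F0 x)"
    and functor_Cmp: "f \<in> homset C x y \<Longrightarrow> g \<in> homset C y z \<Longrightarrow> F1 (Cmp C g f) = Cmp D (F1 g) (F1 f)"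
  using assms unfolding is_functor_def homset_def by auto

lemma is_functorI:
  assumes "\<And>x. x \<in> Obj C \<Longrightarrow> F0 x \<in> Obj D"
    and "\<And>f x y. f \<in> homset C x y \<Longrightarrow> F1 f \<in> homset D (F0 x) (F0 y)"
    and "\<And>x. x \<in> Obj C \<Longrightarrow> F1 (Idn C x) = Idn D (F0 x)"
    and "\<And>f g x y z. f \<in> homset C x y \<Longrightarrow> g \<in> homset C y z \<Longrightarrow> F1 (Cmp C g f) = Cmp D (F1 g) (F1 f)"
  shows "is_functor C D F0 F1"
  using assms unfolding is_functor_def homset_def by auto

lemma homset_pair_cat:
  "(f, f') \<in> homset (pair_cat C D) (x, x') (y, y') \<longleftrightarrow> f \<in> homset C x y \<and> f' \<in> homset D x' y'"
  by (auto simp: homset_def pair_cat_def)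

lemma Obj_fibcat: "xs \<in> Obj (fibcat P f) \<longleftrightarrow> tup (\<lambda>n. Obj (Cat P n)) f xs"
  by (auto simp: fibcat_def list_cat_def tup_def list_all2_conv_all_nth)

lemma Arr_fibcat: "xs \<in> Arr (fibcat P f) \<longleftrightarrow> tup (\<lambda>n. Arr (Cat P n)) f xs"
  by (auto simp: fibcat_def list_cat_def tup_def list_all2_conv_all_nth)

lemma length_Idn_fibcat: "length xs = ocod f \<Longrightarrow> length (Idn (fibcat P f) xs) = ocod f"
  by (simp add: fibcat_def list_cat_def)

lemma nth_Idn_fibcat:
  "length xs = ocod f \<Longrightarrow> i < ocod f \<Longrightarrow> Idn (fibcat P f) xs ! i = Idn (Cat P (psize f i)) (xs ! i)"
  by (simp add: fibcat_def list_cat_def)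

lemma length_Cmp_fibcat [simp]: "length (Cmp (fibcat P f) ys xs) = ocod f"
  by (simp add: fibcat_def list_cat_def)

lemma nth_Cmp_fibcat:
  "i < ocod f \<Longrightarrow> Cmp (fibcat P f) ys xs ! i = Cmp (Cat P (psize f i)) (ys ! i) (xs ! i)"
  by (simp add: fibcat_def list_cat_def)

lemma homset_fibcat:
  "fs \<in> homset (fibcat P f) xs ys \<longleftrightarrow>
    length fs = ocod f \<and> length xs = ocod f \<and> length ys = ocod f \<and>
    (\<forall>i<ocod f. fs ! i \<in> homset (Cat P (psize f i)) (xs ! i) (ys ! i))"
  unfolding homset_def mem_Collect_eq Arr_fibcat tup_def
  by (auto simp: fibcat_def list_cat_def list_eq_iff_nth_eq)

section \<open>Operad composition as a functor on sequences\<close>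

locale oper =
  fixes P :: "('o, 'm) operad"
  assumes operad: "operad P"
begin

lemma category_Cat: "1 \<le> n \<Longrightarrow> category (Cat P n)"
  using operad by (simp add: operad_def)

lemma category_fibcat:
  assumes f: "osurj m k f" shows "category (fibcat P f)"
proof -
  have c: "category (Cat P (psize f i))" if "i < ocod f" for i
    using category_Cat[OF psize_pos[OF f, of i]] that osurjD(6)[OF f] by simp
  show ?thesis
  proof (rule categoryI)
    fix fs assume fs: "fs \<in> Arr (fibcat P f)"
    then have "fs \<in> homset (fibcat P f) (Src (fibcat P f) fs) (Trg (fibcat P f) fs)"
      by (rule Arr_homset)
    then show "Src (fibcat P f) fs \<in> Obj (fibcat P f) \<and> Trg (fibcat P f) fs \<in> Obj (fibcat P f)"
      using homset_Obj[OF c] unfolding homset_fibcat Obj_fibcat tup_def by blast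
  next
    fix xs assume "xs \<in> Obj (fibcat P f)"
    then show "Idn (fibcat P f) xs \<in> homset (fibcat P f) xs xs"
      using Idn_homset[OF c]
      by (simp add: homset_fibcat Obj_fibcat tup_def length_Idn_fibcat nth_Idn_fibcat)
  next
    fix fs gs xs ys zs
    assume "fs \<in> homset (fibcat P f) xs ys" "gs \<in> homset (fibcat P f) ys zs"
    then show "Cmp (fibcat P f) gs fs \<in> homset (fibcat P f) xs zs"
      by (auto simp: homset_fibcat nth_Cmp_fibcat intro: Cmp_homset[OF c])
  next
    fix fs xs ys assume "fs \<in> homset (fibcat P f) xs ys"
    then show "Cmp (fibcat P f) fs (Idn (fibcat P f) xs) = fs"
      and "Cmp (fibcat P f) (Idn (fibcat P f) ys) fs = fs"
      using Cmp_Idn_right[OF c] Cmp_Idn_left[OF c]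
      by (auto simp: homset_fibcat nth_Cmp_fibcat nth_Idn_fibcat intro!: nth_equalityI)
  next
    fix fs gs hs xs ys zs ws
    assume "fs \<in> homset (fibcat P f) xs ys" "gs \<in> homset (fibcat P f) ys zs"
      "hs \<in> homset (fibcat P f) zs ws"
    then show "Cmp (fibcat P f) hs (Cmp (fibcat P f) gs fs) =
        Cmp (fibcat P f) (Cmp (fibcat P f) hs gs) fs"
      by (auto simp: homset_fibcat nth_Cmp_fibcat intro!: nth_equalityI Cmp_assoc[OF c])
  qed
qed

lemma mu_functor:
  "osurj k n g \<Longrightarrow> is_functor (pair_cat (Cat P n) (fibcat P g)) (Cat P k)
    (\<lambda>(c, bs). mu0 P g c bs) (\<lambda>(c, bs). mu1 P g c bs)"
  using operad by (simp add: operad_def)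

lemma mu_homset:
  "osurj k n g \<Longrightarrow> c \<in> homset (Cat P n) x y \<Longrightarrow> bs \<in> homset (fibcat P g) xs ys \<Longrightarrow>
    mu1 P g c bs \<in> homset (Cat P k) (mu0 P g x xs) (mu0 P g y ys)"
  using functor_homset[OF mu_functor, of k n g "(c, bs)" "(x, xs)" "(y, ys)"]
  by (simp add: homset_pair_cat)

lemma mu_Idn:
  "osurj k n g \<Longrightarrow> c \<in> Obj (Cat P n) \<Longrightarrow> bs \<in> Obj (fibcat P g) \<Longrightarrow>
    mu1 P g (Idn (Cat P n) c) (Idn (fibcat P g) bs) = Idn (Cat P k) (mu0 P g c bs)"
  using functor_Idn[OF mu_functor, of k n g "(c, bs)"] by (simp add: pair_cat_def)

lemma mu_Cmp:
  "osurj k n g \<Longrightarrow> c \<in> homset (Cat P n) x y \<Longrightarrow> d \<in> homset (Cat P n) y z \<Longrightarrow>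
    bs \<in> homset (fibcat P g) xs ys \<Longrightarrow> cs \<in> homset (fibcat P g) ys zs \<Longrightarrow>
    mu1 P g (Cmp (Cat P n) d c) (Cmp (fibcat P g) cs bs) = Cmp (Cat P k) (mu1 P g d cs) (mu1 P g c bs)"
  using functor_Cmp[OF mu_functor, of k n g "(c, bs)" "(x, xs)" "(y, ys)" "(d, cs)" "(z, zs)"]
  by (simp add: homset_pair_cat) (simp add: pair_cat_def)

lemma mu_assoc':
  assumes "osurj m k f" "osurj k n g"
  shows "\<forall>c\<in>Obj (Cat P n). \<forall>bs\<in>Obj (fibcat P g). \<forall>xs\<in>Obj (fibcat P f).
      mu0 P f (mu0 P g c bs) xs =
      mu0 P (ocomp g f) c (map (\<lambda>i. mu0 P (induced g f i) (bs ! i) (block g i xs)) [0..<n])"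
    and "\<forall>c\<in>Arr (Cat P n). \<forall>bs\<in>Arr (fibcat P g). \<forall>xs\<in>Arr (fibcat P f).
      mu1 P f (mu1 P g c bs) xs =
      mu1 P (ocomp g f) c (map (\<lambda>i. mu1 P (induced g f i) (bs ! i) (block g i xs)) [0..<n])"
  using operad assms unfolding operad_def by blast+

sublocale ob: set_operad "\<lambda>n. Obj (Cat P n)" "mu0 P" "unit P"
proof
  show "mu0 P g c bs \<in> Obj (Cat P k)"
    if "osurj k n g" "c \<in> Obj (Cat P n)" "tup (\<lambda>n. Obj (Cat P n)) g bs" for k n g c bs
    using functor_Obj[OF mu_functor, OF that(1), of "(c, bs)"] that
    by (simp add: pair_cat_def Obj_fibcat)
  show "mu0 P f (mu0 P g c bs) xs = mu0 P (ocomp g f) c (mul (mu0 P) g f bs xs)"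
    if "osurj m k f" "osurj k n g" "c \<in> Obj (Cat P n)" "tup (\<lambda>n. Obj (Cat P n)) g bs"
      "tup (\<lambda>n. Obj (Cat P n)) f xs" for m k n f g c bs xs
    using mu_assoc'[OF that(1,2)] that(3-5)
    by (simp add: mul_def osurjD(6)[OF that(2)] Obj_fibcat)
qed (use operad in \<open>auto simp: operad_def\<close>)

text \<open>Closure is functoriality of the composition, and the unit is the identity morphism of
  the unit object; the laws are those of the operad on morphisms.\<close>

sublocale ar: set_operad "\<lambda>n. Arr (Cat P n)" "mu1 P" "unit_arr P"
proof
  show "mu1 P g c bs \<in> Arr (Cat P k)"
    if "osurj k n g" "c \<in> Arr (Cat P n)" "tup (\<lambda>n. Arr (Cat P n)) g bs" for k n g c bs
    using mu_homset[OF that(1) Arr_homset[OF that(2)] Arr_homset] that(3)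
    by (auto simp: Arr_fibcat dest: homsetD)
  show "unit_arr P \<in> Arr (Cat P 1)"
    using homsetD(1)[OF Idn_homset[OF category_Cat]] ob.e_closed by (simp add: unit_arr_def)
  show "mu1 P f (mu1 P g c bs) xs = mu1 P (ocomp g f) c (mul (mu1 P) g f bs xs)"
    if "osurj m k f" "osurj k n g" "c \<in> Arr (Cat P n)" "tup (\<lambda>n. Arr (Cat P n)) g bs"
      "tup (\<lambda>n. Arr (Cat P n)) f xs" for m k n f g c bs xs
    using mu_assoc'[OF that(1,2)] that(3-5)
    by (simp add: mul_def osurjD(6)[OF that(2)] Arr_fibcat)
qed (use operad in \<open>auto simp: operad_def\<close>)

lemma homset_fibcat_nth:
  "osurj m n f \<Longrightarrow> fs \<in> homset (fibcat P f) xs ys \<Longrightarrow> i < n \<Longrightarrow>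
    fs ! i \<in> homset (Cat P (psize f i)) (xs ! i) (ys ! i)"
  using osurjD(6) by (simp add: homset_fibcat)

lemma homset_fibcat_length:
  assumes "osurj m n f" "fs \<in> homset (fibcat P f) xs ys"
  shows "length fs = n" "length xs = n" "length ys = n"
  using assms osurjD(6)[OF assms(1)] by (auto simp: homset_fibcat)

lemma homset_fibcat_tup:
  assumes "osurj m n f" "fs \<in> homset (fibcat P f) xs ys"
  shows "tup (\<lambda>n. Arr (Cat P n)) f fs" "tup (\<lambda>n. Obj (Cat P n)) f xs" "tup (\<lambda>n. Obj (Cat P n)) f ys"
  using homsetD(1)[OF assms(2)] homset_Obj[OF category_fibcat[OF assms(1)] assms(2)]
  by (auto simp: Arr_fibcat Obj_fibcat)

lemma block_homset:
  assumes f: "osurj m k f" and g: "osurj k n g" and i: "i < n" and fs: "fs \<in> homset (fibcat P f) xs ys"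
  shows "block g i fs \<in> homset (fibcat P (induced g f i)) (block g i xs) (block g i ys)"
  using osurjD(3,4)[OF g] homset_fibcat_length[OF f fs] homset_fibcat_nth[OF f fs] off_add_less(1)[OF g i]
  by (simp add: homset_fibcat osurjD(6)[OF osurj_induced[OF f g i]] length_block nth_block
      psize_induced[OF f g i])

lemma block_Idn:
  assumes f: "osurj m k f" and g: "osurj k n g" and i: "i < n" and xs: "length xs = k"
  shows "block g i (Idn (fibcat P f) xs) = Idn (fibcat P (induced g f i)) (block g i xs)"
proof -
  note o = osurjD(6)[OF f] osurjD(6)[OF osurj_induced[OF f g i]] osurjD(3,4)[OF g]
  have "length (Idn (fibcat P f) xs) = k" "length (block g i xs) = psize g i"
    using o xs by (simp_all add: length_Idn_fibcat length_block)
  then show ?thesis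
    using o xs off_add_less(1)[OF g i]
    by (intro nth_equalityI)
       (auto simp: length_block nth_block length_Idn_fibcat nth_Idn_fibcat psize_induced[OF f g i])
qed

lemma block_Cmp:
  assumes f: "osurj m k f" and g: "osurj k n g" and i: "i < n"
    and fs: "length fs = k" and gs: "length gs = k"
  shows "block g i (Cmp (fibcat P f) gs fs) =
    Cmp (fibcat P (induced g f i)) (block g i gs) (block g i fs)"
  using osurjD(6)[OF f] osurjD(6)[OF osurj_induced[OF f g i]] osurjD(3,4)[OF g] fs gs
    off_add_less(1)[OF g i]
  by (intro nth_equalityI) (auto simp: length_block nth_block nth_Cmp_fibcat psize_induced[OF f g i])

text \<open>With \<open>mul_Idn\<close> and \<open>mul_Cmp\<close> this says that forming composites
  is functorial in both tuples: in each coordinate the composition functor of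
  \<open>induced g f i\<close> is applied to morphisms between blocks.\<close>

lemma mul_homset:
  assumes f: "osurj m k f" and g: "osurj k n g"
    and bs: "bs \<in> homset (fibcat P g) xs xs'" and as: "as \<in> homset (fibcat P f) ys ys'"
  shows "mul (mu1 P) g f bs as \<in>
    homset (fibcat P (ocomp g f)) (mul (mu0 P) g f xs ys) (mul (mu0 P) g f xs' ys')"
  using osurjD(6)[OF g] osurjD(6)[OF osurj_ocomp[OF f g]]
    mu_homset[OF osurj_induced[OF f g] homset_fibcat_nth[OF g bs] block_homset[OF f g _ as]]
  by (simp add: homset_fibcat nth_mul)

lemma mul_Idn:
  assumes f: "osurj m k f" and g: "osurj k n g"
    and bs: "bs \<in> Obj (fibcat P g)" and as: "as \<in> Obj (fibcat P f)"
  shows "mul (mu1 P) g f (Idn (fibcat P g) bs) (Idn (fibcat P f) as) =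
    Idn (fibcat P (ocomp g f)) (mul (mu0 P) g f bs as)"
proof -
  have bs': "tup (\<lambda>n. Obj (Cat P n)) g bs" and as': "tup (\<lambda>n. Obj (Cat P n)) f as"
    using bs as by (simp_all add: Obj_fibcat)
  show ?thesis
    using osurjD(6)[OF g] osurjD(6)[OF osurj_ocomp[OF f g]] tup_length[OF g bs'] tup_length[OF f as']
      mu_Idn[OF osurj_induced[OF f g] ob.tup_nth[OF g bs']] tup_block[OF f g _ as']
    by (intro nth_equalityI)
       (auto simp: length_Idn_fibcat nth_Idn_fibcat nth_mul block_Idn[OF f g] Obj_fibcat)
qed

lemma mul_Cmp:
  assumes f: "osurj m k f" and g: "osurj k n g"
    and bs: "bs \<in> homset (fibcat P g) xs ys" and bs': "bs' \<in> homset (fibcat P g) ys zs"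
    and as: "as \<in> homset (fibcat P f) us vs" and as': "as' \<in> homset (fibcat P f) vs ws"
  shows "mul (mu1 P) g f (Cmp (fibcat P g) bs' bs) (Cmp (fibcat P f) as' as) =
    Cmp (fibcat P (ocomp g f)) (mul (mu1 P) g f bs' as') (mul (mu1 P) g f bs as)"
  using osurjD(6)[OF g] osurjD(6)[OF osurj_ocomp[OF f g]]
    mu_Cmp[OF osurj_induced[OF f g] homset_fibcat_nth[OF g bs] homset_fibcat_nth[OF g bs']
      block_homset[OF f g _ as] block_homset[OF f g _ as']]
    homset_fibcat_length[OF f as] homset_fibcat_length[OF f as']
  by (intro nth_equalityI) (auto simp: nth_mul nth_Cmp_fibcat block_Cmp[OF f g])

end

section \<open>The 2-category of an operad\<close>

lemma integ_simps [simp]: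
  "Obj (integ P) = {(m, a). 1 \<le> m \<and> a \<in> Obj (Cat P m)}"
  "Arr (integ P) = int_arrows P" "Src (integ P) = src1" "Trg (integ P) = trg1"
  "Idn (integ P) (m, a) = Int1 (m, a) (m, a) (oid m) (replicate m (unit P)) (Idn (Cat P m) a)"
  "Cmp (integ P) = int_comp P"
  "Cell (integ P) = int_cells P" "Src2 (integ P) = src2" "Trg2 (integ P) = trg2"
  "Idn2 (integ P) s = Int2 s s (Idn (fibcat P (imap s)) (iobs s))"
  "VCmp (integ P) d c = Int2 (src2 c) (trg2 d) (Cmp (fibcat P (imap (src2 c))) (icomps d) (icomps c))"
  "Card (integ P) = \<lparr>T0 = fst, T1 = imap, T2 = (\<lambda>c. imap (src2 c))\<rparr>"
  "T1 (Fib (integ P) x) = int_fib_tri"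
  "Lali (integ P) x = (1, unit P)"
  "Ter (integ P) (m, a) = Int1 (m, a) (1, unit P) (bang m) [a] (Idn (Cat P m) a)"
  "Lift (integ P) g (n, z) bs = Int1 (length g, mu0 P g z (map snd bs)) (n, z) g (map snd bs)
     (Idn (Cat P (length g)) (mu0 P g z (map snd bs)))"
  by (simp_all add: integ_def)

lemma vert_simps [simp]:
  "Obj (vert C) = Arr C" "Arr (vert C) = Cell C" "Src (vert C) = Src2 C" "Trg (vert C) = Trg2 C"
  "Idn (vert C) = Idn2 C" "Cmp (vert C) = VCmp C"
  by (simp_all add: vert_def)

lemma horiz_simps [simp]:
  "Obj (horiz C) = Obj C" "Arr (horiz C) = Cell C" "Src (horiz C) c = Src C (Src2 C c)"
  "Trg (horiz C) c = Trg C (Src2 C c)" "Idn (horiz C) x = Idn2 C (Idn C x)" "Cmp (horiz C) = HCmp C"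
  by (simp_all add: horiz_def)

lemma int_comp_sel [simp]:
  "src1 (int_comp P G F) = src1 F" "trg1 (int_comp P G F) = trg1 G"
  "imap (int_comp P G F) = ocomp (imap G) (imap F)"
  by (simp_all add: int_comp_def)

context oper
begin

lemma Int1_iff:
  "Int1 (m, a) (k, b) f as \<alpha> \<in> int_arrows P \<longleftrightarrow>
    a \<in> Obj (Cat P m) \<and> b \<in> Obj (Cat P k) \<and> osurj m k f \<and> as \<in> Obj (fibcat P f) \<and>
    \<alpha> \<in> homset (Cat P m) (mu0 P f b as) a"
  by (simp add: int_arrows_def)

lemma Int1E:
  assumes "s \<in> int_arrows P"
  obtains m a k b f as \<alpha> where "s = Int1 (m, a) (k, b) f as \<alpha>" "a \<in> Obj (Cat P m)"
    "b \<in> Obj (Cat P k)" "osurj m k f" "as \<in> Obj (fibcat P f)"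
    "\<alpha> \<in> homset (Cat P m) (mu0 P f b as) a"
  using assms by (auto simp: int_arrows_def)

lemma homset_integE:
  assumes "s \<in> homset (integ P) (m, a) (k, b)"
  obtains f as \<alpha> where "s = Int1 (m, a) (k, b) f as \<alpha>" "a \<in> Obj (Cat P m)"
    "b \<in> Obj (Cat P k)" "osurj m k f" "as \<in> Obj (fibcat P f)"
    "\<alpha> \<in> homset (Cat P m) (mu0 P f b as) a"
  using assms by (auto simp: homset_def elim: Int1E)

lemma Int2_iff:
  "Int2 (Int1 (m, a) (k, b) f as \<alpha>) (Int1 (m, a) (k, b) f as' \<alpha>') \<delta> \<in> int_cells P \<longleftrightarrow>
    Int1 (m, a) (k, b) f as \<alpha> \<in> int_arrows P \<and> Int1 (m, a) (k, b) f as' \<alpha>' \<in> int_arrows P \<and>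
    \<delta> \<in> homset (fibcat P f) as as' \<and>
    Cmp (Cat P m) \<alpha>' (mu1 P f (Idn (Cat P k) b) \<delta>) = \<alpha>"
  by (simp add: int_cells_def)

text \<open>The two 1-cells of a 2-cell share their ends and their surjection, so these are produced
  only once.\<close>

lemma Int2E:
  assumes "c \<in> int_cells P" "src1 (src2 c) = (m, a)" "trg1 (src2 c) = (k, b)"
  obtains f as \<alpha> as' \<alpha>' \<delta> where
    "c = Int2 (Int1 (m, a) (k, b) f as \<alpha>) (Int1 (m, a) (k, b) f as' \<alpha>') \<delta>"
    "a \<in> Obj (Cat P m)" "b \<in> Obj (Cat P k)" "osurj m k f"
    "as \<in> Obj (fibcat P f)" "\<alpha> \<in> homset (Cat P m) (mu0 P f b as) a"
    "as' \<in> Obj (fibcat P f)" "\<alpha>' \<in> homset (Cat P m) (mu0 P f b as') a"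
    "\<delta> \<in> homset (fibcat P f) as as'" "Cmp (Cat P m) \<alpha>' (mu1 P f (Idn (Cat P k) b) \<delta>) = \<alpha>"
proof -
  from assms(1) obtain s t \<delta> where c: "c = Int2 s t \<delta>" and s: "s \<in> int_arrows P"
    and t: "t \<in> int_arrows P" and st:
    "src1 s = src1 t" "trg1 s = trg1 t" "imap s = imap t" "\<delta> \<in> homset (fibcat P (imap s)) (iobs s) (iobs t)"
    "Cmp (Cat P (fst (src1 t))) (iarr t)
          (mu1 P (imap t) (Idn (Cat P (fst (trg1 t))) (snd (trg1 t))) \<delta>) = iarr s"
    unfolding int_cells_def by blast
  from s assms(2,3) obtain f as \<alpha> where 1: "s = Int1 (m, a) (k, b) f as \<alpha>"
    by (auto elim!: Int1E simp: c)
  with t st obtain as' \<alpha>' where "t = Int1 (m, a) (k, b) f as' \<alpha>'"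
    by (auto elim!: Int1E)
  with 1 c s t st show thesis
    by (intro that) (auto simp: Int1_iff)
qed

lemma Idn_fib_homset:
  "osurj m k f \<Longrightarrow> as \<in> Obj (fibcat P f) \<Longrightarrow> Idn (fibcat P f) as \<in> homset (fibcat P f) as as"
  by (rule Idn_homset[OF category_fibcat])

lemma Idn_Cat_homset:
  "1 \<le> n \<Longrightarrow> a \<in> Obj (Cat P n) \<Longrightarrow> Idn (Cat P n) a \<in> homset (Cat P n) a a"
  by (rule Idn_homset[OF category_Cat])

lemma ar_assoc:
  "osurj m k f \<Longrightarrow> osurj k n g \<Longrightarrow> c \<in> homset (Cat P n) x y \<Longrightarrow> bs \<in> homset (fibcat P g) xs ys \<Longrightarrow>
    as \<in> homset (fibcat P f) us vs \<Longrightarrow>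
    mu1 P f (mu1 P g c bs) as = mu1 P (ocomp g f) c (mul (mu1 P) g f bs as)"
  by (auto intro!: ar.mu_assoc dest: homsetD(1) homset_fibcat_tup(1))

text \<open>Whiskering \<open>c\<close> with \<open>bs\<close> and then with \<open>as\<close> is
  whiskering once with the composed tuple. This is what associativity of the composition of 1-cells
  needs.\<close>

lemma mu_assoc_Idn:
  assumes f: "osurj m k f" and g: "osurj k n g" and c: "c \<in> homset (Cat P n) x y"
    and bs: "bs \<in> Obj (fibcat P g)" and as: "as \<in> Obj (fibcat P f)"
  shows "mu1 P (ocomp g f) c (Idn (fibcat P (ocomp g f)) (mul (mu0 P) g f bs as)) =
    mu1 P f (mu1 P g c (Idn (fibcat P g) bs)) (Idn (fibcat P f) as)"
  by (simp add: mul_Idn[OF f g bs as, symmetric]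
      ar_assoc[OF f g c Idn_fib_homset[OF g bs] Idn_fib_homset[OF f as]])

lemma mu_Cmp_Idn:
  assumes f: "osurj m k f" and c: "c \<in> homset (Cat P k) x y" and d: "d \<in> homset (Cat P k) y z"
    and as: "as \<in> Obj (fibcat P f)"
  shows "mu1 P f (Cmp (Cat P k) d c) (Idn (fibcat P f) as) =
    Cmp (Cat P m) (mu1 P f d (Idn (fibcat P f) as)) (mu1 P f c (Idn (fibcat P f) as))"
  using mu_Cmp[OF f c d Idn_fib_homset[OF f as] Idn_fib_homset[OF f as]]
    Cmp_Idn_left[OF category_fibcat[OF f] Idn_fib_homset[OF f as]] by simp

lemma mu_Idn_Cmp:
  assumes f: "osurj m k f" and b: "b \<in> Obj (Cat P k)"
    and as: "as \<in> homset (fibcat P f) xs ys" and bs: "bs \<in> homset (fibcat P f) ys zs"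
  shows "mu1 P f (Idn (Cat P k) b) (Cmp (fibcat P f) bs as) =
    Cmp (Cat P m) (mu1 P f (Idn (Cat P k) b) bs) (mu1 P f (Idn (Cat P k) b) as)"
  using mu_Cmp[OF f Idn_Cat_homset[OF osurjD(2)[OF f] b] Idn_Cat_homset[OF osurjD(2)[OF f] b] as bs]
    Cmp_Idn_left[OF category_Cat Idn_Cat_homset, OF osurjD(2) osurjD(2), OF f f b] by simp

text \<open>Interchange in the product category: the pair of \<open>c\<close> and \<open>as\<close>
  factors in two ways into a pair acting on one side only after another, and the composition functor
  preserves both factorizations. Horizontal composition uses the second form, fullness the
  first.\<close>

lemma mu_split:
  assumes f: "osurj m k f" and c: "c \<in> homset (Cat P k) x y" and as: "as \<in> homset (fibcat P f) xs ys"
  shows "mu1 P f c as =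
      Cmp (Cat P m) (mu1 P f c (Idn (fibcat P f) ys)) (mu1 P f (Idn (Cat P k) x) as)"
    and "mu1 P f c as =
      Cmp (Cat P m) (mu1 P f (Idn (Cat P k) y) as) (mu1 P f c (Idn (fibcat P f) xs))"
proof -
  note C = category_Cat[OF osurjD(2)[OF f]] and F = category_fibcat[OF f]
  note x = homset_Obj[OF C c] and xs = homset_Obj[OF F as]
  show "mu1 P f c as =
      Cmp (Cat P m) (mu1 P f c (Idn (fibcat P f) ys)) (mu1 P f (Idn (Cat P k) x) as)"
    using mu_Cmp[OF f Idn_homset[OF C, of x] c as Idn_homset[OF F]] x xs
    by (simp add: Cmp_Idn_right[OF C c] Cmp_Idn_left[OF F as])
  show "mu1 P f c as =
      Cmp (Cat P m) (mu1 P f (Idn (Cat P k) y) as) (mu1 P f c (Idn (fibcat P f) xs))"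
    using mu_Cmp[OF f c Idn_homset[OF C, of y] Idn_homset[OF F, of xs] as] x xs
    by (simp add: Cmp_Idn_left[OF C c] Cmp_Idn_right[OF F as])
qed

lemma Idn_fib_oid:
  assumes "1 \<le> n"
  shows "Idn (fibcat P (oid n)) (replicate n (unit P)) = replicate n (unit_arr P)"
  using osurjD(6)[OF osurj_oid[OF assms]]
  by (intro nth_equalityI) (auto simp: length_Idn_fibcat nth_Idn_fibcat psize_oid unit_arr_def)

lemma replicate_unit_fib: "1 \<le> n \<Longrightarrow> replicate n (unit P) \<in> Obj (fibcat P (oid n))"
  using ob.tup_replicate by (simp add: Obj_fibcat)

section \<open>The category of objects and 1-cells\<close>

lemma int_comp_Int1:
  assumes "osurj k n g"
  shows "int_comp P (Int1 y (n, c) g bs \<beta>) (Int1 (m, a) x f as \<alpha>) =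
    Int1 (m, a) (n, c) (ocomp g f) (mul (mu0 P) g f bs as)
      (Cmp (Cat P m) \<alpha> (mu1 P f \<beta> (Idn (fibcat P f) as)))"
  using osurjD(6)[OF assms] by (simp add: int_comp_def mul_def)

lemma HCmp_integ:
  assumes "osurj k n g"
  shows "HCmp (integ P) (Int2 (Int1 y (n, c) g bs \<beta>) t \<epsilon>) (Int2 (Int1 x y' f as \<alpha>) t' \<delta>) =
    Int2 (int_comp P (Int1 y (n, c) g bs \<beta>) (Int1 x y' f as \<alpha>)) (int_comp P t t')
      (mul (mu1 P) g f \<epsilon> \<delta>)"
  using osurjD(6)[OF assms] by (simp add: integ_def mul_def)

lemma Int1_comp_arrow:
  assumes G: "Int1 (k, b) (n, c) g bs \<beta> \<in> int_arrows P" and F: "Int1 (m, a) (k, b) f as \<alpha> \<in> int_arrows P"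
  shows "Int1 (m, a) (n, c) (ocomp g f) (mul (mu0 P) g f bs as)
      (Cmp (Cat P m) \<alpha> (mu1 P f \<beta> (Idn (fibcat P f) as))) \<in> int_arrows P"
proof -
  have g: "osurj k n g" and f: "osurj m k f" and bs: "bs \<in> Obj (fibcat P g)" and c: "c \<in> Obj (Cat P n)"
    and as: "as \<in> Obj (fibcat P f)" and \<beta>: "\<beta> \<in> homset (Cat P k) (mu0 P g c bs) b"
    and \<alpha>: "\<alpha> \<in> homset (Cat P m) (mu0 P f b as) a" and a: "a \<in> Obj (Cat P m)"
    using assms by (auto simp: Int1_iff)
  \<comment> \<open>Associativity on objects rewrites the source of the whiskered \<beta>, so that
    \<alpha> after it has the type required over \<open>ocomp g f\<close>.\<close>
  have "mu1 P f \<beta> (Idn (fibcat P f) as) \<in> homset (Cat P m)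
      (mu0 P (ocomp g f) c (mul (mu0 P) g f bs as)) (mu0 P f b as)"
    using mu_homset[OF f \<beta> Idn_fib_homset[OF f as]] ob.mu_assoc[OF f g c] bs as by (simp add: Obj_fibcat)
  then show ?thesis
    using a c bs as ob.mul_closed[OF f g] Cmp_homset[OF category_Cat[OF osurjD(1)[OF f]] _ \<alpha>]
    by (simp add: Int1_iff osurj_ocomp[OF f g] Obj_fibcat)
qed

lemma int_comp_arrow:
  assumes F: "F \<in> int_arrows P" and G: "G \<in> int_arrows P" and FG: "src1 G = trg1 F"
  shows "int_comp P G F \<in> int_arrows P"
proof -
  obtain m a k b f as \<alpha> where F_eq: "F = Int1 (m, a) (k, b) f as \<alpha>"
    using F by (rule Int1E)
  obtain n c g bs \<beta> where G_eq: "G = Int1 (k, b) (n, c) g bs \<beta>"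
    using G FG by (auto simp: F_eq elim: Int1E)
  then have "osurj k n g" using G by (simp add: Int1_iff)
  then show ?thesis
    using Int1_comp_arrow F G by (simp add: F_eq G_eq int_comp_Int1)
qed

lemma category_integ: "category (integ P)"
proof (rule categoryI)
  fix f assume "f \<in> Arr (integ P)"
  then show "Src (integ P) f \<in> Obj (integ P) \<and> Trg (integ P) f \<in> Obj (integ P)"
    by (auto elim!: Int1E dest: osurjD(1,2))
next
  fix x assume "x \<in> Obj (integ P)"
  then obtain m a where x: "x = (m, a)" "1 \<le> m" "a \<in> Obj (Cat P m)" by auto
  then show "Idn (integ P) x \<in> homset (integ P) x x"
    by (simp add: homset_def Int1_iff osurj_oid replicate_unit_fib ob.mu_unit_right
        Idn_Cat_homset[unfolded homset_def, simplified])
next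
  fix F G x y z assume "F \<in> homset (integ P) x y" "G \<in> homset (integ P) y z"
  then show "Cmp (integ P) G F \<in> homset (integ P) x z"
    using int_comp_arrow by (auto simp: homset_def)
next
  fix F x y assume *: "F \<in> homset (integ P) x y"
  obtain m a k b where xy: "x = (m, a)" "y = (k, b)"
    by (cases x, cases y)
  from *[unfolded xy] obtain f as \<alpha> where F: "F = Int1 (m, a) (k, b) f as \<alpha>" and a: "a \<in> Obj (Cat P m)"
    and b: "b \<in> Obj (Cat P k)" and f: "osurj m k f" and as: "as \<in> Obj (fibcat P f)"
    and \<alpha>: "\<alpha> \<in> homset (Cat P m) (mu0 P f b as) a"
    by (rule homset_integE)
  note m = osurjD(1)[OF f] and k = osurjD(2)[OF f]
  \<comment> \<open>The last component of \<open>F\<close> after the identity contains \<alpha>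
    composed with units, which disappear by the right unit law for morphisms.\<close>
  have 1: "mu1 P (oid m) \<alpha> (Idn (fibcat P (oid m)) (replicate m (unit P))) = \<alpha>"
    using ar.mu_unit_right[OF m homsetD(1)[OF \<alpha>]] by (simp add: Idn_fib_oid[OF m])
  show "Cmp (integ P) F (Idn (integ P) x) = F"
    using ob.mul_unit_right[OF f] as
    by (simp add: F xy int_comp_Int1[OF f] 1 ocomp_oid_right[OF f] Obj_fibcat
        Cmp_Idn_left[OF category_Cat[OF m] \<alpha>])
  show "Cmp (integ P) (Idn (integ P) y) F = F"
    using ob.mul_unit_left[OF f] as mu_Idn[OF f b as]
    by (simp add: F xy int_comp_Int1[OF osurj_oid[OF k]] ocomp_oid_left[OF f] Obj_fibcat
        Cmp_Idn_right[OF category_Cat[OF m] \<alpha>])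
next
  fix F G H x y z w
  assume *: "F \<in> homset (integ P) x y" "G \<in> homset (integ P) y z" "H \<in> homset (integ P) z w"
  obtain m a k b n c p d where xyz: "x = (m, a)" "y = (k, b)" "z = (n, c)" "w = (p, d)"
    by (cases x, cases y, cases z, cases w)
  from *(1)[unfolded xyz] obtain f as \<alpha> where F: "F = Int1 (m, a) (k, b) f as \<alpha>"
    and f: "osurj m k f" and as: "as \<in> Obj (fibcat P f)"
    and \<alpha>: "\<alpha> \<in> homset (Cat P m) (mu0 P f b as) a" by (rule homset_integE)
  from *(2)[unfolded xyz] obtain g bs \<beta> where G: "G = Int1 (k, b) (n, c) g bs \<beta>"
    and g: "osurj k n g" and bs: "bs \<in> Obj (fibcat P g)" and c: "c \<in> Obj (Cat P n)"
    and \<beta>: "\<beta> \<in> homset (Cat P k) (mu0 P g c bs) b" by (rule homset_integE)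
  from *(3)[unfolded xyz] obtain h cs \<gamma> where H: "H = Int1 (n, c) (p, d) h cs \<gamma>"
    and h: "osurj n p h" and cs: "cs \<in> Obj (fibcat P h)"
    and \<gamma>: "\<gamma> \<in> homset (Cat P n) (mu0 P h d cs) c" by (rule homset_integE)
  note Ias = Idn_fib_homset[OF f as] and Ibs = Idn_fib_homset[OF g bs]
  note \<gamma>' = mu_homset[OF g \<gamma> Ibs]
  note gf = osurj_ocomp[OF f g] and hg = osurj_ocomp[OF g h]
  \<comment> \<open>Both last components are \<alpha> after \<open>\<mu>_f(\<beta>, 1)\<close> after
    \<open>\<mu>_f(\<mu>_g(\<gamma>, 1), 1)\<close>, bracketed differently.\<close>
  have "Cmp (Cat P m) \<alpha> (mu1 P f (Cmp (Cat P k) \<beta> (mu1 P g \<gamma> (Idn (fibcat P g) bs))) (Idn (fibcat P f) as))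
     = Cmp (Cat P m) (Cmp (Cat P m) \<alpha> (mu1 P f \<beta> (Idn (fibcat P f) as)))
         (mu1 P (ocomp g f) \<gamma> (Idn (fibcat P (ocomp g f)) (mul (mu0 P) g f bs as)))"
    unfolding mu_assoc_Idn[OF f g \<gamma> bs as] mu_Cmp_Idn[OF f \<gamma>' \<beta> as]
    using Cmp_assoc[OF category_Cat[OF osurjD(1)[OF f]] mu_homset[OF f \<gamma>' Ias] mu_homset[OF f \<beta> Ias] \<alpha>] .
  then show "Cmp (integ P) H (Cmp (integ P) G F) = Cmp (integ P) (Cmp (integ P) H G) F"
    using ob.mul_assoc[OF f g h] cs bs as
    by (simp add: F G H int_comp_Int1[OF g] int_comp_Int1[OF h] int_comp_Int1[OF hg]
        ocomp_assoc[OF f g] Obj_fibcat)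
qed

section \<open>Vertical composition of 2-cells\<close>

lemma homset_vertE:
  assumes "c \<in> homset (vert (integ P)) s t"
  obtains m a k b f as \<alpha> as' \<alpha>' \<delta> where
    "s = Int1 (m, a) (k, b) f as \<alpha>" "t = Int1 (m, a) (k, b) f as' \<alpha>'" "c = Int2 s t \<delta>"
    "a \<in> Obj (Cat P m)" "b \<in> Obj (Cat P k)" "osurj m k f"
    "as \<in> Obj (fibcat P f)" "\<alpha> \<in> homset (Cat P m) (mu0 P f b as) a"
    "as' \<in> Obj (fibcat P f)" "\<alpha>' \<in> homset (Cat P m) (mu0 P f b as') a"
    "\<delta> \<in> homset (fibcat P f) as as'" "Cmp (Cat P m) \<alpha>' (mu1 P f (Idn (Cat P k) b) \<delta>) = \<alpha>"
proof -
  obtain m a k b where mk: "src1 (src2 c) = (m, a)" "trg1 (src2 c) = (k, b)" by fastforce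
  have c: "c \<in> int_cells P" and st: "src2 c = s" "trg2 c = t"
    using assms by (auto simp: homset_def)
  from c mk show thesis
    by (rule Int2E) (rule that[of m a k b], use st in auto)
qed

lemma Idn2_cell:
  assumes "s \<in> int_arrows P"
  shows "Idn2 (integ P) s \<in> int_cells P"
proof -
  from assms obtain m a k b f as \<alpha> where s: "s = Int1 (m, a) (k, b) f as \<alpha>" and b: "b \<in> Obj (Cat P k)"
    and f: "osurj m k f" and as: "as \<in> Obj (fibcat P f)" and \<alpha>: "\<alpha> \<in> homset (Cat P m) (mu0 P f b as) a"
    by (rule Int1E)
  show ?thesis
    using assms mu_Idn[OF f b as] Cmp_Idn_right[OF category_Cat[OF osurjD(1)[OF f]] \<alpha>]
    by (simp add: s Int2_iff Idn_fib_homset[OF f as])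
qed

lemma category_vert: "category (vert (integ P))"
proof (rule categoryI)
  fix c assume "c \<in> Arr (vert (integ P))"
  then show "Src (vert (integ P)) c \<in> Obj (vert (integ P)) \<and> Trg (vert (integ P)) c \<in> Obj (vert (integ P))"
    by (auto simp: int_cells_def)
next
  fix s assume "s \<in> Obj (vert (integ P))"
  then show "Idn (vert (integ P)) s \<in> homset (vert (integ P)) s s"
    using Idn2_cell by (simp add: homset_def)
next
  fix c d r s t assume "c \<in> homset (vert (integ P)) r s" "d \<in> homset (vert (integ P)) s t"
  then show "Cmp (vert (integ P)) d c \<in> homset (vert (integ P)) r t"
  proof (elim homset_vertE)
    fix m a k b f as \<alpha> as' \<alpha>' \<delta> m' a' k' b' f' bs \<beta> bs' \<beta>' \<epsilon>
    assume *: "r = Int1 (m, a) (k, b) f as \<alpha>" "s = Int1 (m, a) (k, b) f as' \<alpha>'" "c = Int2 r s \<delta>"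
      "s = Int1 (m', a') (k', b') f' bs \<beta>" "t = Int1 (m', a') (k', b') f' bs' \<beta>'" "d = Int2 s t \<epsilon>"
      and o: "a \<in> Obj (Cat P m)" "b \<in> Obj (Cat P k)" and f: "osurj m k f"
      and as: "as \<in> Obj (fibcat P f)" and as': "as' \<in> Obj (fibcat P f)" and bs': "bs' \<in> Obj (fibcat P f')"
      and \<alpha>: "\<alpha> \<in> homset (Cat P m) (mu0 P f b as) a" and \<alpha>': "\<alpha>' \<in> homset (Cat P m) (mu0 P f b as') a"
      and \<beta>': "\<beta>' \<in> homset (Cat P m') (mu0 P f' b' bs') a'"
      and \<delta>: "\<delta> \<in> homset (fibcat P f) as as'" and \<epsilon>: "\<epsilon> \<in> homset (fibcat P f') bs bs'"
      and e: "Cmp (Cat P m) \<alpha>' (mu1 P f (Idn (Cat P k) b) \<delta>) = \<alpha>"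
        "Cmp (Cat P m') \<beta>' (mu1 P f' (Idn (Cat P k') b') \<epsilon>) = \<beta>"
    have eq: "m' = m" "a' = a" "k' = k" "b' = b" "f' = f" "bs = as'" "\<beta> = \<alpha>'"
      using * by auto
    note Ib = Idn_Cat_homset[OF osurjD(2)[OF f] o(2)]
    note \<beta>' = \<beta>'[unfolded eq] and \<epsilon> = \<epsilon>[unfolded eq] and bs' = bs'[unfolded eq] and e = e[unfolded eq]
    \<comment> \<open>\<open>mu_Idn_Cmp\<close> splits \<mu> of the composed tuple into a factor
      with \<epsilon> and one with \<delta>; the condition of \<open>d\<close> absorbs the first and
      then the condition of \<open>c\<close> absorbs the second.\<close>
    show ?thesis
      using * o f as bs' \<alpha> \<beta>' Cmp_homset[OF category_fibcat[OF f] \<delta> \<epsilon>] e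
        Cmp_assoc[OF category_Cat[OF osurjD(1)[OF f]] mu_homset[OF f Ib \<delta>] mu_homset[OF f Ib \<epsilon>] \<beta>']
      by (simp add: homset_def[of "vert (integ P)"] eq Int2_iff Int1_iff mu_Idn_Cmp[OF f o(2) \<delta> \<epsilon>])
  qed
next
  fix c s t assume "c \<in> homset (vert (integ P)) s t"
  then show "Cmp (vert (integ P)) c (Idn (vert (integ P)) s) = c"
    "Cmp (vert (integ P)) (Idn (vert (integ P)) t) c = c"
    by (auto elim!: homset_vertE simp: Cmp_Idn_left[OF category_fibcat] Cmp_Idn_right[OF category_fibcat])
next
  fix c d e q r s t
  assume c: "c \<in> homset (vert (integ P)) q r" and d: "d \<in> homset (vert (integ P)) r s"
    and e: "e \<in> homset (vert (integ P)) s t"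
  from c obtain m a k b f as \<alpha> as' \<alpha>' \<delta> where 1: "r = Int1 (m, a) (k, b) f as' \<alpha>'"
    "q = Int1 (m, a) (k, b) f as \<alpha>" "c = Int2 q r \<delta>" "\<delta> \<in> homset (fibcat P f) as as'" "osurj m k f"
    by (rule homset_vertE) blast
  from d[unfolded 1] obtain as'' \<alpha>'' \<delta>' where 2: "s = Int1 (m, a) (k, b) f as'' \<alpha>''" "d = Int2 r s \<delta>'"
    "\<delta>' \<in> homset (fibcat P f) as' as''" by (rule homset_vertE) (auto simp: 1)
  from e[unfolded 2] obtain as3 \<alpha>3 \<delta>3 where 3: "t = Int1 (m, a) (k, b) f as3 \<alpha>3" "e = Int2 s t \<delta>3"
    "\<delta>3 \<in> homset (fibcat P f) as'' as3" by (rule homset_vertE) (auto simp: 2)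
  show "Cmp (vert (integ P)) e (Cmp (vert (integ P)) d c) = Cmp (vert (integ P)) (Cmp (vert (integ P)) e d) c"
    using 1 2 3 Cmp_assoc[OF category_fibcat[OF 1(5)] 1(4) 2(3) 3(3)] by simp
qed

section \<open>Horizontal composition of 2-cells\<close>

lemma HCmp_cell:
  assumes c: "c \<in> int_cells P" and d: "d \<in> int_cells P" and cd: "src1 (src2 d) = trg1 (src2 c)"
  shows "HCmp (integ P) d c \<in> int_cells P"
    "src2 (HCmp (integ P) d c) = int_comp P (src2 d) (src2 c)"
    "trg2 (HCmp (integ P) d c) = int_comp P (trg2 d) (trg2 c)"
proof -
  obtain m a k b n z where x: "src1 (src2 c) = (m, a)" and y: "trg1 (src2 c) = (k, b)"
    and zz: "trg1 (src2 d) = (n, z)"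
    by (metis surj_pair)
  have y': "src1 (src2 d) = (k, b)" using cd y by simp
  obtain f as \<alpha> as' \<alpha>' \<delta> where
    c_eq: "c = Int2 (Int1 (m, a) (k, b) f as \<alpha>) (Int1 (m, a) (k, b) f as' \<alpha>') \<delta>"
    and a: "a \<in> Obj (Cat P m)" and b: "b \<in> Obj (Cat P k)" and f: "osurj m k f"
    and as: "as \<in> Obj (fibcat P f)" and \<alpha>: "\<alpha> \<in> homset (Cat P m) (mu0 P f b as) a"
    and as': "as' \<in> Obj (fibcat P f)" and \<alpha>': "\<alpha>' \<in> homset (Cat P m) (mu0 P f b as') a"
    and \<delta>: "\<delta> \<in> homset (fibcat P f) as as'" and c2: "Cmp (Cat P m) \<alpha>' (mu1 P f (Idn (Cat P k) b) \<delta>) = \<alpha>"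
    using c x y by (rule Int2E)
  obtain g bs \<beta> bs' \<beta>' \<epsilon> where
    d_eq: "d = Int2 (Int1 (k, b) (n, z) g bs \<beta>) (Int1 (k, b) (n, z) g bs' \<beta>') \<epsilon>"
    and z: "z \<in> Obj (Cat P n)" and g: "osurj k n g"
    and bs: "bs \<in> Obj (fibcat P g)" and \<beta>: "\<beta> \<in> homset (Cat P k) (mu0 P g z bs) b"
    and bs': "bs' \<in> Obj (fibcat P g)" and \<beta>': "\<beta>' \<in> homset (Cat P k) (mu0 P g z bs') b"
    and \<epsilon>: "\<epsilon> \<in> homset (fibcat P g) bs bs'" and d2: "Cmp (Cat P k) \<beta>' (mu1 P g (Idn (Cat P n) z) \<epsilon>) = \<beta>"
    using d y' zz by (rule Int2E)
  note m = osurjD(1)[OF f] and k = osurjD(1)[OF g] and n = osurjD(2)[OF g]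
  note C = category_Cat[OF m]
  note Ib = Idn_Cat_homset[OF k b] and Iz = Idn_Cat_homset[OF n z]
  note Ias = Idn_fib_homset[OF f as] and Ias' = Idn_fib_homset[OF f as']
  note e = mu_homset[OF g Iz \<epsilon>]
  \<comment> \<open>The condition for the horizontal composite. Associativity regroups the long
    tuple as \<open>\<mu>_f(\<mu>_g(1, \<epsilon>), \<delta>)\<close>; the condition of
    \<open>d\<close> merges this with \<open>\<beta>'\<close> into
    \<open>\<mu>_f(\<beta>, \<delta>)\<close>; after interchange the condition of \<open>c\<close>
    turns \<open>\<alpha>'\<close> into \<alpha>.\<close>
  have "Cmp (Cat P m) (Cmp (Cat P m) \<alpha>' (mu1 P f \<beta>' (Idn (fibcat P f) as')))
          (mu1 P (ocomp g f) (Idn (Cat P n) z) (mul (mu1 P) g f \<epsilon> \<delta>))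
      = Cmp (Cat P m) (Cmp (Cat P m) \<alpha>' (mu1 P f \<beta>' (Idn (fibcat P f) as')))
          (mu1 P f (mu1 P g (Idn (Cat P n) z) \<epsilon>) \<delta>)"
    by (simp add: ar_assoc[OF f g Iz \<epsilon> \<delta>])
  also have "\<dots> = Cmp (Cat P m) \<alpha>' (Cmp (Cat P m) (mu1 P f \<beta>' (Idn (fibcat P f) as'))
          (mu1 P f (mu1 P g (Idn (Cat P n) z) \<epsilon>) \<delta>))"
    by (rule Cmp_assoc[OF C mu_homset[OF f e \<delta>] mu_homset[OF f \<beta>' Ias'] \<alpha>', symmetric])
  also have "\<dots> = Cmp (Cat P m) \<alpha>' (mu1 P f \<beta> \<delta>)"
    using mu_Cmp[OF f e \<beta>' \<delta> Ias'] Cmp_Idn_left[OF category_fibcat[OF f] \<delta>] by (simp add: d2)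
  also have "\<dots> = Cmp (Cat P m) \<alpha>' (Cmp (Cat P m) (mu1 P f (Idn (Cat P k) b) \<delta>) (mu1 P f \<beta> (Idn (fibcat P f) as)))"
    by (subst mu_split(2)[OF f \<beta> \<delta>]) simp
  also have "\<dots> = Cmp (Cat P m) \<alpha> (mu1 P f \<beta> (Idn (fibcat P f) as))"
    using Cmp_assoc[OF C mu_homset[OF f \<beta> Ias] mu_homset[OF f Ib \<delta>] \<alpha>'] by (simp add: c2)
  finally show "HCmp (integ P) d c \<in> int_cells P"
    using Int1_comp_arrow[of k b n z g bs \<beta> m a f as \<alpha>] Int1_comp_arrow[of k b n z g bs' \<beta>' m a f as' \<alpha>']
      mul_homset[OF f g \<epsilon> \<delta>] a b z f g as as' bs bs' \<alpha> \<alpha>' \<beta> \<beta>'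
    by (simp add: c_eq d_eq HCmp_integ[OF g] int_comp_Int1[OF g] Int2_iff Int1_iff)
  show "src2 (HCmp (integ P) d c) = int_comp P (src2 d) (src2 c)"
    "trg2 (HCmp (integ P) d c) = int_comp P (trg2 d) (trg2 c)"
    by (simp_all add: integ_def)
qed

lemma homset_horizE:
  assumes "c \<in> homset (horiz (integ P)) (m, a) (k, b)"
  obtains f as \<alpha> as' \<alpha>' \<delta> where
    "c = Int2 (Int1 (m, a) (k, b) f as \<alpha>) (Int1 (m, a) (k, b) f as' \<alpha>') \<delta>"
    "a \<in> Obj (Cat P m)" "b \<in> Obj (Cat P k)" "osurj m k f"
    "as \<in> Obj (fibcat P f)" "\<alpha> \<in> homset (Cat P m) (mu0 P f b as) a"
    "as' \<in> Obj (fibcat P f)" "\<alpha>' \<in> homset (Cat P m) (mu0 P f b as') a"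
    "\<delta> \<in> homset (fibcat P f) as as'" "Cmp (Cat P m) \<alpha>' (mu1 P f (Idn (Cat P k) b) \<delta>) = \<alpha>"
proof -
  have "c \<in> int_cells P" "src1 (src2 c) = (m, a)" "trg1 (src2 c) = (k, b)"
    using assms by (auto simp: homset_def)
  then show thesis using that by (rule Int2E)
qed

lemma Int2_arrows:
  assumes "c \<in> int_cells P"
  shows "src2 c \<in> int_arrows P" "trg2 c \<in> int_arrows P"
    "src1 (trg2 c) = src1 (src2 c)" "trg1 (trg2 c) = trg1 (src2 c)" "imap (trg2 c) = imap (src2 c)"
  using assms by (auto simp: int_cells_def)

lemma category_horiz: "category (horiz (integ P))"
proof (rule categoryI)
  fix c assume "c \<in> Arr (horiz (integ P))"
  then show "Src (horiz (integ P)) c \<in> Obj (horiz (integ P)) \<and> Trg (horiz (integ P)) c \<in> Obj (horiz (integ P))"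
    using category_integ Int2_arrows(1) unfolding category_def by fastforce
next
  fix x assume "x \<in> Obj (horiz (integ P))"
  then show "Idn (horiz (integ P)) x \<in> homset (horiz (integ P)) x x"
    using Idn_homset[OF category_integ, of x] Idn2_cell by (simp add: homset_def)
next
  fix c d x y z assume "c \<in> homset (horiz (integ P)) x y" "d \<in> homset (horiz (integ P)) y z"
  then show "Cmp (horiz (integ P)) d c \<in> homset (horiz (integ P)) x z"
    using HCmp_cell by (auto simp: homset_def)
next
  fix c x y assume *: "c \<in> homset (horiz (integ P)) x y"
  obtain m a k b where xy: "x = (m, a)" "y = (k, b)" by (cases x, cases y)
  from *[unfolded xy] obtain f as \<alpha> as' \<alpha>' \<delta> where
    c: "c = Int2 (Int1 (m, a) (k, b) f as \<alpha>) (Int1 (m, a) (k, b) f as' \<alpha>') \<delta>"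
    and f: "osurj m k f" and \<delta>: "\<delta> \<in> homset (fibcat P f) as as'"
    by (rule homset_horizE)
  note m = osurjD(1)[OF f] and k = osurjD(2)[OF f]
  have arr: "Int1 (m, a) (k, b) f as \<alpha> \<in> homset (integ P) (m, a) (k, b)"
    "Int1 (m, a) (k, b) f as' \<alpha>' \<in> homset (integ P) (m, a) (k, b)"
    using * Int2_arrows[of c] by (auto simp: c homset_def)
  note t = homset_fibcat_tup(1)[OF f \<delta>]
  \<comment> \<open>Sources and targets of the composites are covered by the unit laws for 1-cells;
    only the tuples of components remain.\<close>
  note R = Cmp_Idn_right[OF category_integ arr(1), simplified] Cmp_Idn_right[OF category_integ arr(2), simplified]
  note L = Cmp_Idn_left[OF category_integ arr(1), simplified] Cmp_Idn_left[OF category_integ arr(2), simplified]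
  show "Cmp (horiz (integ P)) c (Idn (horiz (integ P)) x) = c"
    by (simp add: c xy HCmp_integ[OF f] R Idn_fib_oid[OF m] ar.mul_unit_right[OF f t])
  show "Cmp (horiz (integ P)) (Idn (horiz (integ P)) y) c = c"
    by (simp add: c xy HCmp_integ[OF osurj_oid[OF k]] L Idn_fib_oid[OF k] ar.mul_unit_left[OF f t])
next
  fix c d e x y z w
  assume *: "c \<in> homset (horiz (integ P)) x y" "d \<in> homset (horiz (integ P)) y z" "e \<in> homset (horiz (integ P)) z w"
  obtain m a k b n z' p w' where xy: "x = (m, a)" "y = (k, b)" "z = (n, z')" "w = (p, w')"
    by (cases x, cases y, cases z, cases w)
  from *(1)[unfolded xy] obtain f as \<alpha> as' \<alpha>' \<delta> where
    c: "c = Int2 (Int1 (m, a) (k, b) f as \<alpha>) (Int1 (m, a) (k, b) f as' \<alpha>') \<delta>"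
    and f: "osurj m k f" and \<delta>: "\<delta> \<in> homset (fibcat P f) as as'"
    by (rule homset_horizE)
  from *(2)[unfolded xy] obtain g bs \<beta> bs' \<beta>' \<epsilon> where
    d: "d = Int2 (Int1 (k, b) (n, z') g bs \<beta>) (Int1 (k, b) (n, z') g bs' \<beta>') \<epsilon>"
    and g: "osurj k n g" and \<epsilon>: "\<epsilon> \<in> homset (fibcat P g) bs bs'"
    by (rule homset_horizE)
  from *(3)[unfolded xy] obtain h cs \<gamma> cs' \<gamma>' \<zeta> where
    e: "e = Int2 (Int1 (n, z') (p, w') h cs \<gamma>) (Int1 (n, z') (p, w') h cs' \<gamma>') \<zeta>"
    and h: "osurj n p h" and \<zeta>: "\<zeta> \<in> homset (fibcat P h) cs cs'"
    by (rule homset_horizE)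
  have arr: "src2 c \<in> homset (integ P) x y" "trg2 c \<in> homset (integ P) x y"
    "src2 d \<in> homset (integ P) y z" "trg2 d \<in> homset (integ P) y z"
    "src2 e \<in> homset (integ P) z w" "trg2 e \<in> homset (integ P) z w"
    using * Int2_arrows by (auto simp: homset_def)
  note A = Cmp_assoc[OF category_integ arr(1,3,5)] Cmp_assoc[OF category_integ arr(2,4,6)]
  have "e = Int2 (src2 e) (trg2 e) \<zeta>" "d = Int2 (src2 d) (trg2 d) \<epsilon>" "c = Int2 (src2 c) (trg2 c) \<delta>"
    by (simp_all add: c d e)
  note hg = osurj_ocomp[OF g h]
  show "Cmp (horiz (integ P)) e (Cmp (horiz (integ P)) d c) = Cmp (horiz (integ P)) (Cmp (horiz (integ P)) e d) c"
    using A ar.mul_assoc[OF f g h homset_fibcat_tup(1)[OF h \<zeta>] homset_fibcat_tup(1)[OF g \<epsilon>] homset_fibcat_tup(1)[OF f \<delta>]]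
    by (simp add: c d e HCmp_integ[OF g] HCmp_integ[OF h] int_comp_Int1[OF g] int_comp_Int1[OF h] HCmp_integ[OF hg])
qed

lemma two_category_integ: "two_category (integ P)"
  unfolding two_category_def
proof (intro conjI ballI impI)
  fix c d assume cd: "c \<in> Cell (integ P)" "d \<in> Cell (integ P)" "Src (integ P) (Src2 (integ P) d) = Trg (integ P) (Src2 (integ P) c)"
  then show "Src2 (integ P) (HCmp (integ P) d c) = Cmp (integ P) (Src2 (integ P) d) (Src2 (integ P) c)"
    "Trg2 (integ P) (HCmp (integ P) d c) = Cmp (integ P) (Trg2 (integ P) d) (Trg2 (integ P) c)"
    using HCmp_cell by auto
next
  fix F G assume *: "F \<in> Arr (integ P)" "G \<in> Arr (integ P)" "Src (integ P) G = Trg (integ P) F"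
  obtain m a k b n c where x: "F \<in> homset (integ P) (m, a) (k, b)" "G \<in> homset (integ P) (k, b) (n, c)"
    using * by (metis (no_types, lifting) Arr_homset surj_pair)
  then show "HCmp (integ P) (Idn2 (integ P) G) (Idn2 (integ P) F) = Idn2 (integ P) (Cmp (integ P) G F)"
    by (elim homset_integE) (simp add: HCmp_integ int_comp_Int1 mul_Idn)
next
  fix c c' d d' assume *: "c \<in> Cell (integ P)" "c' \<in> Cell (integ P)" "d \<in> Cell (integ P)" "d' \<in> Cell (integ P)"
    "Src2 (integ P) c' = Trg2 (integ P) c" "Src2 (integ P) d' = Trg2 (integ P) d"
    "Src (integ P) (Src2 (integ P) d) = Trg (integ P) (Src2 (integ P) c)"
  obtain m a k b n z where x: "src1 (src2 c) = (m, a)" and y: "trg1 (src2 c) = (k, b)"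
    and zz: "trg1 (src2 d) = (n, z)"
    by (metis surj_pair)
  have y': "src1 (src2 d) = (k, b)" using * y by simp
  have c: "c \<in> int_cells P" and d: "d \<in> int_cells P" and c': "c' \<in> int_cells P" and d': "d' \<in> int_cells P"
    using * by auto
  obtain f as \<alpha> as' \<alpha>' \<delta> where
    c_eq: "c = Int2 (Int1 (m, a) (k, b) f as \<alpha>) (Int1 (m, a) (k, b) f as' \<alpha>') \<delta>"
    and f: "osurj m k f" and \<delta>: "\<delta> \<in> homset (fibcat P f) as as'"
    using c x y by (rule Int2E)
  obtain g bs \<beta> bs' \<beta>' \<epsilon> where
    d_eq: "d = Int2 (Int1 (k, b) (n, z) g bs \<beta>) (Int1 (k, b) (n, z) g bs' \<beta>') \<epsilon>"
    and g: "osurj k n g" and \<epsilon>: "\<epsilon> \<in> homset (fibcat P g) bs bs'"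
    using d y' zz by (rule Int2E)
  have c's: "c' \<in> homset (vert (integ P)) (Int1 (m, a) (k, b) f as' \<alpha>') (trg2 c')"
    and d's: "d' \<in> homset (vert (integ P)) (Int1 (k, b) (n, z) g bs' \<beta>') (trg2 d')"
    using * by (auto simp: homset_def c_eq d_eq)
  from c's obtain as'' \<alpha>'' \<delta>' where c'_eq: "c' = Int2 (Int1 (m, a) (k, b) f as' \<alpha>') (Int1 (m, a) (k, b) f as'' \<alpha>'') \<delta>'"
    and \<delta>': "\<delta>' \<in> homset (fibcat P f) as' as''"
    by (rule homset_vertE) auto
  from d's obtain bs'' \<beta>'' \<epsilon>' where d'_eq: "d' = Int2 (Int1 (k, b) (n, z) g bs' \<beta>') (Int1 (k, b) (n, z) g bs'' \<beta>'') \<epsilon>'"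
    and \<epsilon>': "\<epsilon>' \<in> homset (fibcat P g) bs' bs''"
    by (rule homset_vertE) auto
  \<comment> \<open>Interchange is \<open>mul_Cmp\<close>: composing tuples is functorial in both
    tuples.\<close>
  show "HCmp (integ P) (VCmp (integ P) d' d) (VCmp (integ P) c' c) = VCmp (integ P) (HCmp (integ P) d' c') (HCmp (integ P) d c)"
    by (simp add: c_eq d_eq c'_eq d'_eq HCmp_integ[OF g] int_comp_Int1[OF g] mul_Cmp[OF f g \<epsilon> \<epsilon>' \<delta> \<delta>'])
qed (auto simp: category_integ category_vert category_horiz Int2_arrows)

end

section \<open>Fibers\<close>

lemma Fib_integ [simp]:
  "T0 (Fib (integ P) x) \<phi> = map (\<lambda>i. (psize (imap \<phi>) i, iobs \<phi> ! i)) [0..<fst (trg1 \<phi>)]"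
  "T2 (Fib (integ P) x) \<tau> =
    map (\<lambda>i. Int2 (int_fib_tri (src_tri \<tau>) ! i) (int_fib_tri (trg_tri \<tau>) ! i)
                 (block (imap (d0 (src_tri \<tau>))) i (icomps (cell_tri \<tau>))))
      [0..<fst (trg1 (d0 (src_tri \<tau>)))]"
  by (simp_all add: integ_def)

lemma lslice_simps [simp]:
  "Obj (lslice C x) = {\<phi> \<in> Arr C. Trg C \<phi> = x}"
  "Arr (lslice C x) = lax_triangles C x"
  "Src (lslice C x) = d1" "Trg (lslice C x) = d0"
  "Idn (lslice C x) \<phi> = Tri (Idn C (Src C \<phi>)) \<phi> \<phi> (Idn2 C \<phi>)"
  "Cmp (lslice C x) = tri_comp C"
  "Src2 (lslice C x) = src_tri" "Trg2 (lslice C x) = trg_tri"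
  "Idn2 (lslice C x) s = Tri2 s s (Idn2 C (d2 s))"
  "VCmp (lslice C x) \<tau> \<sigma> = Tri2 (src_tri \<sigma>) (trg_tri \<tau>) (VCmp C (cell_tri \<tau>) (cell_tri \<sigma>))"
  "HCmp (lslice C x) \<tau> \<sigma> = Tri2 (tri_comp C (src_tri \<tau>) (src_tri \<sigma>)) (tri_comp C (trg_tri \<tau>) (trg_tri \<sigma>))
     (HCmp C (cell_tri \<tau>) (cell_tri \<sigma>))"
  by (simp_all add: lslice_def)

lemma Cell_lslice:
  "\<tau> \<in> Cell (lslice C x) \<longleftrightarrow>
    src_tri \<tau> \<in> lax_triangles C x \<and> trg_tri \<tau> \<in> lax_triangles C x \<and>
    d1 (src_tri \<tau>) = d1 (trg_tri \<tau>) \<and> d0 (src_tri \<tau>) = d0 (trg_tri \<tau>) \<and>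
    cell_tri \<tau> \<in> Cell C \<and> Src2 C (cell_tri \<tau>) = d2 (src_tri \<tau>) \<and> Trg2 C (cell_tri \<tau>) = d2 (trg_tri \<tau>) \<and>
    VCmp C (tcell (trg_tri \<tau>)) (HCmp C (Idn2 C (d0 (trg_tri \<tau>))) (cell_tri \<tau>)) = tcell (src_tri \<tau>)"
  by (cases \<tau>) (auto simp: lslice_def)

lemma lax_triangles_iff:
  "t \<in> lax_triangles C x \<longleftrightarrow>
    d2 t \<in> Arr C \<and> d1 t \<in> Arr C \<and> d0 t \<in> Arr C \<and> tcell t \<in> Cell C \<and>
    Trg C (d1 t) = x \<and> Trg C (d0 t) = x \<and> Src C (d2 t) = Src C (d1 t) \<and> Trg C (d2 t) = Src C (d0 t) \<and>
    Src2 C (tcell t) = Cmp C (d0 t) (d2 t) \<and> Trg2 C (tcell t) = d1 t"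
  by (cases t) (auto simp: lax_triangles_def)

lemma pow_simps [simp]:
  "Obj (pow C n) = {xs. length xs = n \<and> set xs \<subseteq> Obj C}"
  "Arr (pow C n) = {xs. length xs = n \<and> set xs \<subseteq> Arr C}"
  "Src (pow C n) = map (Src C)" "Trg (pow C n) = map (Trg C)" "Idn (pow C n) = map (Idn C)"
  "Cmp (pow C n) = map2 (Cmp C)"
  "Cell (pow C n) = {xs. length xs = n \<and> set xs \<subseteq> Cell C}"
  "Src2 (pow C n) = map (Src2 C)" "Trg2 (pow C n) = map (Trg2 C)" "Idn2 (pow C n) = map (Idn2 C)"
  "VCmp (pow C n) = map2 (VCmp C)" "HCmp (pow C n) = map2 (HCmp C)"
  by (simp_all add: pow_def)

context oper
begin

text \<open>The source of the 2-cell in a lax triangle is forced to be the composite of the two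
  short sides, so a triangle amounts to its three sides and a tuple \<delta>.\<close>

abbreviation lax_tri ::
  "('o, 'm) int1 \<Rightarrow> ('o, 'm) int1 \<Rightarrow> ('o, 'm) int1 \<Rightarrow> 'm list \<Rightarrow> (('o, 'm) int1, ('o, 'm) int2) tri" where
  "lax_tri \<psi> \<theta> \<phi> \<delta> \<equiv> Tri \<psi> \<theta> \<phi> (Int2 (int_comp P \<phi> \<psi>) \<theta> \<delta>)"

text \<open>2-cells exist only over equal surjections, which is why the long side lies over
  \<open>ocomp g f\<close>. The last conjunct is the 2-cell condition with the last component of the
  composite written out.\<close>

lemma lax_triangle_iff:
  assumes g: "osurj k n g" and f: "osurj m k f"
  shows "lax_tri (Int1 (m, a) (k, b) f as \<alpha>) (Int1 (m, a) (n, c) (ocomp g f) cs \<gamma>)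
      (Int1 (k, b) (n, c) g bs \<beta>) \<delta> \<in> lax_triangles (integ P) (n, c) \<longleftrightarrow>
    Int1 (m, a) (k, b) f as \<alpha> \<in> int_arrows P \<and> Int1 (m, a) (n, c) (ocomp g f) cs \<gamma> \<in> int_arrows P \<and>
    Int1 (k, b) (n, c) g bs \<beta> \<in> int_arrows P \<and>
    \<delta> \<in> homset (fibcat P (ocomp g f)) (mul (mu0 P) g f bs as) cs \<and>
    Cmp (Cat P m) \<gamma> (mu1 P (ocomp g f) (Idn (Cat P n) c) \<delta>) =
    Cmp (Cat P m) \<alpha> (mu1 P f \<beta> (Idn (fibcat P f) as))"
  using Int1_comp_arrow by (auto simp: lax_triangles_iff int_comp_Int1[OF g] Int2_iff)

text \<open>Prescribing \<open>d0 t\<close> is enough to take a triangle apart: the inner side must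
  end where \<open>d0 t\<close> starts, and the target of the 2-cell is the long side.\<close>

lemma lax_triangleE:
  assumes t: "t \<in> lax_triangles (integ P) (n, c)" and d0: "d0 t = Int1 (k, b) (n, c) g bs \<beta>"
  obtains m a f as \<alpha> cs \<gamma> \<delta> where
    "t = lax_tri (Int1 (m, a) (k, b) f as \<alpha>) (Int1 (m, a) (n, c) (ocomp g f) cs \<gamma>)
        (Int1 (k, b) (n, c) g bs \<beta>) \<delta>"
    "osurj m k f" "osurj k n g" "Int1 (m, a) (k, b) f as \<alpha> \<in> int_arrows P"
    "Int1 (m, a) (n, c) (ocomp g f) cs \<gamma> \<in> int_arrows P"
    "Int1 (k, b) (n, c) g bs \<beta> \<in> int_arrows P"
    "\<delta> \<in> homset (fibcat P (ocomp g f)) (mul (mu0 P) g f bs as) cs"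
    "Cmp (Cat P m) \<gamma> (mu1 P (ocomp g f) (Idn (Cat P n) c) \<delta>) =
    Cmp (Cat P m) \<alpha> (mu1 P f \<beta> (Idn (fibcat P f) as))"
proof -
  note T = t[unfolded lax_triangles_iff, simplified]
  have "d2 t \<in> int_arrows P" "trg1 (d2 t) = (k, b)" using T d0 by auto
  then obtain m a f as \<alpha> where d2: "d2 t = Int1 (m, a) (k, b) f as \<alpha>" and f: "osurj m k f"
    by (auto elim: Int1E)
  have g: "osurj k n g" using T d0 by (auto simp: Int1_iff)
  have s: "src2 (tcell t) = Int1 (m, a) (n, c) (ocomp g f) (mul (mu0 P) g f bs as)
          (Cmp (Cat P m) \<alpha> (mu1 P f \<beta> (Idn (fibcat P f) as)))"
    using T d0 d2 by (simp add: int_comp_Int1[OF g])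
  have "tcell t \<in> int_cells P"
    using T by blast
  moreover have "src1 (src2 (tcell t)) = (m, a)" "trg1 (src2 (tcell t)) = (n, c)"
    by (simp_all add: s)
  ultimately obtain \<delta> cs \<gamma> where c: "tcell t = Int2 (src2 (tcell t)) (Int1 (m, a) (n, c) (ocomp g f) cs \<gamma>) \<delta>"
    by (rule Int2E) (use s in auto)
  then have d1: "d1 t = Int1 (m, a) (n, c) (ocomp g f) cs \<gamma>"
    using T by (metis int2.sel(2))
  have "t = Tri (d2 t) (d1 t) (d0 t) (tcell t)" by simp
  also have "\<dots> = lax_tri (Int1 (m, a) (k, b) f as \<alpha>)
      (Int1 (m, a) (n, c) (ocomp g f) cs \<gamma>) (Int1 (k, b) (n, c) g bs \<beta>) \<delta>"
    using c s d0 d1 d2 by (simp add: int_comp_Int1[OF g])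
  finally have *: "t = \<dots>" .
  show thesis
    by (rule that[OF * f g]) (use t[unfolded * lax_triangle_iff[OF g f]] in auto)
qed

lemma fib_tri:
  "int_fib_tri (Tri (Int1 x y f as \<alpha>) (Int1 x' z' h cs \<gamma>) (Int1 y' (n, c) g bs \<beta>) (Int2 s t \<delta>)) =
    map (\<lambda>i. Int1 (psize h i, cs ! i) (psize g i, bs ! i) (induced g f i) (block g i as) (\<delta> ! i)) [0..<n]"
  by (simp add: int_fib_tri_def)

lemma homset_pow:
  "fs \<in> homset (pow C n) xs ys \<longleftrightarrow>
    length fs = n \<and> length xs = n \<and> length ys = n \<and> (\<forall>i<n. fs ! i \<in> homset C (xs ! i) (ys ! i))"
  by (auto simp: homset_def set_conv_nth list_eq_iff_nth_eq)

lemma Int1_Obj_fib: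
  assumes "Int1 x (n, c) f as \<alpha> \<in> int_arrows P" "i < n"
  shows "(psize f i, as ! i) \<in> Obj (integ P)" "length as = n"
proof -
  obtain m where f: "osurj m n f" and as: "as \<in> Obj (fibcat P f)"
    using assms(1) by (cases x) (auto simp: Int1_iff)
  show "(psize f i, as ! i) \<in> Obj (integ P)" "length as = n"
    using psize_pos[OF f assms(2)] ob.tup_nth[OF f _ assms(2), of as] tup_length[OF f, of _ as] as
    by (auto simp: Obj_fibcat)
qed

text \<open>Coordinate \<open>i\<close> of \<delta> goes from a composite to \<open>cs ! i\<close>,
  which is the type of the last component of a 1-cell.\<close>

lemma fib_tri_arrow:
  assumes g: "osurj k n g" and f: "osurj m k f" and i: "i < n"
    and as: "as \<in> Obj (fibcat P f)" and bs: "bs \<in> Obj (fibcat P g)"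
    and \<delta>: "\<delta> \<in> homset (fibcat P (ocomp g f)) (mul (mu0 P) g f bs as) cs"
  shows "Int1 (psize (ocomp g f) i, cs ! i) (psize g i, bs ! i) (induced g f i) (block g i as) (\<delta> ! i)
    \<in> int_arrows P"
proof -
  note gf = osurj_ocomp[OF f g]
  have "cs \<in> Obj (fibcat P (ocomp g f))"
    using homset_Obj[OF category_fibcat[OF gf] \<delta>] by simp
  then show ?thesis
    using as bs homset_fibcat_nth[OF gf \<delta> i] osurjD(6)[OF g] i
      ob.tup_nth[OF g, of bs i] ob.tup_nth[OF gf, of cs i] tup_block[OF f g i]
    by (simp add: Int1_iff osurj_induced[OF f g i] Obj_fibcat nth_mul)
qed

lemma fib_tri_comp:
  assumes t: "t \<in> lax_triangles (integ P) x" and s: "s \<in> lax_triangles (integ P) x" and st: "d0 s = d1 t"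
  shows "int_fib_tri (tri_comp (integ P) t s) = map2 (int_comp P) (int_fib_tri t) (int_fib_tri s)"
proof -
  obtain n c where x: "x = (n, c)" by (cases x)
  have "d0 t \<in> int_arrows P" "trg1 (d0 t) = (n, c)"
    using t by (auto simp: lax_triangles_iff x)
  then obtain k b g bs \<beta> where d0: "d0 t = Int1 (k, b) (n, c) g bs \<beta>" by (auto elim: Int1E)
  obtain m a f as \<alpha> cs \<gamma> \<delta> where t_eq:
    "t = lax_tri (Int1 (m, a) (k, b) f as \<alpha>) (Int1 (m, a) (n, c) (ocomp g f) cs \<gamma>)
        (Int1 (k, b) (n, c) g bs \<beta>) \<delta>"
    and f: "osurj m k f" and g: "osurj k n g" and Fa: "Int1 (m, a) (k, b) f as \<alpha> \<in> int_arrows P"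
    using t[unfolded x] d0 by (rule lax_triangleE)
  have d0s: "d0 s = Int1 (m, a) (n, c) (ocomp g f) cs \<gamma>" using st t_eq by simp
  obtain l d h ds \<sigma> es \<epsilon> \<zeta> where s_eq:
    "s = lax_tri (Int1 (l, d) (m, a) h ds \<sigma>)
        (Int1 (l, d) (n, c) (ocomp (ocomp g f) h) es \<epsilon>) (Int1 (m, a) (n, c) (ocomp g f) cs \<gamma>) \<zeta>"
    and h: "osurj l m h" and Ha: "Int1 (l, d) (m, a) h ds \<sigma> \<in> int_arrows P"
    using s[unfolded x] d0s by (rule lax_triangleE)
  note gf = osurj_ocomp[OF f g] and gfh = osurj_ocomp[OF h osurj_ocomp[OF f g]]
  have las: "length as = k" and lds: "length ds = m"
    using Fa Ha tup_length[OF f] tup_length[OF h] by (auto simp: Int1_iff Obj_fibcat)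
  show ?thesis
  proof (rule nth_equalityI)
    show "length (int_fib_tri (tri_comp (integ P) t s)) =
        length (map2 (int_comp P) (int_fib_tri t) (int_fib_tri s))"
      by (simp add: t_eq s_eq tri_comp_def int_fib_tri_def)
    fix i assume "i < length (int_fib_tri (tri_comp (integ P) t s))"
    then have i: "i < n" by (simp add: t_eq s_eq tri_comp_def int_fib_tri_def)
    \<comment> \<open>Composition of triangles whiskers \<delta> with identities and then composes
      with \<zeta>. In coordinate \<open>i\<close> the block of identities is again a tuple of
      identities (\<open>block_Idn\<close>), which leaves the composite of the two fibers.\<close>
    show "int_fib_tri (tri_comp (integ P) t s) ! i = map2 (int_comp P) (int_fib_tri t) (int_fib_tri s) ! i"
      using i osurjD(6)[OF gfh] osurjD(6)[OF gf]
      by (simp add: t_eq s_eq tri_comp_def int_comp_Int1[OF f] int_comp_Int1[OF g] HCmp_integ[OF gf] fib_tri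
          int_comp_Int1[OF osurj_induced[OF f g i]] ob.block_mul[OF h f g i las lds]
          induced_ocomp[OF h f g i] nth_Cmp_fibcat nth_mul block_Idn[OF h gf i lds])
  qed
qed

lemma fib_functor: 
  assumes x: "x \<in> Obj (integ P)"
  shows "is_functor (lslice (integ P) x) (pow (integ P) (fst x))
    (T0 (Fib (integ P) x)) (T1 (Fib (integ P) x))"
proof (rule is_functorI)
  let ?L = "lslice (integ P) x" and ?D = "pow (integ P) (fst x)" and ?F = "Fib (integ P) x"
  obtain n c where x: "x = (n, c)" by (cases x)
  {
    fix \<phi> assume "\<phi> \<in> Obj ?L"
    then have \<phi>: "\<phi> \<in> int_arrows P" "trg1 \<phi> = (n, c)" by (auto simp: x)
    then obtain k b g bs \<beta> where "\<phi> = Int1 (k, b) (n, c) g bs \<beta>"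
      by (auto elim: Int1E)
    with \<phi>(1) show "T0 ?F \<phi> \<in> Obj ?D"
      using Int1_Obj_fib by (auto simp: x)
  }
  {
    fix t \<theta> \<phi> assume t: "t \<in> homset ?L \<theta> \<phi>"
    then have "d0 t \<in> int_arrows P" "trg1 (d0 t) = (n, c)" and tl: "t \<in> lax_triangles (integ P) (n, c)"
      by (auto simp: homset_def lax_triangles_iff x)
    then obtain k b g bs \<beta> where d0: "d0 t = Int1 (k, b) (n, c) g bs \<beta>" by (auto elim: Int1E)
    obtain m a f as \<alpha> cs \<gamma> \<delta> where t_eq:
      "t = lax_tri (Int1 (m, a) (k, b) f as \<alpha>) (Int1 (m, a) (n, c) (ocomp g f) cs \<gamma>)
          (Int1 (k, b) (n, c) g bs \<beta>) \<delta>"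
      and f: "osurj m k f" and g: "osurj k n g" and F: "Int1 (m, a) (k, b) f as \<alpha> \<in> int_arrows P"
      and G: "Int1 (k, b) (n, c) g bs \<beta> \<in> int_arrows P"
      and \<delta>: "\<delta> \<in> homset (fibcat P (ocomp g f)) (mul (mu0 P) g f bs as) cs"
      using tl d0 by (rule lax_triangleE)
    have as: "as \<in> Obj (fibcat P f)" and bs: "bs \<in> Obj (fibcat P g)"
      using F G by (auto simp: Int1_iff)
    have "\<theta> = Int1 (m, a) (n, c) (ocomp g f) cs \<gamma>" "\<phi> = Int1 (k, b) (n, c) g bs \<beta>"
      using t by (auto simp: homset_def t_eq)
    then show "T1 ?F t \<in> homset ?D (T0 ?F \<theta>) (T0 ?F \<phi>)"
      unfolding homset_pow using fib_tri_arrow[OF g f _ as bs \<delta>]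
      by (auto simp: x t_eq fib_tri homset_def)
  }
  {
    fix \<phi> assume "\<phi> \<in> Obj ?L"
    then obtain k b g bs \<beta> where \<phi>: "\<phi> = Int1 (k, b) (n, c) g bs \<beta>" and g: "osurj k n g"
      and bs: "bs \<in> Obj (fibcat P g)"
      by (auto simp: x elim: Int1E)
    have l: "length bs = n" using tup_length[OF g] bs by (auto simp: Obj_fibcat)
    show "T1 ?F (Idn ?L \<phi>) = Idn ?D (T0 ?F \<phi>)"
      using l osurjD(6)[OF g]
      by (simp add: \<phi> x fib_tri induced_oid_right[OF g] block_replicate[OF g] nth_Idn_fibcat)
  }
  {
    fix s t q r p
    assume s: "s \<in> homset ?L q r" and t: "t \<in> homset ?L r p"
    then show "T1 ?F (Cmp ?L t s) =
        Cmp ?D (T1 ?F t) (T1 ?F s)"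
      by (auto simp: homset_def intro: fib_tri_comp)
  }
qed

text \<open>Both triangles and the 2-cell between them in normal form, over one pair of surjections.
  The last conclusion is the condition on a 2-cell of the slice, reduced to tuples of
  components.\<close>

lemma slice_cellE:
  assumes \<tau>: "\<tau> \<in> Cell (lslice (integ P) (n, c))" and d0: "d0 (src_tri \<tau>) = Int1 (k, b) (n, c) g bs \<beta>"
  obtains m a f as \<alpha> cs \<gamma> \<delta> as' \<alpha>' \<delta>' \<xi> where
    "src_tri \<tau> = lax_tri (Int1 (m, a) (k, b) f as \<alpha>)
        (Int1 (m, a) (n, c) (ocomp g f) cs \<gamma>) (Int1 (k, b) (n, c) g bs \<beta>) \<delta>"
    "trg_tri \<tau> = lax_tri (Int1 (m, a) (k, b) f as' \<alpha>')
        (Int1 (m, a) (n, c) (ocomp g f) cs \<gamma>) (Int1 (k, b) (n, c) g bs \<beta>) \<delta>'"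
    "cell_tri \<tau> = Int2 (Int1 (m, a) (k, b) f as \<alpha>) (Int1 (m, a) (k, b) f as' \<alpha>') \<xi>"
    "osurj m k f" "osurj k n g" "as \<in> Obj (fibcat P f)" "as' \<in> Obj (fibcat P f)" "bs \<in> Obj (fibcat P g)"
    "\<delta> \<in> homset (fibcat P (ocomp g f)) (mul (mu0 P) g f bs as) cs"
    "\<delta>' \<in> homset (fibcat P (ocomp g f)) (mul (mu0 P) g f bs as') cs"
    "\<xi> \<in> homset (fibcat P f) as as'"
    "Cmp (fibcat P (ocomp g f)) \<delta>' (mul (mu1 P) g f (Idn (fibcat P g) bs) \<xi>) = \<delta>"
proof -
  note T = \<tau>[unfolded Cell_lslice, simplified]
  have s: "src_tri \<tau> \<in> lax_triangles (integ P) (n, c)" using T by simp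
  from s d0 obtain m a f as \<alpha> cs \<gamma> \<delta> where s_eq:
    "src_tri \<tau> = lax_tri (Int1 (m, a) (k, b) f as \<alpha>)
        (Int1 (m, a) (n, c) (ocomp g f) cs \<gamma>) (Int1 (k, b) (n, c) g bs \<beta>) \<delta>"
    and f: "osurj m k f" and g: "osurj k n g" and G: "Int1 (k, b) (n, c) g bs \<beta> \<in> int_arrows P"
    and F: "Int1 (m, a) (k, b) f as \<alpha> \<in> int_arrows P"
    and \<delta>: "\<delta> \<in> homset (fibcat P (ocomp g f)) (mul (mu0 P) g f bs as) cs"
    by (rule lax_triangleE)
  have bs: "bs \<in> Obj (fibcat P g)" using G by (simp add: Int1_iff)
  have "cell_tri \<tau> \<in> int_cells P" "src1 (src2 (cell_tri \<tau>)) = (m, a)" "trg1 (src2 (cell_tri \<tau>)) = (k, b)"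
    using T s_eq by auto
  then obtain as' \<alpha>' \<xi> where c: "cell_tri \<tau> = Int2 (Int1 (m, a) (k, b) f as \<alpha>) (Int1 (m, a) (k, b) f as' \<alpha>') \<xi>"
    and as: "as \<in> Obj (fibcat P f)" "as' \<in> Obj (fibcat P f)" and \<xi>: "\<xi> \<in> homset (fibcat P f) as as'"
    by (rule Int2E) (use T s_eq in auto)
  have t: "trg_tri \<tau> \<in> lax_triangles (integ P) (n, c)" and d0t: "d0 (trg_tri \<tau>) = Int1 (k, b) (n, c) g bs \<beta>"
    using T d0 by simp_all
  have d1t: "d1 (trg_tri \<tau>) = Int1 (m, a) (n, c) (ocomp g f) cs \<gamma>"
    and d2t: "d2 (trg_tri \<tau>) = Int1 (m, a) (k, b) f as' \<alpha>'"
    using T s_eq c by (metis tri.sel(2), metis int2.sel(2))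
  obtain m1 a1 f1 as1 \<alpha>1 cs1 \<gamma>1 \<delta>' where t1: 
    "trg_tri \<tau> = lax_tri (Int1 (m1, a1) (k, b) f1 as1 \<alpha>1)
        (Int1 (m1, a1) (n, c) (ocomp g f1) cs1 \<gamma>1) (Int1 (k, b) (n, c) g bs \<beta>) \<delta>'"
    and \<delta>1: "\<delta>' \<in> homset (fibcat P (ocomp g f1)) (mul (mu0 P) g f1 bs as1) cs1"
    using t d0t by (rule lax_triangleE)
  have eq: "m1 = m" "a1 = a" "f1 = f" "as1 = as'" "\<alpha>1 = \<alpha>'" "cs1 = cs" "\<gamma>1 = \<gamma>"
    using d1t d2t unfolding t1 by simp_all
  note t_eq = t1[unfolded eq] and \<delta>' = \<delta>1[unfolded eq]
  have e: "Cmp (fibcat P (ocomp g f)) \<delta>' (mul (mu1 P) g f (Idn (fibcat P g) bs) \<xi>) = \<delta>"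
    using T by (simp add: s_eq t_eq c HCmp_integ[OF g])
  show thesis by (rule that[OF s_eq t_eq c f g as bs \<delta> \<delta>' \<xi> e])
qed

lemma Arr_lslice_d0E:
  assumes "\<phi> \<in> int_arrows P" "trg1 \<phi> = (n, c)"
  obtains k b g bs \<beta> where "\<phi> = Int1 (k, b) (n, c) g bs \<beta>" "osurj k n g" "bs \<in> Obj (fibcat P g)"
  using assms by (auto elim: Int1E)

lemma fib_cell:
  assumes \<tau>: "\<tau> \<in> Cell (lslice (integ P) (n, c))" and i: "i < n"
  shows "T2 (Fib (integ P) (n, c)) \<tau> ! i \<in> homset (vert (integ P))
    (int_fib_tri (src_tri \<tau>) ! i) (int_fib_tri (trg_tri \<tau>) ! i)"
proof -
  have "d0 (src_tri \<tau>) \<in> int_arrows P" "trg1 (d0 (src_tri \<tau>)) = (n, c)"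
    using \<tau> by (auto simp: Cell_lslice lax_triangles_iff)
  then obtain k b g bs \<beta> where d0: "d0 (src_tri \<tau>) = Int1 (k, b) (n, c) g bs \<beta>"
    by (rule Arr_lslice_d0E)
  obtain m a f as \<alpha> cs \<gamma> \<delta> as' \<alpha>' \<delta>' \<xi> where eq:
    "src_tri \<tau> = lax_tri (Int1 (m, a) (k, b) f as \<alpha>)
        (Int1 (m, a) (n, c) (ocomp g f) cs \<gamma>) (Int1 (k, b) (n, c) g bs \<beta>) \<delta>"
    "trg_tri \<tau> = lax_tri (Int1 (m, a) (k, b) f as' \<alpha>')
        (Int1 (m, a) (n, c) (ocomp g f) cs \<gamma>) (Int1 (k, b) (n, c) g bs \<beta>) \<delta>'"
    "cell_tri \<tau> = Int2 (Int1 (m, a) (k, b) f as \<alpha>) (Int1 (m, a) (k, b) f as' \<alpha>') \<xi>"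
    and f: "osurj m k f" and g: "osurj k n g"
    and as: "as \<in> Obj (fibcat P f)" and as': "as' \<in> Obj (fibcat P f)" and bs: "bs \<in> Obj (fibcat P g)"
    and \<delta>: "\<delta> \<in> homset (fibcat P (ocomp g f)) (mul (mu0 P) g f bs as) cs"
    and \<delta>': "\<delta>' \<in> homset (fibcat P (ocomp g f)) (mul (mu0 P) g f bs as') cs"
    and \<xi>: "\<xi> \<in> homset (fibcat P f) as as'"
    and e: "Cmp (fibcat P (ocomp g f)) \<delta>' (mul (mu1 P) g f (Idn (fibcat P g) bs) \<xi>) = \<delta>"
    using \<tau> d0 by (rule slice_cellE)
  have l: "length bs = n" using tup_length[OF g] bs by (auto simp: Obj_fibcat)
  \<comment> \<open>The 2-cell condition of the \<open>i\<close>-th fiber is coordinate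
    \<open>i\<close> of the slice condition \<open>e\<close>.\<close>
  have "Cmp (Cat P (psize (ocomp g f) i)) (\<delta>' ! i)
      (mu1 P (induced g f i) (Idn (Cat P (psize g i)) (bs ! i)) (block g i \<xi>)) = \<delta> ! i"
    using i l osurjD(6)[OF g] osurjD(6)[OF osurj_ocomp[OF f g]]
    by (simp add: e[symmetric] nth_Cmp_fibcat nth_mul nth_Idn_fibcat)
  then show ?thesis
    using i fib_tri_arrow[OF g f i as bs \<delta>] fib_tri_arrow[OF g f i as' bs \<delta>'] block_homset[OF f g i \<xi>]
    by (simp add: eq fib_tri homset_def[of "vert (integ P)"] Int2_iff)
qed

lemma length_fib_tri: "length (int_fib_tri t) = fst (trg1 (d0 t))"
  by (simp add: int_fib_tri_def)

text \<open>On 2-cells, taking fibers cuts the tuple into blocks, so vertical composition is handled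
  by \<open>block_Cmp\<close> and horizontal composition by \<open>block_mul\<close>. Sources and
  targets are covered by what is known for triangles.\<close>

lemma fib_two_functor:
  assumes "x \<in> Obj (integ P)"
  shows "two_functor (lslice (integ P) x) (pow (integ P) (fst x)) (Fib (integ P) x)"
  unfolding two_functor_def
proof (intro conjI)
  let ?L = "lslice (integ P) x" and ?D = "pow (integ P) (fst x)" and ?F = "Fib (integ P) x"
  obtain n c where x: "x = (n, c)" by (cases x)
  have d0: "fst (trg1 (d0 (src_tri \<tau>))) = n" "fst (trg1 (d0 (trg_tri \<tau>))) = n"
    if "\<tau> \<in> Cell ?L" for \<tau>
    using that by (auto simp: x Cell_lslice lax_triangles_iff)
  show F: "is_functor ?L ?D (T0 ?F) (T1 ?F)"
    using assms by (rule fib_functor)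
  have cell: "T2 ?F \<tau> \<in> Cell ?D"
    "map src2 (T2 ?F \<tau>) = int_fib_tri (src_tri \<tau>)"
    "map trg2 (T2 ?F \<tau>) = int_fib_tri (trg_tri \<tau>)"
    if "\<tau> \<in> Cell ?L" for \<tau>
  proof -
    have l: "length (T2 ?F \<tau>) = n"
      using d0[OF that] by simp
    show "T2 ?F \<tau> \<in> Cell ?D"
      using l fib_cell[OF that[unfolded x]] unfolding x
      by (auto simp: homset_def in_set_conv_nth simp del: Fib_integ)
    show "map src2 (T2 ?F \<tau>) = int_fib_tri (src_tri \<tau>)"
      "map trg2 (T2 ?F \<tau>) = int_fib_tri (trg_tri \<tau>)"
      using l d0[OF that] by (auto intro!: nth_equalityI simp: length_fib_tri)
  qed
  show "is_functor (vert ?L) (vert ?D) (T1 ?F) (T2 ?F)"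
  proof (rule is_functorI)
    fix t assume "t \<in> Obj (vert ?L)"
    then have t: "t \<in> lax_triangles (integ P) x" by simp
    then show "T1 ?F t \<in> Obj (vert ?D)"
      using homsetD(1)[OF functor_homset[OF F, of t "d1 t" "d0 t"]] by (simp add: homset_def)
    have "d0 t \<in> int_arrows P" "trg1 (d0 t) = (n, c)"
      using t by (auto simp: lax_triangles_iff x)
    then obtain k b g bs \<beta> where "d0 t = Int1 (k, b) (n, c) g bs \<beta>" by (rule Arr_lslice_d0E)
    with t[unfolded x] obtain m a f as \<alpha> cs \<gamma> \<delta> where t_eq:
      "t = lax_tri (Int1 (m, a) (k, b) f as \<alpha>) (Int1 (m, a) (n, c) (ocomp g f) cs \<gamma>)
          (Int1 (k, b) (n, c) g bs \<beta>) \<delta>"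
      and f: "osurj m k f" and g: "osurj k n g" and Fa: "Int1 (m, a) (k, b) f as \<alpha> \<in> int_arrows P"
      by (rule lax_triangleE)
    have las: "length as = k"
      using Fa tup_length[OF f] by (auto simp: Int1_iff Obj_fibcat)
    show "T2 ?F (Idn (vert ?L) t) =
        Idn (vert ?D) (T1 ?F t)"
      using las by (auto intro!: nth_equalityI simp: t_eq fib_tri block_Idn[OF f g])
  next
    fix \<tau> s t assume "\<tau> \<in> homset (vert ?L) s t"
    then show "T2 ?F \<tau> \<in> homset (vert ?D)
        (T1 ?F s) (T1 ?F t)"
      using cell by (auto simp: homset_def simp del: Fib_integ)
  next
    fix \<tau> \<sigma> r s t
    assume *: "\<tau> \<in> homset (vert ?L) r s" "\<sigma> \<in> homset (vert ?L) s t"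
    then have \<tau>: "\<tau> \<in> Cell ?L" "trg_tri \<tau> = s" and \<sigma>: "\<sigma> \<in> Cell ?L" "src_tri \<sigma> = s"
      by (auto simp: homset_def)
    then have "d0 (src_tri \<tau>) \<in> int_arrows P" "trg1 (d0 (src_tri \<tau>)) = (n, c)"
      by (auto simp: Cell_lslice lax_triangles_iff x)
    then obtain k b g bs \<beta> where d0: "d0 (src_tri \<tau>) = Int1 (k, b) (n, c) g bs \<beta>"
      by (rule Arr_lslice_d0E)
    from \<tau>(1)[unfolded x] d0 obtain m a f as \<alpha> as' \<alpha>' \<xi> where f: "osurj m k f" and g: "osurj k n g"
      and d2: "d2 (trg_tri \<tau>) = Int1 (m, a) (k, b) f as' \<alpha>'" "d0 (trg_tri \<tau>) = Int1 (k, b) (n, c) g bs \<beta>"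
      and c\<tau>: "cell_tri \<tau> = Int2 (Int1 (m, a) (k, b) f as \<alpha>) (Int1 (m, a) (k, b) f as' \<alpha>') \<xi>"
      and \<xi>: "\<xi> \<in> homset (fibcat P f) as as'"
      by (rule slice_cellE) (metis tri.sel(1,3))
    have d0s: "d0 (src_tri \<sigma>) = Int1 (k, b) (n, c) g bs \<beta>"
      using \<tau>(2) \<sigma>(2) d2 by simp
    from \<sigma>(1)[unfolded x] d0s obtain l d h bs bs' \<eta> where h: "osurj l k h"
      and \<eta>: "\<eta> \<in> homset (fibcat P h) bs bs'" "icomps (cell_tri \<sigma>) = \<eta>"
      by (rule slice_cellE) (metis int2.sel(3))
    note \<tau>' = homset_fibcat_length(1)[OF f \<xi>] homset_fibcat_length(1)[OF h \<eta>(1)]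
    have "d2 (src_tri \<tau>) = Int1 (m, a) (k, b) f as \<alpha>"
      using \<tau>(1) c\<tau> by (simp add: Cell_lslice)
    \<comment> \<open>Vertical composition in the target takes place in the categories given by the
      surjection of the source 1-cell, here an \<open>i\<close>-th fiber, so this surjection has to
      be known.\<close>
    then have i: "imap (int_fib_tri (src_tri \<tau>) ! i) = induced g f i" if "i < n" for i
      using that d0 by (simp add: int_fib_tri_def)
    show "T2 ?F (Cmp (vert ?L) \<sigma> \<tau>) =
        Cmp (vert ?D) (T2 ?F \<sigma>) (T2 ?F \<tau>)"
      using \<tau>' by (auto intro!: nth_equalityI simp: d0 d0s c\<tau> \<eta>(2) i block_Cmp[OF f g])
  qed
  show "is_functor (horiz ?L) (horiz ?D) (T0 ?F) (T2 ?F)"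
  proof (rule is_functorI)
    fix \<phi> assume \<phi>: "\<phi> \<in> Obj (horiz ?L)"
    then show "T0 ?F \<phi> \<in> Obj (horiz ?D)"
      using functor_Obj[OF F] by simp
    from \<phi> have "\<phi> \<in> int_arrows P" "trg1 \<phi> = (n, c)" by (auto simp: x)
    then obtain k b g bs \<beta> where \<phi>': "\<phi> = Int1 (k, b) (n, c) g bs \<beta>" "osurj k n g" "bs \<in> Obj (fibcat P g)"
      by (rule Arr_lslice_d0E)
    note k = osurjD(1)[OF \<phi>'(2)]
    show "T2 ?F (Idn (horiz ?L) \<phi>) =
        Idn (horiz ?D) (T0 ?F \<phi>)"
      using functor_Idn[OF F, of \<phi>] \<phi> k
      by (auto intro!: nth_equalityI
         simp: \<phi>' x fib_tri Idn_fib_oid[OF k] Idn_fib_oid[OF psize_pos[OF \<phi>'(2)]] induced_oid_right[OF \<phi>'(2)] block_replicate[OF \<phi>'(2)])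
  next
    fix \<tau> \<theta> \<phi> assume *: "\<tau> \<in> homset (horiz ?L) \<theta> \<phi>"
    then have "src_tri \<tau> \<in> homset ?L \<theta> \<phi>"
      by (auto simp: homset_def Cell_lslice)
    then have "int_fib_tri (src_tri \<tau>) \<in> homset ?D (T0 ?F \<theta>) (T0 ?F \<phi>)"
      using functor_homset[OF F] by simp
    then show "T2 ?F \<tau> \<in> homset (horiz ?D)
        (T0 ?F \<theta>) (T0 ?F \<phi>)"
      using cell[of \<tau>] * by (simp add: homset_def map_map[symmetric] del: Fib_integ map_map)
  next
    fix \<sigma> \<tau> \<theta> \<phi> \<upsilon>
    assume *: "\<sigma> \<in> homset (horiz ?L) \<theta> \<phi>" "\<tau> \<in> homset (horiz ?L) \<phi> \<upsilon>"
    then have \<tau>: "\<tau> \<in> Cell ?L" "d1 (src_tri \<tau>) = \<phi>" and \<sigma>: "\<sigma> \<in> Cell ?L" "d0 (src_tri \<sigma>) = \<phi>"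
      by (auto simp: homset_def)
    have c: "int_fib_tri (tri_comp (integ P) (src_tri \<tau>) (src_tri \<sigma>)) =
        map2 (int_comp P) (int_fib_tri (src_tri \<tau>)) (int_fib_tri (src_tri \<sigma>))"
      "int_fib_tri (tri_comp (integ P) (trg_tri \<tau>) (trg_tri \<sigma>)) =
        map2 (int_comp P) (int_fib_tri (trg_tri \<tau>)) (int_fib_tri (trg_tri \<sigma>))"
      using \<tau> \<sigma> by (auto intro!: fib_tri_comp simp: Cell_lslice)
    have "d0 (src_tri \<tau>) \<in> int_arrows P" "trg1 (d0 (src_tri \<tau>)) = (n, c)"
      using \<tau> by (auto simp: Cell_lslice lax_triangles_iff x)
    then obtain k b g bs \<beta> where d0: "d0 (src_tri \<tau>) = Int1 (k, b) (n, c) g bs \<beta>"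
      by (rule Arr_lslice_d0E)
    from \<tau>(1)[unfolded x] d0 obtain m a f as \<alpha> cs \<gamma> \<delta> as' \<alpha>' \<delta>' \<xi> where T:
      "src_tri \<tau> = lax_tri (Int1 (m, a) (k, b) f as \<alpha>)
          (Int1 (m, a) (n, c) (ocomp g f) cs \<gamma>) (Int1 (k, b) (n, c) g bs \<beta>) \<delta>"
      "trg_tri \<tau> = lax_tri (Int1 (m, a) (k, b) f as' \<alpha>')
          (Int1 (m, a) (n, c) (ocomp g f) cs \<gamma>) (Int1 (k, b) (n, c) g bs \<beta>) \<delta>'"
      "cell_tri \<tau> = Int2 (Int1 (m, a) (k, b) f as \<alpha>) (Int1 (m, a) (k, b) f as' \<alpha>') \<xi>"
      and f: "osurj m k f" and g: "osurj k n g" and \<xi>: "\<xi> \<in> homset (fibcat P f) as as'"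
      by (rule slice_cellE)
    have d0': "d0 (src_tri \<sigma>) = Int1 (m, a) (n, c) (ocomp g f) cs \<gamma>"
      using \<tau>(2) \<sigma>(2) T(1) by simp
    from \<sigma>(1)[unfolded x] d0' obtain l d h ds \<zeta> es \<epsilon> \<delta>2 ds' \<zeta>' \<delta>2' \<eta> where S:
      "src_tri \<sigma> = lax_tri (Int1 (l, d) (m, a) h ds \<zeta>)
          (Int1 (l, d) (n, c) (ocomp (ocomp g f) h) es \<epsilon>) (Int1 (m, a) (n, c) (ocomp g f) cs \<gamma>) \<delta>2"
      "trg_tri \<sigma> = lax_tri (Int1 (l, d) (m, a) h ds' \<zeta>')
          (Int1 (l, d) (n, c) (ocomp (ocomp g f) h) es \<epsilon>) (Int1 (m, a) (n, c) (ocomp g f) cs \<gamma>) \<delta>2'"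
      "cell_tri \<sigma> = Int2 (Int1 (l, d) (m, a) h ds \<zeta>) (Int1 (l, d) (m, a) h ds' \<zeta>') \<eta>"
      and h: "osurj l m h" and \<eta>: "\<eta> \<in> homset (fibcat P h) ds ds'"
      by (rule slice_cellE)
    note l\<xi> = homset_fibcat_length(1)[OF f \<xi>] and l\<eta> = homset_fibcat_length(1)[OF h \<eta>]
    show "T2 ?F (Cmp (horiz ?L) \<tau> \<sigma>) =
        Cmp (horiz ?D) (T2 ?F \<tau>) (T2 ?F \<sigma>)"
    proof (rule nth_equalityI)
      have d0s: "d0 (tri_comp (integ P) (src_tri \<tau>) (src_tri \<sigma>)) = Int1 (k, b) (n, c) g bs \<beta>"
        by (simp add: tri_comp_def d0)
      show "length (T2 ?F (Cmp (horiz ?L) \<tau> \<sigma>)) =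
          length (Cmp (horiz ?D) (T2 ?F \<tau>) (T2 ?F \<sigma>))"
        by (simp add: d0s d0 d0')
      fix i assume "i < length (T2 ?F (Cmp (horiz ?L) \<tau> \<sigma>))"
      then have i: "i < n" by (simp add: d0s)
      show "T2 ?F (Cmp (horiz ?L) \<tau> \<sigma>) ! i =
          Cmp (horiz ?D) (T2 ?F \<tau>) (T2 ?F \<sigma>) ! i"
        using i
        by (simp add: d0s d0 d0' c length_fib_tri)
          (simp add: T S fib_tri HCmp_integ[OF f] HCmp_integ[OF osurj_induced[OF f g i]]
             ar.block_mul[OF h f g i l\<xi> l\<eta>])
    qed
  qed
qed

end

section \<open>The axioms of operadic 2-categories\<close>

text \<open>Concatenation is the isomorphism that joins the powers in the fiber axiom; place
  \<open>j\<close> of block \<open>i\<close> becomes position \<open>off g i + j\<close>.\<close>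

lemma concat_eqI:
  assumes g: "osurj k n g" and "length zs = n" "length ys = k"
    and "\<And>i. i < n \<Longrightarrow> length (zs ! i) = psize g i"
    and "\<And>i j. i < n \<Longrightarrow> j < psize g i \<Longrightarrow> zs ! i ! j = ys ! (off g i + j)"
  shows "concat zs = ys"
proof -
  have "zs = map (\<lambda>i. map (\<lambda>j. ys ! (off g i + j)) [0..<psize g i]) [0..<n]"
    using assms by (auto intro!: nth_equalityI)
  then have "concat zs = map ((!) ys) [0..<k]"
    by (simp add: concat_blocks[OF g])
  then show ?thesis
    using assms(3) by (metis map_nth)
qed

lemma Fib_concat_simps [simp]:
  "T0 (Fib_concat C ps) xs = concat (map2 (\<lambda>p. T0 (Fib C p)) ps xs)"
  "T1 (Fib_concat C ps) ys = concat (map2 (\<lambda>p. T1 (Fib C p)) ps ys)"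
  "T2 (Fib_concat C ps) zs = concat (map2 (\<lambda>p. T2 (Fib C p)) ps zs)"
  by (simp_all add: Fib_concat_def)

lemma unzip_fun_simps [simp]:
  "T0 unzip_fun xs = xs" "T1 unzip_fun = unzip_tri" "T2 unzip_fun = unzip_tri2"
  by (simp_all add: unzip_fun_def)

lemma slice_fun_simps [simp]:
  "T0 (slice_fun F) = T1 F" "T1 (slice_fun F) = map_tri (T1 F) (T2 F)"
  "T2 (slice_fun F) = map_tri2 (T1 F) (T2 F)"
  by (simp_all add: slice_fun_def)

lemma dom_fun_simps [simp]:
  "T0 (dom_fun C) = Src C" "T1 (dom_fun C) = d2" "T2 (dom_fun C) = cell_tri"
  by (simp_all add: dom_fun_def)

lemma tcomp_simps [simp]:
  "T0 (tcomp G F) x = T0 G (T0 F x)" "T1 (tcomp G F) f = T1 G (T1 F f)" "T2 (tcomp G F) c = T2 G (T2 F c)"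
  by (simp_all add: tcomp_def)

lemma pow_fun_simps [simp]:
  "T0 (pow_fun F) = map (T0 F)" "T1 (pow_fun F) = map (T1 F)" "T2 (pow_fun F) = map (T2 F)"
  by (simp_all add: pow_fun_def)

lemma length_unzip_tri [simp]: "length (unzip_tri t) = length (d0 t)"
  by (simp add: unzip_tri_def)

lemma nth_unzip_tri:
  "i < length (d0 t) \<Longrightarrow> unzip_tri t ! i = Tri (d2 t ! i) (d1 t ! i) (d0 t ! i) (tcell t ! i)"
  by (simp add: unzip_tri_def)

lemma length_unzip_tri2 [simp]: "length (unzip_tri2 \<tau>) = length (d0 (src_tri \<tau>))"
  by (simp add: unzip_tri2_def)

lemma nth_unzip_tri2:
  "i < length (d0 (src_tri \<tau>)) \<Longrightarrow>
    unzip_tri2 \<tau> ! i = Tri2 (unzip_tri (src_tri \<tau>) ! i) (unzip_tri (trg_tri \<tau>) ! i) (cell_tri \<tau> ! i)"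
  by (simp add: unzip_tri2_def)

lemma Deltas_simps [simp]:
  "Obj Deltas = {n. 1 \<le> n}" "Arr Deltas = {f. osurj (length f) (ocod f) f}"
  "Src Deltas = length" "Trg Deltas = ocod" "Idn Deltas = oid" "Cmp Deltas = ocomp"
  "Cell Deltas = {f. osurj (length f) (ocod f) f}" "Src2 Deltas = id" "Trg2 Deltas = id" "Idn2 Deltas = id"
  "VCmp Deltas g f = f" "HCmp Deltas = ocomp"
  by (simp_all add: Deltas_def)

lemma Deltas_fib_simps [simp]:
  "T0 (Deltas_fib n) g = map (psize g) [0..<n]"
  "T1 (Deltas_fib n) t = map (induced (d0 t) (d2 t)) [0..<n]"
  "T2 (Deltas_fib n) \<tau> = map (induced (d0 (src_tri \<tau>)) (cell_tri \<tau>)) [0..<n]"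
  by (simp_all add: Deltas_fib_def)

lemma twofun_singl [simp]: "T0 singl x = [x]" "T1 singl f = [f]" "T2 singl c = [c]"
  by (simp_all add: singl_def)

context oper
begin

lemma card_two_functor: "two_functor (integ P) Deltas (Card (integ P))"
proof -
  have 1: "osurj (fst (src1 s)) (fst (trg1 s)) (imap s)" "length (imap s) = fst (src1 s)"
    "ocod (imap s) = fst (trg1 s)" if "s \<in> int_arrows P" for s
    using that by (auto elim!: Int1E dest: osurjD(3,6))
  show ?thesis
    unfolding two_functor_def
  proof (intro conjI)
    show "is_functor (integ P) Deltas (T0 (Card (integ P))) (T1 (Card (integ P)))"
      using 1(1)[THEN osurj_ocod] by (intro is_functorI) (auto simp: homset_def 1)
    show "is_functor (vert (integ P)) (vert Deltas) (T1 (Card (integ P))) (T2 (Card (integ P)))"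
      using 1(1)[THEN osurj_ocod] by (intro is_functorI) (auto simp: homset_def Int2_arrows)
    show "is_functor (horiz (integ P)) (horiz Deltas) (T0 (Card (integ P))) (T2 (Card (integ P)))"
      by (rule is_functorI) (use 1(1)[THEN osurj_ocod] in \<open>auto simp: homset_def HCmp_cell 1 Int2_arrows\<close>)
  qed
qed

section \<open>The chosen object \<open>[1,e]\<close> and its terminal 1-cells\<close>

lemma Obj_fibcat_bang:
  assumes "1 \<le> m" "as \<in> Obj (fibcat P (bang m))"
  obtains a where "as = [a]" "a \<in> Obj (Cat P m)"
proof -
  have "length as = 1"
    using assms tup_length[OF osurj_bang] by (auto simp: Obj_fibcat)
  then obtain a where "as = [a]" by (auto simp: length_Suc_conv)
  then show thesis
    using that assms ob.tup_bang by (simp add: Obj_fibcat)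
qed

lemma homset_fibcat_bang:
  assumes "1 \<le> m"
  shows "fs \<in> homset (fibcat P (bang m)) [a] [b] \<longleftrightarrow> (\<exists>f. fs = [f] \<and> f \<in> homset (Cat P m) a b)"
  using osurjD(6)[OF osurj_bang[OF assms]]
  by (auto simp: homset_fibcat psize_bang length_Suc_conv)

lemma mu1_bang:
  "1 \<le> m \<Longrightarrow> f \<in> homset (Cat P m) a b \<Longrightarrow> mu1 P (bang m) (Idn (Cat P (Suc 0)) (unit P)) [f] = f"
  using ar.mu_unit_left by (auto simp: unit_arr_def dest: homsetD(1))

lemma Ter_arrow:
  assumes "1 \<le> m" "a \<in> Obj (Cat P m)"
  shows "Int1 (m, a) (1, unit P) (bang m) [a] (Idn (Cat P m) a) \<in> int_arrows P"
  using assms ob.tup_bang ob.mu_unit_left ob.e_closed osurj_bang Idn_Cat_homset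
  by (simp add: Int1_iff Obj_fibcat)

text \<open>By the left unit law a 1-cell from \<open>[m,a]\<close> to \<open>[1,e]\<close> is a
  morphism \<alpha> from some \<open>a'\<close> to \<open>a\<close>. A 2-cell from it to the 1-cell
  with an identity as last component is a morphism whose composite with that identity is \<alpha>,
  hence \<alpha> itself.\<close>

lemma terminal_Ter:
  assumes x: "x \<in> Obj (integ P)"
  shows "terminal (Hom (integ P) x (1, unit P)) (Ter (integ P) x)"
proof -
  obtain m a where x: "x = (m, a)" "1 \<le> m" "a \<in> Obj (Cat P m)"
    using x by auto
  note C = category_Cat[OF x(2)]
  let ?t = "Int1 (m, a) (1, unit P) (bang m) [a] (Idn (Cat P m) a)"
  have t: "?t \<in> int_arrows P" using x by (intro Ter_arrow)
  have "\<exists>!c. c \<in> int_cells P \<and> src2 c = s \<and> trg2 c = ?t"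
    if s: "s \<in> int_arrows P" "src1 s = (m, a)" "trg1 s = (1, unit P)" for s
  proof -
    obtain f as \<alpha> where s': "s = Int1 (m, a) (1, unit P) f as \<alpha>" and f: "osurj m 1 f"
      and as: "as \<in> Obj (fibcat P f)" and \<alpha>: "\<alpha> \<in> homset (Cat P m) (mu0 P f (unit P) as) a"
      using s by (auto elim: Int1E)
    note f' = osurj_to_1[OF f]
    obtain a' where a': "as = [a']" "a' \<in> Obj (Cat P m)"
      using Obj_fibcat_bang[OF x(2)] as unfolding f' by blast
    have \<alpha>: "\<alpha> \<in> homset (Cat P m) a' a"
      using \<alpha> a' ob.mu_unit_left[OF x(2)] by (simp add: f')
    have *: "Int2 s ?t \<delta> \<in> int_cells P \<longleftrightarrow> \<delta> = [\<alpha>]" for \<delta>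
    proof -
      have "Int2 s ?t \<delta> \<in> int_cells P \<longleftrightarrow> (\<exists>f. \<delta> = [f] \<and> f \<in> homset (Cat P m) a' a \<and>
          Cmp (Cat P m) (Idn (Cat P m) a) (mu1 P (bang m) (Idn (Cat P 1) (unit P)) \<delta>) = \<alpha>)"
        using s(1) t unfolding s' f' a' by (auto simp: Int2_iff homset_fibcat_bang[OF x(2)])
      also have "\<dots> \<longleftrightarrow> \<delta> = [\<alpha>]"
        using \<alpha> by (auto simp: mu1_bang[OF x(2)] Cmp_Idn_left[OF C])
      finally show ?thesis .
    qed
    show ?thesis
    proof (rule ex1I[of _ "Int2 s ?t [\<alpha>]"])
      show "Int2 s ?t [\<alpha>] \<in> int_cells P \<and> src2 (Int2 s ?t [\<alpha>]) = s \<and> trg2 (Int2 s ?t [\<alpha>]) = ?t"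
        using * by simp
      show "c = Int2 s ?t [\<alpha>]" if "c \<in> int_cells P \<and> src2 c = s \<and> trg2 c = ?t" for c
        using that * by (cases c) auto
    qed
  qed
  moreover have "c \<in> homset (Hom (integ P) (m, a) (1, unit P)) s ?t \<longleftrightarrow>
      c \<in> int_cells P \<and> src2 c = s \<and> trg2 c = ?t" if "s \<in> homset (integ P) (m, a) (1, unit P)" for c s
    using that t by (auto simp: homset_def Hom_def)
  ultimately have "\<exists>!c. c \<in> homset (Hom (integ P) (m, a) (1, unit P)) s ?t"
    if "s \<in> homset (integ P) (m, a) (1, unit P)" for s
    using that by (simp add: homset_def[of "integ P"])
  moreover have "?t \<in> homset (integ P) (m, a) (1, unit P)"
    using t by (simp add: homset_def)
  moreover have "Obj (Hom (integ P) (m, a) (1, unit P)) = homset (integ P) (m, a) (1, unit P)"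
    by (simp add: Hom_def)
  ultimately show ?thesis
    by (simp add: terminal_def x(1))
qed

text \<open>Every object has a 1-cell to \<open>[1,e]\<close>, so there is a single component and
  one chosen object is enough.\<close>

lemma conn_unit:
  assumes "x \<in> Obj (integ P)" shows "conn (integ P) x (1, unit P)"
proof -
  have "Ter (integ P) x \<in> homset (integ P) x (1, unit P)"
    using terminal_Ter[OF assms] by (simp add: terminal_def Hom_def)
  then show ?thesis
    using assms ob.e_closed unfolding conn_def
    by (auto simp: homset_def intro!: r_into_equivclp)
qed

lemma Ter_unit: "Ter (integ P) (1, unit P) = Idn (integ P) (1, unit P)"
  by (simp add: bang_def oid_def)

lemma lali_unit: "local_lali_terminal (integ P) (1, unit P)"
proof -
  have u: "(1, unit P) \<in> Obj (integ P)" using ob.e_closed by simp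
  show ?thesis
    unfolding local_lali_terminal_def
  proof (intro conjI allI impI)
    show "\<exists>t. terminal (Hom (integ P) x (1, unit P)) t" if "conn (integ P) x (1, unit P)" for x
      using terminal_Ter[of x] that unfolding conn_def by blast
    show "terminal (Hom (integ P) (1, unit P) (1, unit P)) (Idn (integ P) (1, unit P))"
      unfolding Ter_unit[symmetric] using u by (rule terminal_Ter)
  qed (rule u)
qed

lemma card_fib:
  assumes "x \<in> Obj (integ P)"
  shows "teq (lslice (integ P) x) (tcomp (pow_fun (Card (integ P))) (Fib (integ P) x))
    (tcomp (Deltas_fib (ncard (integ P) x)) (slice_fun (Card (integ P))))"
  unfolding teq_def
  by (auto simp: Cell_lslice lax_triangles_iff tri.map_sel tri2.map_sel int_fib_tri_def)

text \<open>Between the terminal 1-cells the tuple \<delta> has one entry and the last components of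
  both outer sides are identities. The triangle condition then equates this entry with the last
  component of \<open>d2 t\<close>, so the only fiber is \<open>d2 t\<close>.\<close>

lemma fib_Ter_triangle:
  assumes t: "t \<in> lax_triangles (integ P) (1, unit P)"
    and y: "y \<in> Obj (integ P)" "d0 t = Ter (integ P) y" and z: "d1 t = Ter (integ P) z"
  shows "int_fib_tri t = [d2 t]"
proof -
  obtain k b where y': "y = (k, b)" "1 \<le> k" "b \<in> Obj (Cat P k)" using y by auto
  obtain m a f as \<alpha> cs \<gamma> \<delta> where
    t': "t = lax_tri (Int1 (m, a) (k, b) f as \<alpha>)
        (Int1 (m, a) (1, unit P) (ocomp (bang k) f) cs \<gamma>) (Int1 (k, b) (1, unit P) (bang k) [b] (Idn (Cat P k) b)) \<delta>"
    and f: "osurj m k f" and F: "Int1 (m, a) (k, b) f as \<alpha> \<in> int_arrows P"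
    and \<delta>: "\<delta> \<in> homset (fibcat P (ocomp (bang k) f)) (mul (mu0 P) (bang k) f [b] as) cs"
    and e: "Cmp (Cat P m) \<gamma> (mu1 P (ocomp (bang k) f) (Idn (Cat P 1) (unit P)) \<delta>) =
      Cmp (Cat P m) \<alpha> (mu1 P f (Idn (Cat P k) b) (Idn (fibcat P f) as))"
    using t y(2)[unfolded y' integ_simps] by (rule lax_triangleE)
  have z': "cs = [a]" "\<gamma> = Idn (Cat P m) a"
    using z by (cases z; simp add: t')+
  note m = osurjD(1)[OF f] and bf = ocomp_bang[OF f]
  note C = category_Cat[OF m]
  have as: "as \<in> Obj (fibcat P f)" and \<alpha>: "\<alpha> \<in> homset (Cat P m) (mu0 P f b as) a"
    using F by (auto simp: Int1_iff)
  have l: "length as = k" using tup_length[OF f] as by (auto simp: Obj_fibcat)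
  have "mul (mu0 P) (bang k) f [b] as = [mu0 P f b as]"
    using ob.mul_bang[OF f] as by (simp add: Obj_fibcat)
  then obtain d where d: "\<delta> = [d]" "d \<in> homset (Cat P m) (mu0 P f b as) a"
    using \<delta> homset_fibcat_bang[OF m] by (auto simp: bf z')
  have "d = \<alpha>"
    using e d \<alpha> mu_Idn[OF f y'(3) as]
    by (simp add: bf z' mu1_bang[OF m d(2)] Cmp_Idn_left[OF C d(2)] Cmp_Idn_right[OF C \<alpha>])
  then show ?thesis
    by (simp add: t' fib_tri d z' bf psize_bang induced_bang[OF f] block_bang l)
qed

lemma unit_axiom_integ: "unit_axiom (integ P)"
  unfolding unit_axiom_def
proof (rule ballI, rule conjI)
  fix v assume "v \<in> chosen_objects (integ P)"
  then have v: "v = (1, unit P)" by (auto simp: chosen_objects_def)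
  show "ncard (integ P) v = 1" by (simp add: v)
  let ?S = "Ter (integ P) ` {y \<in> Obj (integ P). Lali (integ P) y = v}"
  show "teq (full_sub (lslice (integ P) v) ?S) (Fib (integ P) v) (tcomp singl (dom_fun (integ P)))"
    unfolding teq_def
  proof (intro conjI ballI)
    fix \<phi> assume "\<phi> \<in> Obj (full_sub (lslice (integ P) v) ?S)"
    then have "\<phi> \<in> ?S" by (simp add: full_sub_def)
    then obtain m a where "\<phi> = Ter (integ P) (m, a)" by auto
    then show "T0 (Fib (integ P) v) \<phi> = T0 (tcomp singl (dom_fun (integ P))) \<phi>"
      by (simp add: psize_bang)
  next
    fix t assume "t \<in> Arr (full_sub (lslice (integ P) v) ?S)"
    then have "t \<in> lax_triangles (integ P) (1, unit P)" "d0 t \<in> ?S" "d1 t \<in> ?S"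
      by (simp_all add: full_sub_def v)
    then have "int_fib_tri t = [d2 t]"
      using fib_Ter_triangle by blast
    then show "T1 (Fib (integ P) v) t = T1 (tcomp singl (dom_fun (integ P))) t"
      by simp
  next
    fix \<tau> assume "\<tau> \<in> Cell (full_sub (lslice (integ P) v) ?S)"
    then have \<tau>: "\<tau> \<in> Cell (lslice (integ P) (1, unit P))" and S: "d0 (src_tri \<tau>) \<in> ?S" "d1 (src_tri \<tau>) \<in> ?S"
      by (simp_all add: full_sub_def v)
    note T = \<tau>[unfolded Cell_lslice]
    from S obtain y z where y: "y \<in> Obj (integ P)" "d0 (src_tri \<tau>) = Ter (integ P) y"
      and z: "d1 (src_tri \<tau>) = Ter (integ P) z" by blast
    \<comment> \<open>The source and target triangles of \<tau> have the same outer sides, so the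
      fibers of both are known.\<close>
    have "d0 (trg_tri \<tau>) = Ter (integ P) y" "d1 (trg_tri \<tau>) = Ter (integ P) z"
      using T y z by metis+
    then have F: "int_fib_tri (src_tri \<tau>) = [d2 (src_tri \<tau>)]" "int_fib_tri (trg_tri \<tau>) = [d2 (trg_tri \<tau>)]"
      using T y z fib_Ter_triangle by blast+
    obtain k b where y': "y = (k, b)" "1 \<le> k" using y by auto
    obtain m a f as \<alpha> as' \<alpha>' \<xi> where f: "osurj m k f" and \<xi>: "\<xi> \<in> homset (fibcat P f) as as'"
      and c: "cell_tri \<tau> = Int2 (Int1 (m, a) (k, b) f as \<alpha>) (Int1 (m, a) (k, b) f as' \<alpha>') \<xi>"
      using \<tau> y(2)[unfolded y' integ_simps] by (rule slice_cellE)
    have st: "src2 (cell_tri \<tau>) = d2 (src_tri \<tau>)" "trg2 (cell_tri \<tau>) = d2 (trg_tri \<tau>)"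
      using T by simp_all
    have "block (bang k) 0 \<xi> = \<xi>"
      using homset_fibcat_length[OF f \<xi>] by (simp add: block_bang)
    then show "T2 (Fib (integ P) v) \<tau> = T2 (tcomp singl (dom_fun (integ P))) \<tau>"
      using st y(2) by (simp add: F y' c)
  qed
qed

section \<open>Triangles into identities, and the fiber axiom\<close>

lemma fib_epsilon:
  assumes \<phi>: "\<phi> \<in> int_arrows P"
  shows "int_fib_tri (Tri \<phi> \<phi> (Idn (integ P) (trg1 \<phi>)) (Idn2 (integ P) \<phi>)) =
    map (Ter (integ P)) (T0 (Fib (integ P) (trg1 \<phi>)) \<phi>)"
proof -
  obtain m a n b f as \<alpha> where \<phi>': "\<phi> = Int1 (m, a) (n, b) f as \<alpha>" and f: "osurj m n f"
    and as: "as \<in> Obj (fibcat P f)"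
    using \<phi> by (rule Int1E)
  have l: "length as = n" using tup_length[OF f] as by (auto simp: Obj_fibcat)
  show ?thesis
    using l osurjD(6)[OF f]
    by (simp add: \<phi>' fib_tri psize_oid induced_oid_left[OF f] block_oid nth_Idn_fibcat)
qed

text \<open>The fiber axiom on 1-cells, one block at a time. \<open>T\<close> is a triangle of
  triangles over a fixed 1-cell; once its sides and its 2-cell are in normal form, the claim is
  \<open>induced_induced\<close> for the surjections and \<open>block_block\<close> for the
  tuples.\<close>

lemma tri_tri:
  assumes T: "T \<in> lax_triangles (lslice (integ P) (n, c)) (Int1 (k, b) (n, c) g bs \<beta>)"
    and i: "i < n"
  shows "length (int_fib_tri (unzip_tri (map_tri int_fib_tri (T2 (Fib (integ P) (n, c))) T) ! i)) = psize g i"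
    "j < psize g i \<Longrightarrow> int_fib_tri (unzip_tri (map_tri int_fib_tri (T2 (Fib (integ P) (n, c))) T) ! i) ! j =
     int_fib_tri (map_tri d2 cell_tri T) ! (off g i + j)"
proof -
  let ?\<phi> = "Int1 (k, b) (n, c) g bs \<beta>"
  note TD = T[unfolded lax_triangles_iff[of _ "lslice (integ P) (n, c)"] lslice_simps]
  have d0T: "d0 T \<in> lax_triangles (integ P) (n, c)" "d0 (d0 T) = ?\<phi>" using TD by auto
  obtain m a f as \<alpha> cs \<gamma> \<delta> where d0: "d0 T = lax_tri
      (Int1 (m, a) (k, b) f as \<alpha>) (Int1 (m, a) (n, c) (ocomp g f) cs \<gamma>) ?\<phi> \<delta>"
    and f: "osurj m k f" and g: "osurj k n g" and F: "Int1 (m, a) (k, b) f as \<alpha> \<in> int_arrows P"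
    using d0T by (rule lax_triangleE)
  have d2T: "d2 T \<in> lax_triangles (integ P) (n, c)" "d0 (d2 T) = Int1 (m, a) (n, c) (ocomp g f) cs \<gamma>"
    using TD d0 by auto
  obtain l d h ds \<sigma> es \<epsilon> \<zeta> where d2: "d2 T = lax_tri
      (Int1 (l, d) (m, a) h ds \<sigma>) (Int1 (l, d) (n, c) (ocomp (ocomp g f) h) es \<epsilon>) (Int1 (m, a) (n, c) (ocomp g f) cs \<gamma>) \<zeta>"
    and h: "osurj l m h" and H: "Int1 (l, d) (m, a) h ds \<sigma> \<in> int_arrows P"
    using d2T by (rule lax_triangleE)
  have tc: "tcell T \<in> Cell (lslice (integ P) (n, c))" "src_tri (tcell T) = tri_comp (integ P) (d0 T) (d2 T)"
    "trg_tri (tcell T) = d1 T"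
    using TD by auto
  then have "d0 (src_tri (tcell T)) = ?\<phi>" by (simp add: tri_comp_def d0)
  with tc(1) obtain l' d' q qs \<rho> gs \<kappa> \<delta>1 qs' \<rho>' \<delta>2 \<xi> where
    s: "src_tri (tcell T) = lax_tri (Int1 (l', d') (k, b) q qs \<rho>)
        (Int1 (l', d') (n, c) (ocomp g q) gs \<kappa>) ?\<phi> \<delta>1"
    and t: "trg_tri (tcell T) = lax_tri (Int1 (l', d') (k, b) q qs' \<rho>')
        (Int1 (l', d') (n, c) (ocomp g q) gs \<kappa>) ?\<phi> \<delta>2"
    and cell: "cell_tri (tcell T) = Int2 (Int1 (l', d') (k, b) q qs \<rho>) (Int1 (l', d') (k, b) q qs' \<rho>') \<xi>"
    and qs': "qs' \<in> Obj (fibcat P q)" and \<xi>: "\<xi> \<in> homset (fibcat P q) qs qs'"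
    by (rule slice_cellE)
  \<comment> \<open>The source of \<open>tcell T\<close> is the composite of the triangles
    \<open>d0 T\<close> and \<open>d2 T\<close>, so its surjection is the composite of
    theirs.\<close>
  have q: "q = ocomp f h"
    using tc(2) by (simp add: s tri_comp_def d0 d2 int_comp_Int1[OF f])
  have l': "l' = l"
    using tc(2) by (simp add: s tri_comp_def d0 d2 int_comp_Int1[OF f])
  note fh = osurj_ocomp[OF h f] and gf = osurj_ocomp[OF f g]
  have lens: "length \<xi> = k" "length qs' = k" "length as = k" "length ds = m"
    using F H tup_length[OF f] tup_length[OF h] homset_fibcat_length[OF fh \<xi>[unfolded q]]
    by (auto simp: Int1_iff Obj_fibcat)
  have T_eq: "T = Tri (d2 T) (d1 T) (d0 T) (tcell T)" by simp
  note d1 = t[unfolded tc(3)]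
  have L: "unzip_tri (map_tri int_fib_tri (T2 (Fib (integ P) (n, c))) T) ! i =
      Tri (int_fib_tri (d2 T) ! i) (int_fib_tri (d1 T) ! i) (int_fib_tri (d0 T) ! i)
        (T2 (Fib (integ P) (n, c)) (tcell T) ! i)"
    using i by (simp add: nth_unzip_tri tri.map_sel d0 fib_tri)
  have R: "map_tri d2 cell_tri T = Tri (d2 (d2 T)) (d2 (d1 T)) (d2 (d0 T)) (cell_tri (tcell T))"
    by (simp add: T_eq[symmetric] tri.expand tri.map_sel)
  show "length (int_fib_tri (unzip_tri (map_tri int_fib_tri (T2 (Fib (integ P) (n, c))) T) ! i)) = psize g i"
    unfolding L using i by (simp add: length_fib_tri d0 fib_tri)
  show "int_fib_tri (unzip_tri (map_tri int_fib_tri (T2 (Fib (integ P) (n, c))) T) ! i) ! j =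
     int_fib_tri (map_tri d2 cell_tri T) ! (off g i + j)" if j: "j < psize g i"
    unfolding L R using i j off_add_less(1)[OF g i j] lens osurjD(3,4)[OF g]
    by (simp add: d0 d1 d2 s t cell fib_tri q[symmetric] nth_block
        psize_induced[OF f g i j] psize_induced[OF fh g i j, folded q]
        induced_induced[OF h f g i j] block_block[OF f g i j])
qed

lemma fiber_axiom_integ: "fiber_axiom (integ P)"
  unfolding fiber_axiom_def teq_def
proof (intro ballI conjI)
  fix \<phi> assume \<phi>: "\<phi> \<in> Arr (integ P)"
  then obtain k b n c g bs \<beta> where \<phi>': "\<phi> = Int1 (k, b) (n, c) g bs \<beta>" and g: "osurj k n g"
    by (auto elim: Int1E)
  let ?F = "T2 (Fib (integ P) (n, c))"
  {
    fix t assume "t \<in> Obj (lslice (lslice (integ P) (Trg (integ P) \<phi>)) \<phi>)"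
    then have t: "t \<in> lax_triangles (integ P) (n, c)" "d0 t = Int1 (k, b) (n, c) g bs \<beta>"
      by (auto simp: \<phi>')
    then obtain m a f as \<alpha> cs \<gamma> \<delta> where t': "t = lax_tri
        (Int1 (m, a) (k, b) f as \<alpha>) (Int1 (m, a) (n, c) (ocomp g f) cs \<gamma>) (Int1 (k, b) (n, c) g bs \<beta>) \<delta>"
      and f: "osurj m k f" and F: "Int1 (m, a) (k, b) f as \<alpha> \<in> int_arrows P"
      by (rule lax_triangleE)
    have l: "length as = k"
      using F tup_length[OF f] by (auto simp: Int1_iff Obj_fibcat)
    \<comment> \<open>On objects of the iterated slice the fibers of the fibers of \<open>t\<close>
      carry the entries of \<open>as\<close>, regrouped by blocks.\<close>
    show "T0 (tcomp (Fib_concat (integ P) (T0 (Fib (integ P) (Trg (integ P) \<phi>)) \<phi>))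
             (tcomp unzip_fun (slice_fun (Fib (integ P) (Trg (integ P) \<phi>))))) t =
          T0 (tcomp (Fib (integ P) (Src (integ P) \<phi>)) (slice_fun (dom_fun (integ P)))) t"
      unfolding tcomp_simps Fib_concat_simps
      using l osurjD(3,4)[OF g] off_add_less(1)[OF g]
      by (intro concat_eqI[OF g]) (auto simp: t' \<phi>' fib_tri psize_induced[OF f g] nth_block)
  }
  note TT = tri_tri[where n = n and c = c and k = k and b = b and g = g and bs = bs and \<beta> = \<beta>]
  have fst_d0: "fst (trg1 (d2 (d0 T))) = k" "length (int_fib_tri (d0 T)) = n"
    if "T \<in> lax_triangles (lslice (integ P) (n, c)) (Int1 (k, b) (n, c) g bs \<beta>)" for T
    using that by (auto simp: lax_triangles_iff length_fib_tri)
  {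
    fix T assume "T \<in> Arr (lslice (lslice (integ P) (Trg (integ P) \<phi>)) \<phi>)"
    then have T: "T \<in> lax_triangles (lslice (integ P) (n, c)) (Int1 (k, b) (n, c) g bs \<beta>)"
      by (simp add: \<phi>')
    show "T1 (tcomp (Fib_concat (integ P) (T0 (Fib (integ P) (Trg (integ P) \<phi>)) \<phi>))
             (tcomp unzip_fun (slice_fun (Fib (integ P) (Trg (integ P) \<phi>))))) T =
          T1 (tcomp (Fib (integ P) (Src (integ P) \<phi>)) (slice_fun (dom_fun (integ P)))) T"
      unfolding tcomp_simps Fib_concat_simps
      using TT[OF T] fst_d0[OF T]
      by (intro concat_eqI[OF g])
        (auto simp: \<phi>' length_fib_tri tri.map_sel simp del: Fib_integ(2))
  }
  fix \<tau> assume \<tau>: "\<tau> \<in> Cell (lslice (lslice (integ P) (Trg (integ P) \<phi>)) \<phi>)"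
  note \<tau> = \<tau>[unfolded Cell_lslice[of _ "lslice (integ P) (Trg (integ P) \<phi>)"], unfolded \<phi>', simplified]
  let ?S = "src_tri \<tau>" and ?T = "trg_tri \<tau>"
  have S: "?S \<in> lax_triangles (lslice (integ P) (n, c)) (Int1 (k, b) (n, c) g bs \<beta>)"
    and T: "?T \<in> lax_triangles (lslice (integ P) (n, c)) (Int1 (k, b) (n, c) g bs \<beta>)"
    and c: "cell_tri \<tau> \<in> Cell (lslice (integ P) (n, c))"
    and src_c: "src_tri (cell_tri \<tau>) = d2 ?S"
    using \<tau> by auto
  note SD = S[unfolded lax_triangles_iff[of _ "lslice (integ P) (n, c)"] lslice_simps]
  have d0S: "d0 ?S \<in> lax_triangles (integ P) (n, c)" "d0 (d0 ?S) = Int1 (k, b) (n, c) g bs \<beta>" using SD by auto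
  obtain m a f as \<alpha> cs \<gamma> \<delta> where d0: "d0 ?S = lax_tri
      (Int1 (m, a) (k, b) f as \<alpha>) (Int1 (m, a) (n, c) (ocomp g f) cs \<gamma>) (Int1 (k, b) (n, c) g bs \<beta>) \<delta>"
    and f: "osurj m k f"
    using d0S by (rule lax_triangleE)
  have d0c: "d0 (src_tri (cell_tri \<tau>)) = Int1 (m, a) (n, c) (ocomp g f) cs \<gamma>"
    using SD d0 by (auto simp: src_c)
  obtain l d h ds \<sigma> ds' \<sigma>' \<xi> where h: "osurj l m h" and \<xi>: "\<xi> \<in> homset (fibcat P h) ds ds'"
    and cell: "cell_tri (cell_tri \<tau>) = Int2 (Int1 (l, d) (m, a) h ds \<sigma>) (Int1 (l, d) (m, a) h ds' \<sigma>') \<xi>"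
    using c d0c by (rule slice_cellE)
  note l\<xi> = homset_fibcat_length(1)[OF h \<xi>]
  have R: "unzip_tri2 (map_tri2 int_fib_tri ?F \<tau>) ! i =
      Tri2 (unzip_tri (map_tri int_fib_tri ?F ?S) ! i) (unzip_tri (map_tri int_fib_tri ?F ?T) ! i)
        (?F (cell_tri \<tau>) ! i)" if "i < n" for i
    using that d0 by (simp add: nth_unzip_tri2 tri2.map_sel tri.map_sel length_fib_tri)
  have U: "d0 (unzip_tri (map_tri int_fib_tri ?F ?S) ! i) = int_fib_tri (d0 ?S) ! i" if "i < n" for i
    using that d0 by (simp add: nth_unzip_tri tri.map_sel length_fib_tri)
  show "T2 (tcomp (Fib_concat (integ P) (T0 (Fib (integ P) (Trg (integ P) \<phi>)) \<phi>))
             (tcomp unzip_fun (slice_fun (Fib (integ P) (Trg (integ P) \<phi>))))) \<tau> =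
          T2 (tcomp (Fib (integ P) (Src (integ P) \<phi>)) (slice_fun (dom_fun (integ P)))) \<tau>"
    unfolding tcomp_simps Fib_concat_simps
  proof (rule concat_eqI[OF g])
    let ?zs = "map2 (\<lambda>p. T2 (Fib (integ P) p)) (T0 (Fib (integ P) (Trg (integ P) \<phi>)) \<phi>)
      (T2 unzip_fun (T2 (slice_fun (Fib (integ P) (Trg (integ P) \<phi>))) \<tau>))"
    show "length ?zs = n"
      by (simp add: \<phi>' tri2.map_sel tri.map_sel length_fib_tri d0)
    show "length (T2 (Fib (integ P) (Src (integ P) \<phi>)) (T2 (slice_fun (dom_fun (integ P))) \<tau>)) = k"
      by (simp add: tri2.map_sel tri.map_sel d0)
    have z: "?zs ! i = T2 (Fib (integ P) (psize g i, bs ! i)) (unzip_tri2 (map_tri2 int_fib_tri ?F \<tau>) ! i)" if "i < n" for i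
      using that d0 by (simp add: \<phi>' tri2.map_sel tri.map_sel length_fib_tri del: Fib_integ(2))
    fix i assume i: "i < n"
    show "length (?zs ! i) = psize g i"
      unfolding z[OF i] R[OF i] using i by (simp add: U d0 fib_tri)
    fix j assume j: "j < psize g i"
    have e: "?F (cell_tri \<tau>) ! i = Int2 (int_fib_tri (src_tri (cell_tri \<tau>)) ! i)
       (int_fib_tri (trg_tri (cell_tri \<tau>)) ! i) (block (ocomp g f) i \<xi>)"
      using i by (simp add: d0c cell)
    \<comment> \<open>The source and target of this 2-cell agree by \<open>tri_tri\<close>, applied
      to both triangles of \<tau>; what remains is \<open>block_block\<close> for the tuple
      \<xi>.\<close>
    show "?zs ! i ! j = T2 (Fib (integ P) (Src (integ P) \<phi>)) (T2 (slice_fun (dom_fun (integ P))) \<tau>) ! (off g i + j)"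
      unfolding z[OF i] R[OF i] e
      using i j TT(2)[OF S i] TT(2)[OF T i] off_add_less(1)[OF g i j]
      by (simp add: U d0 fib_tri tri2.map_sel tri.map_sel cell block_block[OF f g i j l\<xi>])
  qed
qed

lemma operadic_2category_integ: "operadic_2category (integ P)"
  unfolding operadic_2category_def
proof (intro conjI ballI allI impI)
  show "set (T0 (Fib (integ P) x) (Idn (integ P) x)) \<subseteq> chosen_objects (integ P)"
    if "x \<in> Obj (integ P)" for x
    using that by (auto simp: chosen_objects_def psize_oid intro!: image_eqI)
  show "Ter (integ P) v = Idn (integ P) v" if "v \<in> chosen_objects (integ P)" for v
    using that Ter_unit by (auto simp: chosen_objects_def)
  show "T1 (Fib (integ P) (Trg (integ P) \<phi>)) (Tri \<phi> \<phi> (Idn (integ P) (Trg (integ P) \<phi>)) (Idn2 (integ P) \<phi>)) =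
      map (Ter (integ P)) (T0 (Fib (integ P) (Trg (integ P) \<phi>)) \<phi>)" if "\<phi> \<in> Arr (integ P)" for \<phi>
    using fib_epsilon that by (simp del: Fib_integ integ_simps(10))
qed (use two_category_integ card_two_functor fib_two_functor lali_unit conn_unit terminal_Ter card_fib
    unit_axiom_integ fiber_axiom_integ in simp_all)

end

section \<open>Operadic cartesian lifts\<close>

lemma block_index:
  assumes g: "osurj k n g" and j: "j < k"
  obtains i j' where "i < n" "j' < psize g i" "j = off g i + j'" "g ! j = i"
proof
  note D = osurjD[OF g]
  show "g ! j < n" using g j by (rule osurj_nth)
  have "off g (g ! j) \<le> j" "j < off g (Suc (g ! j))"
    using less_off_iff[OF D(4), of j "g ! j"] less_off_iff[OF D(4), of j "Suc (g ! j)"] j D(3) by auto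
  then show "j - off g (g ! j) < psize g (g ! j)" "j = off g (g ! j) + (j - off g (g ! j))"
    by (simp_all add: psize_off[OF D(4)])
qed simp

lemma block_ext:
  assumes g: "osurj k n g" and "length xs = k" "length ys = k"
    and "\<And>i. i < n \<Longrightarrow> block g i xs = block g i ys"
  shows "xs = ys"
proof (rule nth_equalityI)
  fix j assume "j < length xs"
  then obtain i j' where "i < n" "j' < psize g i" "j = off g i + j'"
    using block_index[OF g] assms(2) by metis
  then show "xs ! j = ys ! j"
    using assms(2-4) osurjD(3,4)[OF g] nth_block[of g xs j' i] nth_block[of g ys j' i] by simp
qed (use assms in simp)

text \<open>Inverse to cutting: position \<open>j\<close> belongs to block \<open>g ! j\<close> at
  place \<open>j - off g (g ! j)\<close>. It assembles the objects of a 1-cell from those of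
  prescribed fibers.\<close>

definition unblock :: "nat list \<Rightarrow> (nat \<Rightarrow> 'x list) \<Rightarrow> 'x list" where
  "unblock g xss = map (\<lambda>j. xss (g ! j) ! (j - off g (g ! j))) [0..<length g]"

lemma block_unblock:
  assumes g: "osurj k n g" and i: "i < n" and l: "length (xss i) = psize g i"
  shows "block g i (unblock g xss) = xss i"
  using l osurjD(3,4)[OF g] off_add_less[OF g i]
  by (intro nth_equalityI) (auto simp: length_block nth_block unblock_def)

lemma length_unblock [simp]: "length (unblock g xss) = length g"
  by (simp add: unblock_def)

text \<open>Converse of \<open>tup_block\<close>: by \<open>block_index\<close> every position lies
  in some block.\<close>

lemma tup_blockI:
  assumes f: "osurj m k f" and g: "osurj k n g" and l: "length xs = k"
    and b: "\<And>i. i < n \<Longrightarrow> tup X (induced g f i) (block g i xs)"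
  shows "tup X f xs"
  unfolding tup_def osurjD(6)[OF f]
proof (intro conjI allI impI l)
  fix j assume "j < k"
  then obtain i j' where i: "i < n" "j' < psize g i" "j = off g i + j'"
    by (rule block_index[OF g])
  then show "xs ! j \<in> X (psize f j)"
    using b[OF i(1)] l osurjD(3,4)[OF g] osurjD(6)[OF osurj_induced[OF f g i(1)]]
    by (auto simp: tup_def nth_block psize_induced[OF f g i(1)])
qed

context oper
begin

lemma cartesian_lift:
  assumes g: "osurj k n g" and c: "c \<in> Obj (Cat P n)" and bs: "bs \<in> Obj (fibcat P g)"
  shows "operadic_cartesian (integ P)
    (Int1 (k, mu0 P g c bs) (n, c) g bs (Idn (Cat P k) (mu0 P g c bs)))"
proof -
  let ?b = "mu0 P g c bs"
  let ?\<phi> = "Int1 (k, ?b) (n, c) g bs (Idn (Cat P k) ?b)"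
  have b: "?b \<in> Obj (Cat P k)"
    using ob.mu_closed[OF g c] bs by (simp add: Obj_fibcat)
  have \<phi>: "?\<phi> \<in> int_arrows P"
    using b c g bs Idn_Cat_homset[OF osurjD(1)[OF g] b] by (simp add: Int1_iff)
  have "\<exists>!t. t \<in> lax_triangles (integ P) (n, c) \<and> d0 t = ?\<phi> \<and> d1 t = \<theta> \<and>
      int_fib_tri t = \<psi>s \<and> imap (d2 t) = f"
    if \<theta>: "\<theta> \<in> int_arrows P" "trg1 \<theta> = (n, c)" and l\<psi>: "length \<psi>s = n"
      and \<psi>s: "\<And>i. i < n \<Longrightarrow> \<psi>s ! i \<in> homset (integ P) (psize (imap \<theta>) i, iobs \<theta> ! i) (psize g i, bs ! i)"
      and f: "osurj (fst (src1 \<theta>)) k f" and gf: "ocomp g f = imap \<theta>"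
      and ind: "\<And>i. i < n \<Longrightarrow> induced g f i = imap (\<psi>s ! i)"
    for \<theta> \<psi>s f
  proof -
    obtain m a cs \<gamma> where \<theta>': "\<theta> = Int1 (m, a) (n, c) (ocomp g f) cs \<gamma>" and a: "a \<in> Obj (Cat P m)"
      and cs: "cs \<in> Obj (fibcat P (ocomp g f))"
      and \<gamma>: "\<gamma> \<in> homset (Cat P m) (mu0 P (ocomp g f) c cs) a"
      using \<theta> gf by (auto elim: Int1E)
    have f: "osurj m k f" using f by (simp add: \<theta>')
    note gof = osurj_ocomp[OF f g]
    have lbs: "length bs = n" and lcs: "length cs = n"
      using tup_length[OF g] tup_length[OF gof] bs cs by (auto simp: Obj_fibcat)
    \<comment> \<open>The tuple of the missing 1-cell is glued from the tuples of the prescribed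
      fibers, and \<delta> collects their last components.\<close>
    define as where "as = unblock g (\<lambda>i. iobs (\<psi>s ! i))"
    define \<delta> where "\<delta> = map iarr \<psi>s"
    have las: "length as = k" using osurjD(3)[OF g] by (simp add: as_def)
    have \<psi>': "\<psi>s ! i = Int1 (psize (ocomp g f) i, cs ! i) (psize g i, bs ! i) (induced g f i)
          (block g i as) (\<delta> ! i)" "tup (\<lambda>n. Obj (Cat P n)) (induced g f i) (block g i as)"
        "\<delta> ! i \<in> homset (Cat P (psize (ocomp g f) i)) (mu0 P (induced g f i) (bs ! i) (block g i as)) (cs ! i)"
      if i: "i < n" for i
    proof -
      obtain as' \<alpha> where e: "\<psi>s ! i = Int1 (psize (ocomp g f) i, cs ! i) (psize g i, bs ! i) (induced g f i) as' \<alpha>"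
        and as': "as' \<in> Obj (fibcat P (induced g f i))"
        and \<alpha>: "\<alpha> \<in> homset (Cat P (psize (ocomp g f) i)) (mu0 P (induced g f i) (bs ! i) as') (cs ! i)"
        using homset_integE[OF \<psi>s[OF i]] ind[OF i] \<theta>' by (metis int1.sel)
      have "length as' = psize g i"
        using tup_length[OF osurj_induced[OF f g i]] as' by (auto simp: Obj_fibcat)
      then have "block g i as = as'"
        unfolding as_def using e by (subst block_unblock[OF g i]) auto
      moreover have "\<delta> ! i = \<alpha>" using i l\<psi> e by (simp add: \<delta>_def)
      ultimately show "\<psi>s ! i = Int1 (psize (ocomp g f) i, cs ! i) (psize g i, bs ! i) (induced g f i)
          (block g i as) (\<delta> ! i)" "tup (\<lambda>n. Obj (Cat P n)) (induced g f i) (block g i as)"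
        "\<delta> ! i \<in> homset (Cat P (psize (ocomp g f) i)) (mu0 P (induced g f i) (bs ! i) (block g i as)) (cs ! i)"
        using e as' \<alpha> by (simp_all add: Obj_fibcat)
    qed
    have as: "as \<in> Obj (fibcat P f)"
      using tup_blockI[OF f g las \<psi>'(2)] by (simp add: Obj_fibcat)
    have \<delta>: "\<delta> \<in> homset (fibcat P (ocomp g f)) (mul (mu0 P) g f bs as) cs"
      using \<psi>'(3) l\<psi> lcs osurjD(6)[OF gof] osurjD(6)[OF g] by (simp add: homset_fibcat nth_mul \<delta>_def)
    \<comment> \<open>Forced by the triangle condition: the last component of the lift is an
      identity, so by \<open>unit\<close> the other side of the condition reduces to
      \<alpha>.\<close>
    define \<alpha> where "\<alpha> = Cmp (Cat P m) \<gamma> (mu1 P (ocomp g f) (Idn (Cat P n) c) \<delta>)"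
    note C = category_Cat[OF osurjD(1)[OF f]]
    have assoc: "mu0 P (ocomp g f) c (mul (mu0 P) g f bs as) = mu0 P f ?b as"
      using ob.mu_assoc[OF f g c] bs as by (simp add: Obj_fibcat)
    have \<alpha>: "\<alpha> \<in> homset (Cat P m) (mu0 P f ?b as) a"
      using Cmp_homset[OF C mu_homset[OF gof Idn_Cat_homset[OF osurjD(2)[OF g] c] \<delta>] \<gamma>]
      by (simp add: \<alpha>_def assoc)
    have unit: "Cmp (Cat P m) \<alpha>' (mu1 P f (Idn (Cat P k) ?b) (Idn (fibcat P f) as)) = \<alpha>'"
      if "\<alpha>' \<in> homset (Cat P m) (mu0 P f ?b as) a" for \<alpha>'
      using mu_Idn[OF f b as] Cmp_Idn_right[OF C that] by simp
    let ?t = "lax_tri (Int1 (m, a) (k, ?b) f as \<alpha>)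
        (Int1 (m, a) (n, c) (ocomp g f) cs \<gamma>) ?\<phi> \<delta>"
    show ?thesis
    proof (rule ex1I[of _ ?t])
      have "?t \<in> lax_triangles (integ P) (n, c)"
        unfolding lax_triangle_iff[OF g f] using \<theta> \<phi> \<alpha> \<delta> a b f as unit[OF \<alpha>]
        by (simp add: \<theta>' Int1_iff \<alpha>_def)
      moreover have "int_fib_tri ?t = \<psi>s"
        using \<psi>'(1) l\<psi> by (intro nth_equalityI) (auto simp: fib_tri)
      ultimately show "?t \<in> lax_triangles (integ P) (n, c) \<and> d0 ?t = ?\<phi> \<and> d1 ?t = \<theta> \<and>
          int_fib_tri ?t = \<psi>s \<and> imap (d2 ?t) = f"
        by (simp add: \<theta>')
    next
      fix t assume t: "t \<in> lax_triangles (integ P) (n, c) \<and> d0 t = ?\<phi> \<and> d1 t = \<theta> \<and>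
          int_fib_tri t = \<psi>s \<and> imap (d2 t) = f"
      then have "t \<in> lax_triangles (integ P) (n, c)" "d0 t = ?\<phi>" by auto
      then obtain m' a' f' as' \<alpha>' cs' \<gamma>' \<delta>' where t': "t = lax_tri
          (Int1 (m', a') (k, ?b) f' as' \<alpha>') (Int1 (m', a') (n, c) (ocomp g f') cs' \<gamma>') ?\<phi> \<delta>'"
        and F': "Int1 (m', a') (k, ?b) f' as' \<alpha>' \<in> int_arrows P"
        and \<delta>': "\<delta>' \<in> homset (fibcat P (ocomp g f')) (mul (mu0 P) g f' bs as') cs'"
        and e: "Cmp (Cat P m') \<gamma>' (mu1 P (ocomp g f') (Idn (Cat P n) c) \<delta>') =
          Cmp (Cat P m') \<alpha>' (mu1 P f' (Idn (Cat P k) ?b) (Idn (fibcat P f') as'))"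
        by (rule lax_triangleE)
      have eq: "m' = m" "a' = a" "f' = f" "cs' = cs" "\<gamma>' = \<gamma>"
        using t by (auto simp: t' \<theta>')
      note F' = F'[unfolded eq] and \<delta>' = \<delta>'[unfolded eq] and e = e[unfolded eq] and t' = t'[unfolded eq]
      have las': "length as' = k"
        using F' tup_length[OF f] by (auto simp: Int1_iff Obj_fibcat)
      have fib: "Int1 (psize (ocomp g f) i, cs ! i) (psize g i, bs ! i) (induced g f i) (block g i as') (\<delta>' ! i)
          = \<psi>s ! i" if "i < n" for i
        using t that by (auto simp: t' fib_tri)
      \<comment> \<open>Uniqueness: the fibers fix all blocks of the tuple and all entries of the
        2-cell, and then the condition fixes the last component.\<close>
      have as': "as' = as"
        using fib \<psi>'(1) by (intro block_ext[OF g las' las]) auto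
      have \<delta>'\<delta>: "\<delta>' = \<delta>"
        using fib \<psi>'(1) homset_fibcat_length[OF gof \<delta>'] homset_fibcat_length[OF gof \<delta>]
        by (intro nth_equalityI) auto
      have "\<alpha>' = \<alpha>"
        using e F' unit[of \<alpha>'] by (simp add: Int1_iff as' \<delta>'\<delta> \<alpha>_def)
      then show "t = ?t" by (simp add: t' as' \<delta>'\<delta>)
    qed
  qed
  then show ?thesis
    using \<phi> by (simp add: operadic_cartesian_def)
qed

lemma lift_dataD:
  assumes "lift_data (integ P) g (n, c) bs"
  shows "osurj (length g) n g" "c \<in> Obj (Cat P n)" "map snd bs \<in> Obj (fibcat P g)" "length bs = n"
    "\<And>j. j < n \<Longrightarrow> fst (bs ! j) = psize g j"
proof -
  have g: "osurj (length g) n g" and n: "length bs = n" and c: "c \<in> Obj (Cat P n)" and bs: "set bs \<subseteq> Obj (integ P)"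
    and ps: "\<And>j. j < n \<Longrightarrow> fst (bs ! j) = psize g j"
    using assms by (auto simp: lift_data_def)
  have "snd (bs ! j) \<in> Obj (Cat P (psize g j))" if "j < n" for j
    using bs ps[OF that] that n nth_mem[of j bs] by fastforce
  then show "osurj (length g) n g" "c \<in> Obj (Cat P n)" "map snd bs \<in> Obj (fibcat P g)" "length bs = n"
    "\<And>j. j < n \<Longrightarrow> fst (bs ! j) = psize g j"
    using g n c ps osurjD(6)[OF g] by (auto simp: Obj_fibcat tup_def)
qed

lemma is_lift_Lift:
  assumes "lift_data (integ P) g b bs"
  shows "is_lift (integ P) g b bs (Lift (integ P) g b bs)"
proof -
  obtain n c where b: "b = (n, c)" by (cases b)
  note L = lift_dataD[OF assms[unfolded b]]
  have "map (\<lambda>i. (psize g i, map snd bs ! i)) [0..<n] = bs"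
    using L(4,5) by (intro nth_equalityI) (auto simp: prod_eq_iff)
  then show ?thesis
    using cartesian_lift[OF L(1-3)] L(4) by (simp add: is_lift_def b)
qed

text \<open>The domains of the small lifts form the tuple \<open>mul\<close>, so the sources agree
  by associativity of \<mu> on objects. The last component of the composite is a composite of
  identities.\<close>

lemma Lift_Cmp:
  assumes g: "lift_data (integ P) g (n, c) bs"
    and f: "lift_data (integ P) f (Src (integ P) (Lift (integ P) g (n, c) bs)) as"
  shows "Cmp (integ P) (Lift (integ P) g (n, c) bs)
      (Lift (integ P) f (Src (integ P) (Lift (integ P) g (n, c) bs)) as) =
    Lift (integ P) (ocomp g f) (n, c)
      (map (\<lambda>i. Src (integ P) (Lift (integ P) (induced g f i) (bs ! i) (block g i as))) [0..<n])"
proof -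
  note G = lift_dataD[OF g] and F = lift_dataD[OF f[simplified]]
  let ?b = "mu0 P g c (map snd bs)"
  have b: "?b \<in> Obj (Cat P (length g))"
    using ob.mu_closed[OF G(1,2)] G(3) by (simp add: Obj_fibcat)
  have assoc: "mu0 P (ocomp g f) c (mul (mu0 P) g f (map snd bs) (map snd as)) = mu0 P f ?b (map snd as)"
    using ob.mu_assoc[OF F(1) G(1,2)] G(3) F(3) by (simp add: Obj_fibcat)
  have mb: "mu0 P f ?b (map snd as) \<in> Obj (Cat P (length f))"
    using ob.mu_closed[OF F(1,2)] F(3) by (simp add: Obj_fibcat)
  have "snd (src1 (Lift (integ P) h p xs)) = mu0 P h (snd p) (map snd xs)" for h p xs
    by (cases p) simp
  then have l: "map snd (map (\<lambda>i. Src (integ P) (Lift (integ P) (induced g f i) (bs ! i) (block g i as))) [0..<n])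
      = mul (mu0 P) g f (map snd bs) (map snd as)"
    using G(4) osurjD(6)[OF G(1)] by (auto simp: mul_def block_map)
  note C = category_Cat[OF osurjD(1)[OF F(1)]]
  show ?thesis
    unfolding integ_simps(16) l assoc
    using mu_Idn[OF F(1) b F(3)] Cmp_Idn_right[OF C Idn_homset[OF C mb]]
    by (simp add: int_comp_Int1[OF G(1)] assoc)
qed

lemma split_fibered_integ: "split_fibered (integ P)"
  unfolding split_fibered_def
proof (intro conjI allI impI ballI)
  \<comment> \<open>Surjectivity on components: \<open>bang\<close> connects every ordinal to 1, so
    the object \<open>[1,e]\<close> serves for all of them.\<close>
  have "conn Deltas n 1" "conn Deltas 1 n" if "1 \<le> n" for n
  proof -
    have "bang n \<in> Arr Deltas \<and> Src Deltas (bang n) = n \<and> Trg Deltas (bang n) = 1"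
      using osurjD(3,6)[OF osurj_bang[OF that]] osurj_ocod[OF osurj_bang[OF that]] by simp
    then have e: "equivclp (\<lambda>p q. \<exists>f\<in>Arr Deltas. Src Deltas f = p \<and> Trg Deltas f = q) n 1"
      by (intro r_into_equivclp) blast
    show "conn Deltas n 1" using e that by (simp add: conn_def)
    show "conn Deltas 1 n" using equivclp_sym[OF e] that by (simp add: conn_def)
  qed
  moreover have "(1, unit P) \<in> Obj (integ P)" using ob.e_closed by simp
  ultimately have "\<exists>x\<in>Obj (integ P). conn Deltas (ncard (integ P) x) n" if "n \<in> Obj Deltas" for n
    using that by (intro bexI[of _ "(1, unit P)"]) simp_all
  then show "fibered (integ P)"
    unfolding fibered_def using operadic_2category_integ is_lift_Lift by blast
  show "is_lift (integ P) f b as (Lift (integ P) f b as)" if "lift_data (integ P) f b as" for f b as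
    using that by (rule is_lift_Lift)
  show "Lift (integ P) (oid (ncard (integ P) c)) c (T0 (Fib (integ P) c) (Idn (integ P) c)) = Idn (integ P) c"
    if c: "c \<in> Obj (integ P)" for c
  proof -
    obtain n a where c: "c = (n, a)" "1 \<le> n" "a \<in> Obj (Cat P n)" using c by auto
    have l: "map snd (T0 (Fib (integ P) c) (Idn (integ P) c)) = replicate n (unit P)"
      by (intro nth_equalityI) (auto simp: c)
    have "length (oid n) = n" by (simp add: oid_def)
    then show ?thesis
      unfolding c(1) integ_simps(16) using l ob.mu_unit_right[OF c(2,3)] by (simp add: c(1))
  qed
  show "Lift (integ P) (bang (ncard (integ P) c)) (Lali (integ P) c) [c] = Ter (integ P) c"
    if "c \<in> Obj (integ P)" for c
    using that ob.mu_unit_left by (cases c) (simp add: bang_def)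
  show "Cmp (integ P) (Lift (integ P) g c bs) (Lift (integ P) f (Src (integ P) (Lift (integ P) g c bs)) as) =
    Lift (integ P) (ocomp g f) c
      (map (\<lambda>i. Src (integ P) (Lift (integ P) (induced g f i) (bs ! i) (block g i as))) [0..<ncard (integ P) c])"
    if "lift_data (integ P) g c bs" "lift_data (integ P) f (Src (integ P) (Lift (integ P) g c bs)) as"
    for f g c bs as
    using that Lift_Cmp[of g "fst c" "snd c" bs f as] by simp
qed

end

section \<open>The category of split-fibered operadic 2-categories\<close>

lemma teqD:
  assumes "teq C F G"
  shows "x \<in> Obj C \<Longrightarrow> T0 F x = T0 G x" "f \<in> Arr C \<Longrightarrow> T1 F f = T1 G f" "c \<in> Cell C \<Longrightarrow> T2 F c = T2 G c"
  using assms by (auto simp: teq_def)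

lemma teqI:
  assumes "\<And>x. x \<in> Obj C \<Longrightarrow> T0 F x = T0 G x" "\<And>f. f \<in> Arr C \<Longrightarrow> T1 F f = T1 G f"
    "\<And>c. c \<in> Cell C \<Longrightarrow> T2 F c = T2 G c"
  shows "teq C F G"
  using assms by (auto simp: teq_def)

text \<open>Arrows of \<open>SFib\<close> carry restricted 2-functors; this reduces their equality
  to agreement on carriers.\<close>

lemma trestrict_eq_iff: "trestrict C F = trestrict C G \<longleftrightarrow> teq C F G"
proof
  assume "trestrict C F = trestrict C G"
  then have "restrict (T0 F) (Obj C) = restrict (T0 G) (Obj C)" "restrict (T1 F) (Arr C) = restrict (T1 G) (Arr C)"
    "restrict (T2 F) (Cell C) = restrict (T2 G) (Cell C)"
    by (simp_all add: trestrict_def)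
  then show "teq C F G"
    by (auto intro!: teqI dest: fun_cong simp: restrict_def fun_eq_iff split: if_splits)
qed (auto simp: trestrict_def teq_def restrict_def fun_eq_iff)

lemma teq_trestrict: "teq C (trestrict C F) F"
  by (auto simp: teq_def trestrict_def)

lemma teq_sym: "teq C F G \<Longrightarrow> teq C G F"
  by (simp add: teq_def)

lemma teq_trans: "teq C F G \<Longrightarrow> teq C G H \<Longrightarrow> teq C F H"
  by (simp add: teq_def)

lemma trestrict_idem [simp]: "trestrict C (trestrict C F) = trestrict C F"
  by (simp add: trestrict_eq_iff teq_trestrict)

text \<open>Agreement is assumed only on carriers, and the category axioms guarantee that
  identities, composites and endpoints stay in them.\<close>

lemma is_functor_cong:
  assumes C: "category C" and F: "is_functor C D F0 F1"
    and e: "\<And>x. x \<in> Obj C \<Longrightarrow> F0 x = G0 x" "\<And>f. f \<in> Arr C \<Longrightarrow> F1 f = G1 f"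
  shows "is_functor C D G0 G1"
proof (rule is_functorI)
  fix x assume x: "x \<in> Obj C"
  then show "G0 x \<in> Obj D" using functor_Obj[OF F] by (simp add: e[symmetric])
  show "G1 (Idn C x) = Idn D (G0 x)"
    using functor_Idn[OF F x] x homsetD(1)[OF Idn_homset[OF C x]] by (simp add: e)
next
  fix f x y assume f: "f \<in> homset C x y"
  then show "G1 f \<in> homset D (G0 x) (G0 y)"
    using functor_homset[OF F f] homset_Obj[OF C f] homsetD(1)[OF f] by (simp add: e)
next
  fix f g x y z assume f: "f \<in> homset C x y" and g: "g \<in> homset C y z"
  show "G1 (Cmp C g f) = Cmp D (G1 g) (G1 f)"
    using functor_Cmp[OF F f g] homsetD(1)[OF Cmp_homset[OF C f g]] homsetD(1)[OF f] homsetD(1)[OF g]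
    by (simp add: e)
qed

lemma is_functor_comp:
  assumes F: "is_functor C D F0 F1" and G: "is_functor D E G0 G1"
  shows "is_functor C E (G0 \<circ> F0) (G1 \<circ> F1)"
proof (rule is_functorI)
  show "(G1 \<circ> F1) (Cmp C g f) = Cmp E ((G1 \<circ> F1) g) ((G1 \<circ> F1) f)"
    if "f \<in> homset C x y" "g \<in> homset C y z" for f g x y z
    using functor_Cmp[OF F that] functor_Cmp[OF G functor_homset[OF F that(1)] functor_homset[OF F that(2)]]
    by simp
qed (simp_all add: functor_Obj[OF F] functor_Idn[OF F] functor_Obj[OF G] functor_Idn[OF G]
    functor_homset[OF G functor_homset[OF F]])

lemma is_functor_id: "is_functor C C id id"
  by (simp add: is_functor_def)

lemma two_categoryD:
  assumes "two_category C"
  shows "category C" "category (vert C)" "category (horiz C)"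
    "c \<in> Cell C \<Longrightarrow> Src C (Src2 C c) = Src C (Trg2 C c) \<and> Trg C (Src2 C c) = Trg C (Trg2 C c)"
    "c \<in> Cell C \<Longrightarrow> d \<in> Cell C \<Longrightarrow> Src C (Src2 C d) = Trg C (Src2 C c) \<Longrightarrow>
      Src2 C (HCmp C d c) = Cmp C (Src2 C d) (Src2 C c) \<and> Trg2 C (HCmp C d c) = Cmp C (Trg2 C d) (Trg2 C c)"
  using assms by (auto simp: two_category_def)

lemma two_functorD:
  assumes "two_functor C D F"
  shows "is_functor C D (T0 F) (T1 F)" "is_functor (vert C) (vert D) (T1 F) (T2 F)"
    "is_functor (horiz C) (horiz D) (T0 F) (T2 F)"
  using assms by (auto simp: two_functor_def)

lemma two_functor_cong:
  assumes "two_category C" "two_functor C D F" "teq C F G"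
  shows "two_functor C D G"
  using two_functorD[OF assms(2)] two_categoryD(1-3)[OF assms(1)] teqD[OF assms(3)]
  unfolding two_functor_def by (auto intro: is_functor_cong)

lemma two_functor_comp:
  assumes "two_functor C D F" "two_functor D E G" shows "two_functor C E (tcomp G F)"
  using two_functorD[OF assms(1)] two_functorD[OF assms(2)]
  unfolding two_functor_def tcomp_def by (auto intro: is_functor_comp)

lemma two_functor_carrier:
  assumes C: "two_category C" and F: "two_functor C D F"
  shows "x \<in> Obj C \<Longrightarrow> T0 F x \<in> Obj D"
    and "f \<in> Arr C \<Longrightarrow> T1 F f \<in> Arr D" "f \<in> Arr C \<Longrightarrow> Src D (T1 F f) = T0 F (Src C f)"
      "f \<in> Arr C \<Longrightarrow> Trg D (T1 F f) = T0 F (Trg C f)"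
    and "c \<in> Cell C \<Longrightarrow> T2 F c \<in> Cell D" "c \<in> Cell C \<Longrightarrow> Src2 D (T2 F c) = T1 F (Src2 C c)"
      "c \<in> Cell C \<Longrightarrow> Trg2 D (T2 F c) = T1 F (Trg2 C c)"
  using two_functorD[OF F] by (auto simp: is_functor_def)

text \<open>The axioms constrain \<open>Fib\<close> only on the carrier of a slice. Before an
  equation about fibers in \<open>D\<close> can be applied to an image under \<open>F\<close>, the
  image must be known to lie in the slice of \<open>D\<close>.\<close>

lemma slice_fun_carrier:
  assumes C: "two_category C" and F: "two_functor C D F"
  shows "\<phi> \<in> Obj (lslice C x) \<Longrightarrow> T1 F \<phi> \<in> Obj (lslice D (T0 F x))"
    and "t \<in> lax_triangles C x \<Longrightarrow> map_tri (T1 F) (T2 F) t \<in> lax_triangles D (T0 F x)"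
    and "\<tau> \<in> Cell (lslice C x) \<Longrightarrow> map_tri2 (T1 F) (T2 F) \<tau> \<in> Cell (lslice D (T0 F x))"
proof -
  note K = two_functor_carrier[OF C F]
  note F1 = functor_Cmp[OF two_functorD(1)[OF F]]
  show "\<phi> \<in> Obj (lslice C x) \<Longrightarrow> T1 F \<phi> \<in> Obj (lslice D (T0 F x))"
    by (auto simp: K)
  show T: "map_tri (T1 F) (T2 F) t \<in> lax_triangles D (T0 F x)" if "t \<in> lax_triangles C x" for t
    using that F1[of "d2 t" "Src C (d2 t)" "Trg C (d2 t)" "d0 t" x]
    by (auto simp: lax_triangles_iff tri.map_sel K homset_def)
  show "map_tri2 (T1 F) (T2 F) \<tau> \<in> Cell (lslice D (T0 F x))" if \<tau>: "\<tau> \<in> Cell (lslice C x)"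
  proof -
    let ?s = "src_tri \<tau>" and ?t = "trg_tri \<tau>" and ?c = "cell_tri \<tau>"
    note L = \<tau>[unfolded Cell_lslice]
    have t: "d0 ?t \<in> Arr C" "d2 ?t \<in> Arr C" "tcell ?t \<in> Cell C" "Trg C (d2 ?t) = Src C (d0 ?t)"
      "Src2 C (tcell ?t) = Cmp C (d0 ?t) (d2 ?t)"
      using L by (auto simp: lax_triangles_iff)
    have c: "?c \<in> Cell C" "Trg2 C ?c = d2 ?t" using L by auto
    let ?i = "Idn2 C (d0 ?t)"
    have i: "?i \<in> Cell C" "Src2 C ?i = d0 ?t" "Trg2 C ?i = d0 ?t"
      using Idn_homset[OF two_categoryD(2)[OF C], of "d0 ?t"] t by (auto simp: homset_def)
    have ci: "Src C (Src2 C ?i) = Trg C (Src2 C ?c)"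
      using two_categoryD(4)[OF C c(1)] c t i by simp
    have h: "HCmp C ?i ?c \<in> Cell C"
      using Cmp_homset[OF two_categoryD(3)[OF C], of ?c "Src C (Src2 C ?c)" "Trg C (Src2 C ?c)" ?i "Trg C (d0 ?t)"]
        c i ci by (auto simp: homset_def)
    have h': "Trg2 C (HCmp C ?i ?c) = Src2 C (tcell ?t)"
      using two_categoryD(5)[OF C c(1) i(1) ci] i c t by simp
    \<comment> \<open>The slice condition is transported one operation at a time: vertical
      composite, horizontal composite, identity 2-cell. The preceding facts supply composability at
      each stage.\<close>
    have "T2 F (VCmp C (tcell ?t) (HCmp C ?i ?c)) = VCmp D (T2 F (tcell ?t)) (T2 F (HCmp C ?i ?c))"
      using functor_Cmp[OF two_functorD(2)[OF F], of "HCmp C ?i ?c" "Src2 C (HCmp C ?i ?c)" "Src2 C (tcell ?t)"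
          "tcell ?t" "Trg2 C (tcell ?t)"] h h' t by (simp add: homset_def)
    also have "T2 F (HCmp C ?i ?c) = HCmp D (T2 F ?i) (T2 F ?c)"
      using functor_Cmp[OF two_functorD(3)[OF F], of ?c "Src C (Src2 C ?c)" "Trg C (Src2 C ?c)" ?i "Trg C (d0 ?t)"]
        c i ci by (simp add: homset_def)
    also have "T2 F ?i = Idn2 D (T1 F (d0 ?t))"
      using functor_Idn[OF two_functorD(2)[OF F], of "d0 ?t"] t by simp
    finally have "T2 F (tcell ?s) = VCmp D (T2 F (tcell ?t)) (HCmp D (Idn2 D (T1 F (d0 ?t))) (T2 F ?c))"
      using L by simp
    then show ?thesis
      using L T[of ?s] T[of ?t] by (simp add: Cell_lslice tri2.map_sel tri.map_sel K)
  qed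
qed

lemma operadic_2categoryD:
  assumes "operadic_2category C"
  shows "two_category C" "two_functor C Deltas (Card C)"
    "x \<in> Obj C \<Longrightarrow> two_functor (lslice C x) (pow C (ncard C x)) (Fib C x)"
    "x \<in> Obj C \<Longrightarrow> Lali C x \<in> Obj C"
  using assms by (auto simp: operadic_2category_def local_lali_terminal_def)

lemma split_fiberedD:
  assumes "split_fibered C"
  shows "operadic_2category C" "lift_data C f b as \<Longrightarrow> Lift C f b as \<in> Arr C"
  using assms by (auto simp: split_fibered_def fibered_def is_lift_def operadic_cartesian_def)

lemma Fib_carrier:
  assumes C: "operadic_2category C" and x: "x \<in> Obj C"
  shows "\<phi> \<in> Obj (lslice C x) \<Longrightarrow> set (T0 (Fib C x) \<phi>) \<subseteq> Obj C"
    and "t \<in> Arr (lslice C x) \<Longrightarrow> set (T1 (Fib C x) t) \<subseteq> Arr C"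
    and "\<tau> \<in> Cell (lslice C x) \<Longrightarrow> set (T2 (Fib C x) \<tau>) \<subseteq> Cell C"
  using two_functorD[OF operadic_2categoryD(3)[OF C x]] by (auto simp: is_functor_def)

lemma slice_fun_cong:
  assumes C: "two_category C" and e: "teq C F G"
  shows "teq (lslice C x) (slice_fun F) (slice_fun G)"
proof -
  have t: "map_tri (T1 F) (T2 F) t = map_tri (T1 G) (T2 G) t" if "t \<in> lax_triangles C x" for t
    using that teqD[OF e] by (cases t) (auto simp: lax_triangles_iff)
  show ?thesis
  proof (rule teqI)
    fix \<tau> assume \<tau>: "\<tau> \<in> Cell (lslice C x)"
    then show "T2 (slice_fun F) \<tau> = T2 (slice_fun G) \<tau>"
      using t[of "src_tri \<tau>"] t[of "trg_tri \<tau>"] teqD[OF e] by (cases \<tau>) (auto simp: Cell_lslice)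
  qed (use t teqD[OF e] in auto)
qed

lemma pow_fun_cong:
  assumes "teq C F G"
  shows "set xs \<subseteq> Obj C \<Longrightarrow> map (T0 F) xs = map (T0 G) xs"
    "set fs \<subseteq> Arr C \<Longrightarrow> map (T1 F) fs = map (T1 G) fs"
    "set cs \<subseteq> Cell C \<Longrightarrow> map (T2 F) cs = map (T2 G) cs"
  using teqD[OF assms] by auto

lemma sfib_morphismD:
  assumes "sfib_morphism C D G"
  shows "two_functor C D G" "teq C (tcomp (Card D) G) (Card C)"
    "x \<in> Obj C \<Longrightarrow> teq (lslice C x) (tcomp (Fib D (T0 G x)) (slice_fun G)) (tcomp (pow_fun G) (Fib C x))"
    "x \<in> Obj C \<Longrightarrow> T0 G (Lali C x) = Lali D (T0 G x)"
    "lift_data C f b as \<Longrightarrow> T1 G (Lift C f b as) = Lift D f (T0 G b) (map (T0 G) as)"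
  using assms by (auto simp: sfib_morphism_def operadic_2functor_def)

lemma sfib_morphismI:
  assumes "two_functor C D G" "teq C (tcomp (Card D) G) (Card C)"
    "\<And>x. x \<in> Obj C \<Longrightarrow> teq (lslice C x) (tcomp (Fib D (T0 G x)) (slice_fun G)) (tcomp (pow_fun G) (Fib C x))"
    "\<And>x. x \<in> Obj C \<Longrightarrow> T0 G (Lali C x) = Lali D (T0 G x)"
    "\<And>f b as. lift_data C f b as \<Longrightarrow> T1 G (Lift C f b as) = Lift D f (T0 G b) (map (T0 G) as)"
  shows "sfib_morphism C D G"
  using assms by (auto simp: sfib_morphism_def operadic_2functor_def)

text \<open>By \<open>Fib_carrier\<close> the fibers of objects, triangles and cells lie in the
  carriers, where the two 2-functors agree; lifts lie in \<open>Arr C\<close> by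
  \<open>split_fiberedD\<close>.\<close>

lemma sfib_morphism_cong:
  assumes C: "split_fibered C" and F: "sfib_morphism C D F" and e: "teq C F G"
  shows "sfib_morphism C D G"
proof (rule sfib_morphismI)
  note O = split_fiberedD(1)[OF C]
  note C2 = operadic_2categoryD(1)[OF O]
  note E = teqD[OF e[THEN teq_sym]]
  show "two_functor C D G"
    using C2 sfib_morphismD(1)[OF F] e by (rule two_functor_cong)
  show "teq C (tcomp (Card D) G) (Card C)"
    using teqD[OF sfib_morphismD(2)[OF F]] by (intro teqI) (simp_all add: E)
  fix x assume x: "x \<in> Obj C"
  note S = teqD[OF slice_fun_cong[OF C2 e[THEN teq_sym], of x]]
  note P = pow_fun_cong[OF e[THEN teq_sym]]
  show "teq (lslice C x) (tcomp (Fib D (T0 G x)) (slice_fun G)) (tcomp (pow_fun G) (Fib C x))"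
    using teqD[OF sfib_morphismD(3)[OF F x], unfolded tcomp_simps pow_fun_simps]
    by (intro teqI) (simp_all only: tcomp_simps pow_fun_simps E(1)[OF x] S P Fib_carrier[OF O x])
  show "T0 G (Lali C x) = Lali D (T0 G x)"
    using sfib_morphismD(4)[OF F x] operadic_2categoryD(4)[OF O x] by (simp add: E x)
next
  note E = teqD[OF e[THEN teq_sym]]
  fix f b as assume l: "lift_data C f b as"
  then have "b \<in> Obj C" "set as \<subseteq> Obj C" by (simp_all add: lift_data_def)
  moreover from this have "map (T0 G) as = map (T0 F) as"
    by (intro pow_fun_cong(1)[OF e[THEN teq_sym]])
  ultimately show "T1 G (Lift C f b as) = Lift D f (T0 G b) (map (T0 G) as)"
    using sfib_morphismD(5)[OF F l] split_fiberedD(2)[OF C l] by (simp add: E cong: map_cong)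
qed

text \<open>Cardinalities are preserved, so lifting data go to lifting data. Preservation of lifts
  by a second morphism can then be used after a first one.\<close>

lemma lift_data_map:
  assumes C: "split_fibered C" and F: "sfib_morphism C D F" and l: "lift_data C f b as"
  shows "lift_data D f (T0 F b) (map (T0 F) as)"
proof -
  note K = two_functor_carrier[OF operadic_2categoryD(1)[OF split_fiberedD(1)[OF C]] sfib_morphismD(1)[OF F]]
  note e = teqD(1)[OF sfib_morphismD(2)[OF F]]
  have "ncard D (T0 F (as ! j)) = ncard C (as ! j)" if "j < ncard C b" for j
  proof -
    have "as ! j \<in> Obj C"
      using l that nth_mem[of j as] by (auto simp: lift_data_def simp del: nth_mem)
    then show ?thesis using e by simp
  qed
  then show ?thesis
    using l K(1) e[of b] by (auto simp: lift_data_def)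
qed

lemma sfib_morphism_comp:
  assumes C: "split_fibered C" and F: "sfib_morphism C D F" and G: "sfib_morphism D E G"
  shows "sfib_morphism C E (tcomp G F)"
proof (rule sfib_morphismI)
  note O = split_fiberedD(1)[OF C]
  note C2 = operadic_2categoryD(1)[OF O]
  note F2 = sfib_morphismD(1)[OF F]
  note K = two_functor_carrier[OF C2 F2]
  show "two_functor C E (tcomp G F)"
    using F2 sfib_morphismD(1)[OF G] by (rule two_functor_comp)
  show "teq C (tcomp (Card E) (tcomp G F)) (Card C)"
    using teqD[OF sfib_morphismD(2)[OF F]] teqD[OF sfib_morphismD(2)[OF G]] K by (intro teqI) simp_all
  fix x assume x: "x \<in> Obj C"
  note L = slice_fun_carrier[OF C2 F2, of _ x]
  have m: "map_tri (T1 (tcomp G F)) (T2 (tcomp G F)) t = map_tri (T1 G) (T2 G) (map_tri (T1 F) (T2 F) t)"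
    "map_tri2 (T1 (tcomp G F)) (T2 (tcomp G F)) \<tau> = map_tri2 (T1 G) (T2 G) (map_tri2 (T1 F) (T2 F) \<tau>)" for t \<tau>
    by (simp_all add: tri.map_comp tri2.map_comp tcomp_def)
  note e1 = teqD[OF sfib_morphismD(3)[OF F x], simplified]
  note e2 = teqD[OF sfib_morphismD(3)[OF G K(1)[OF x]], simplified]
  show "teq (lslice C x) (tcomp (Fib E (T0 (tcomp G F) x)) (slice_fun (tcomp G F)))
      (tcomp (pow_fun (tcomp G F)) (Fib C x))"
    using L by (intro teqI) (simp_all add: m e1 e2)
  show "T0 (tcomp G F) (Lali C x) = Lali E (T0 (tcomp G F) x)"
    using sfib_morphismD(4)[OF F x] sfib_morphismD(4)[OF G K(1)[OF x]] by simp
next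
  fix f b as assume l: "lift_data C f b as"
  show "T1 (tcomp G F) (Lift C f b as) = Lift E f (T0 (tcomp G F) b) (map (T0 (tcomp G F)) as)"
    using sfib_morphismD(5)[OF F l] sfib_morphismD(5)[OF G lift_data_map[OF C F l]]
    by (simp add: tcomp_def comp_def)
qed

lemma sfib_morphism_id: "sfib_morphism C C tid"
proof (rule sfib_morphismI)
  show "two_functor C C tid"
    by (simp add: two_functor_def tid_def is_functor_id)
qed (auto simp: tid_def tri.map_id tri2.map_id intro!: teqI simp flip: id_def)

lemma SFib_simps [simp]:
  "Obj SFib = {C. split_fibered C}"
  "(C, F, D) \<in> Arr SFib \<longleftrightarrow> split_fibered C \<and> split_fibered D \<and> sfib_morphism C D F \<and> trestrict C F = F"
  "Src SFib (C, F, D) = C" "Trg SFib (C, F, D) = D" "Idn SFib C = (C, trestrict C tid, C)"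
  "Cmp SFib (C', G, E) (C, F, D) = (C, trestrict C (tcomp G F), E)"
  by (simp_all add: SFib_def)

lemma homset_SFib:
  "A \<in> homset SFib C D \<longleftrightarrow> (\<exists>F. A = (C, F, D) \<and> split_fibered C \<and> split_fibered D \<and>
    sfib_morphism C D F \<and> trestrict C F = F)"
  by (cases A) (auto simp: homset_def)

lemma category_SFib: "category SFib"
proof (rule categoryI)
  fix A :: "('a, 'b, 'c) sfib \<times> ('a, 'b, 'c, 'a, 'b, 'c) twofun \<times> ('a, 'b, 'c) sfib"
  assume "A \<in> Arr SFib"
  then show "Src SFib A \<in> Obj SFib \<and> Trg SFib A \<in> Obj SFib" by (cases A) simp
next
  fix C :: "('a, 'b, 'c) sfib"
  assume "C \<in> Obj SFib"
  then show "Idn SFib C \<in> homset SFib C C"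
    using sfib_morphism_cong[OF _ sfib_morphism_id teq_sym[OF teq_trestrict]] by (simp add: homset_SFib)
next
  fix A B and C D E :: "('a, 'b, 'c) sfib"
  assume "A \<in> homset SFib C D" "B \<in> homset SFib D E"
  then show "Cmp SFib B A \<in> homset SFib C E"
    using sfib_morphism_cong[OF _ sfib_morphism_comp teq_sym[OF teq_trestrict]]
    by (auto simp: homset_SFib)
next
  fix A and C D :: "('a, 'b, 'c) sfib"
  assume "A \<in> homset SFib C D"
  then obtain F where F: "A = (C, F, D)" "split_fibered C" "split_fibered D" "sfib_morphism C D F" "trestrict C F = F"
    by (auto simp: homset_SFib)
  note K = two_functor_carrier[OF operadic_2categoryD(1)[OF split_fiberedD(1)[OF F(2)]] sfib_morphismD(1)[OF F(4)]]
  have "trestrict C (tcomp F (trestrict C tid)) = trestrict C F"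
    unfolding trestrict_eq_iff by (rule teqI) (simp_all add: trestrict_def tid_def)
  then show "Cmp SFib A (Idn SFib C) = A" by (simp add: F)
  have "trestrict C (tcomp (trestrict D tid) F) = trestrict C F"
    unfolding trestrict_eq_iff by (rule teqI) (simp_all add: trestrict_def tid_def K)
  then show "Cmp SFib (Idn SFib D) A = A" by (simp add: F)
next
  fix A A' A'' and B C D E :: "('a, 'b, 'c) sfib"
  assume "A \<in> homset SFib B C" "A' \<in> homset SFib C D" "A'' \<in> homset SFib D E"
  then obtain F G H where F: "A = (B, F, C)" "split_fibered B" "sfib_morphism B C F"
    and G: "A' = (C, G, D)" and H: "A'' = (D, H, E)"
    by (auto simp: homset_SFib)
  note K = two_functor_carrier[OF operadic_2categoryD(1)[OF split_fiberedD(1)[OF F(2)]] sfib_morphismD(1)[OF F(3)]]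
  \<comment> \<open>By \<open>K\<close> the first morphism maps carriers into carriers, so the inner
    restrictions are invisible after the outer one.\<close>
  have "trestrict B (tcomp H (trestrict B (tcomp G F))) = trestrict B (tcomp (trestrict C (tcomp H G)) F)"
    unfolding trestrict_eq_iff by (rule teqI) (simp_all add: trestrict_def K)
  then show "Cmp SFib A'' (Cmp SFib A' A) = Cmp SFib (Cmp SFib A'' A') A"
    by (simp add: F G H)
qed

section \<open>Morphisms of operads and the category of operads\<close>

lemma length_mapfib [simp]: "length (mapfib F g xs) = ocod g"
  by (simp add: mapfib_def)

lemma nth_mapfib: "i < ocod g \<Longrightarrow> mapfib F g xs ! i = F (psize g i) (xs ! i)"
  by (simp add: mapfib_def)

lemma mapfib_cong:
  assumes g: "osurj m n g" and xs: "tup X g xs"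
    and "\<And>n x. 1 \<le> n \<Longrightarrow> x \<in> X n \<Longrightarrow> F n x = G n x"
  shows "mapfib F g xs = mapfib G g xs"
  using xs assms(3) psize_pos[OF g] osurjD(6)[OF g] by (auto simp: mapfib_def tup_def)

lemma mapfib_comp: "mapfib (\<lambda>n. G n \<circ> F n) g xs = mapfib G g (mapfib F g xs)"
  by (simp add: mapfib_def)

lemma mapfib_id: "length xs = ocod g \<Longrightarrow> mapfib (\<lambda>n. id) g xs = xs"
  by (metis (no_types, lifting) id_apply length_mapfib nth_equalityI nth_mapfib)

lemma tup_mapfib:
  assumes g: "osurj m n g" and xs: "tup X g xs"
    and "\<And>n x. 1 \<le> n \<Longrightarrow> x \<in> X n \<Longrightarrow> F n x \<in> Y n"
  shows "tup Y g (mapfib F g xs)"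
  using xs assms(3) psize_pos[OF g] osurjD(6)[OF g] by (auto simp: nth_mapfib tup_def)

lemma block_mapfib:
  assumes f: "osurj m k f" and g: "osurj k n g" and i: "i < n" and xs: "length xs = k"
  shows "block g i (mapfib F f xs) = mapfib F (induced g f i) (block g i xs)"
  using osurjD(6)[OF f] osurjD(6)[OF osurj_induced[OF f g i]] osurjD(3,4)[OF g] xs off_add_less(1)[OF g i]
  by (intro nth_equalityI) (auto simp: length_block nth_block nth_mapfib psize_induced[OF f g i])

lemma mapfib_replicate: "1 \<le> n \<Longrightarrow> mapfib F (oid n) (replicate n e) = replicate n (F 1 e)"
  using osurjD(6)[OF osurj_oid] by (intro nth_equalityI) (auto simp: nth_mapfib psize_oid)

text \<open>In coordinate \<open>i\<close> this is compatibility with composition over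
  \<open>induced g f i\<close>, combined with \<open>block_mapfib\<close>. It is kept abstract in
  \<open>X\<close> so as to serve both objects and morphisms.\<close>

lemma mapfib_mul:
  assumes f: "osurj m k f" and g: "osurj k n g" and bs: "tup X g bs" and xs: "tup X f xs"
    and \<mu>: "\<And>k n g c bs. osurj k n g \<Longrightarrow> c \<in> X n \<Longrightarrow> tup X g bs \<Longrightarrow> F k (\<mu> g c bs) = \<nu> g (F n c) (mapfib F g bs)"
  shows "mapfib F (ocomp g f) (mul \<mu> g f bs xs) = mul \<nu> g f (mapfib F g bs) (mapfib F f xs)"
proof (rule nth_equalityI)
  note o = osurjD(6)[OF g] osurjD(6)[OF osurj_ocomp[OF f g]]
  show "length (mapfib F (ocomp g f) (mul \<mu> g f bs xs)) = length (mul \<nu> g f (mapfib F g bs) (mapfib F f xs))"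
    using o by simp
  fix i assume "i < length (mapfib F (ocomp g f) (mul \<mu> g f bs xs))"
  then have i: "i < n" using o by simp
  have "bs ! i \<in> X (psize g i)" using bs i o by (simp add: tup_def)
  then show "mapfib F (ocomp g f) (mul \<mu> g f bs xs) ! i = mul \<nu> g f (mapfib F g bs) (mapfib F f xs) ! i"
    using i o \<mu>[OF osurj_induced[OF f g i] _ tup_block[OF f g i xs]] tup_length[OF f xs]
    by (simp add: nth_mapfib nth_mul block_mapfib[OF f g i])
qed

lemma integ_map_simps [simp]:
  "T0 (integ_map F) (m, a) = (m, O0 F m a)"
  "T1 (integ_map F) (Int1 (m, a) (k, b) f as \<alpha>) =
    Int1 (m, O0 F m a) (k, O0 F k b) f (mapfib (O0 F) f as) (O1 F m \<alpha>)"
  "T2 (integ_map F) (Int2 s t \<delta>) =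
    Int2 (T1 (integ_map F) s) (T1 (integ_map F) t) (mapfib (O1 F) (imap s) \<delta>)"
  by (simp_all add: integ_map_def Let_def)

lemma integ_map_sel [simp]:
  "fst (T0 (integ_map F) x) = fst x"
  "src1 (T1 (integ_map F) s) = T0 (integ_map F) (src1 s)"
  "trg1 (T1 (integ_map F) s) = T0 (integ_map F) (trg1 s)"
  "imap (T1 (integ_map F) s) = imap s"
  "src2 (T2 (integ_map F) c) = T1 (integ_map F) (src2 c)"
  "trg2 (T2 (integ_map F) c) = T1 (integ_map F) (trg2 c)"
  "icomps (T2 (integ_map F) c) = mapfib (O1 F) (imap (src2 c)) (icomps c)"
  by (simp_all add: integ_map_def Let_def split: prod.splits)

section \<open>The 2-functor induced by a morphism of operads\<close>

locale operad_mor = P: oper P + Q: oper Q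
  for P :: "('o, 'm) operad" and Q :: "('p, 'n) operad" +
  fixes F :: "('o, 'm, 'p, 'n) opmap"
  assumes mor: "operad_morphism P Q F"
begin

lemma cat_functor: "1 \<le> n \<Longrightarrow> is_functor (Cat P n) (Cat Q n) (O0 F n) (O1 F n)"
  using mor by (simp add: operad_morphism_def)

lemma map_unit: "O0 F 1 (unit P) = unit Q"
  using mor by (simp add: operad_morphism_def)

lemma map_mu0:
  "osurj k n g \<Longrightarrow> c \<in> Obj (Cat P n) \<Longrightarrow> bs \<in> Obj (fibcat P g) \<Longrightarrow>
    O0 F k (mu0 P g c bs) = mu0 Q g (O0 F n c) (mapfib (O0 F) g bs)"
  using mor by (simp add: operad_morphism_def)

lemma map_mu1:
  "osurj k n g \<Longrightarrow> c \<in> Arr (Cat P n) \<Longrightarrow> bs \<in> Arr (fibcat P g) \<Longrightarrow>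
    O1 F k (mu1 P g c bs) = mu1 Q g (O1 F n c) (mapfib (O1 F) g bs)"
  using mor by (simp add: operad_morphism_def)

text \<open>Inherited coordinate by coordinate: fibers have at least one element
  (\<open>psize_pos\<close>), and in those arities \<open>F\<close> is a functor.\<close>

lemma mapfib_functor:
  assumes f: "osurj m k f"
  shows "is_functor (fibcat P f) (fibcat Q f) (mapfib (O0 F) f) (mapfib (O1 F) f)"
proof (rule is_functorI)
  note c = cat_functor[OF psize_pos[OF f]] and o = osurjD(6)[OF f]
  show "mapfib (O0 F) f xs \<in> Obj (fibcat Q f)" if "xs \<in> Obj (fibcat P f)" for xs
    using that by (auto simp: Obj_fibcat intro: tup_mapfib[OF f] functor_Obj[OF cat_functor])
  show "mapfib (O1 F) f (Idn (fibcat P f) xs) = Idn (fibcat Q f) (mapfib (O0 F) f xs)"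
    if "xs \<in> Obj (fibcat P f)" for xs
    using that o functor_Idn[OF c]
    by (intro nth_equalityI) (auto simp: nth_mapfib length_Idn_fibcat nth_Idn_fibcat Obj_fibcat tup_def)
  show "mapfib (O1 F) f fs \<in> homset (fibcat Q f) (mapfib (O0 F) f xs) (mapfib (O0 F) f ys)"
    if "fs \<in> homset (fibcat P f) xs ys" for fs xs ys
    using that o functor_homset[OF c] by (auto simp: homset_fibcat nth_mapfib)
  show "mapfib (O1 F) f (Cmp (fibcat P f) gs fs) = Cmp (fibcat Q f) (mapfib (O1 F) f gs) (mapfib (O1 F) f fs)"
    if "fs \<in> homset (fibcat P f) xs ys" "gs \<in> homset (fibcat P f) ys zs" for fs gs xs ys zs
    using that o
    by (intro nth_equalityI) (auto simp: homset_fibcat nth_mapfib nth_Cmp_fibcat intro!: functor_Cmp[OF c])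
qed

lemma mapfib_mul0:
  assumes f: "osurj m k f" and g: "osurj k n g" and bs: "bs \<in> Obj (fibcat P g)" and xs: "xs \<in> Obj (fibcat P f)"
  shows "mapfib (O0 F) (ocomp g f) (mul (mu0 P) g f bs xs) =
    mul (mu0 Q) g f (mapfib (O0 F) g bs) (mapfib (O0 F) f xs)"
  using bs xs map_mu0 by (intro mapfib_mul[OF f g]) (auto simp: Obj_fibcat)

lemma mapfib_mul1:
  assumes f: "osurj m k f" and g: "osurj k n g" and bs: "bs \<in> Arr (fibcat P g)" and xs: "xs \<in> Arr (fibcat P f)"
  shows "mapfib (O1 F) (ocomp g f) (mul (mu1 P) g f bs xs) =
    mul (mu1 Q) g f (mapfib (O1 F) g bs) (mapfib (O1 F) f xs)"
  using bs xs map_mu1 by (intro mapfib_mul[OF f g]) (auto simp: Arr_fibcat)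

lemma integ_map_arrow:
  assumes "s \<in> int_arrows P" shows "T1 (integ_map F) s \<in> int_arrows Q"
proof -
  obtain m a k b f as \<alpha> where s: "s = Int1 (m, a) (k, b) f as \<alpha>" and a: "a \<in> Obj (Cat P m)"
    and b: "b \<in> Obj (Cat P k)" and f: "osurj m k f" and as: "as \<in> Obj (fibcat P f)"
    and \<alpha>: "\<alpha> \<in> homset (Cat P m) (mu0 P f b as) a"
    using assms by (rule P.Int1E)
  show ?thesis
    using functor_Obj[OF cat_functor[OF osurjD(1)[OF f]] a] functor_Obj[OF cat_functor[OF osurjD(2)[OF f]] b]
      functor_Obj[OF mapfib_functor[OF f] as] functor_homset[OF cat_functor[OF osurjD(1)[OF f]] \<alpha>] f
    by (simp add: s Q.Int1_iff map_mu0[OF f b as])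
qed

lemma integ_map_comp:
  assumes F: "S \<in> int_arrows P" and G: "T \<in> int_arrows P" and FG: "src1 T = trg1 S"
  shows "T1 (integ_map F) (int_comp P T S) = int_comp Q (T1 (integ_map F) T) (T1 (integ_map F) S)"
proof -
  obtain m a k b f as \<alpha> where S: "S = Int1 (m, a) (k, b) f as \<alpha>" and f: "osurj m k f"
    and b: "b \<in> Obj (Cat P k)" and as: "as \<in> Obj (fibcat P f)" and \<alpha>: "\<alpha> \<in> homset (Cat P m) (mu0 P f b as) a"
    using F by (rule P.Int1E)
  obtain n c g bs \<beta> where T: "T = Int1 (k, b) (n, c) g bs \<beta>" and g: "osurj k n g"
    and bs: "bs \<in> Obj (fibcat P g)" and \<beta>: "\<beta> \<in> homset (Cat P k) (mu0 P g c bs) b"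
    using G FG by (auto simp: S elim: P.Int1E)
  note I = P.Idn_fib_homset[OF f as]
  \<comment> \<open>\<open>F\<close> preserves both operations occurring in the last component:
    composition in arity \<open>m\<close> and whiskering of \<beta> with identities.\<close>
  have "O1 F m (Cmp (Cat P m) \<alpha> (mu1 P f \<beta> (Idn (fibcat P f) as))) =
      Cmp (Cat Q m) (O1 F m \<alpha>) (mu1 Q f (O1 F k \<beta>) (Idn (fibcat Q f) (mapfib (O0 F) f as)))"
    using functor_Cmp[OF cat_functor[OF osurjD(1)[OF f]] P.mu_homset[OF f \<beta> I] \<alpha>]
      map_mu1[OF f homsetD(1)[OF \<beta>] homsetD(1)[OF I]] functor_Idn[OF mapfib_functor[OF f] as] by simp
  then show ?thesis
    by (simp add: S T P.int_comp_Int1[OF g] Q.int_comp_Int1[OF g] mapfib_mul0[OF f g bs as])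
qed

lemma integ_map_cell:
  assumes "c \<in> int_cells P" shows "T2 (integ_map F) c \<in> int_cells Q"
proof -
  obtain m a k b where "src1 (src2 c) = (m, a)" "trg1 (src2 c) = (k, b)" by (metis surj_pair)
  with assms obtain f as \<alpha> as' \<alpha>' \<delta> where
    c: "c = Int2 (Int1 (m, a) (k, b) f as \<alpha>) (Int1 (m, a) (k, b) f as' \<alpha>') \<delta>"
    and b: "b \<in> Obj (Cat P k)" and f: "osurj m k f"
    and \<alpha>': "\<alpha>' \<in> homset (Cat P m) (mu0 P f b as') a"
    and \<delta>: "\<delta> \<in> homset (fibcat P f) as as'" and e: "Cmp (Cat P m) \<alpha>' (mu1 P f (Idn (Cat P k) b) \<delta>) = \<alpha>"
    by (rule P.Int2E)
  note Ib = P.Idn_Cat_homset[OF osurjD(2)[OF f] b]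
  have "Cmp (Cat Q m) (O1 F m \<alpha>') (mu1 Q f (Idn (Cat Q k) (O0 F k b)) (mapfib (O1 F) f \<delta>)) = O1 F m \<alpha>"
    using functor_Cmp[OF cat_functor[OF osurjD(1)[OF f]] P.mu_homset[OF f Ib \<delta>] \<alpha>']
      map_mu1[OF f homsetD(1)[OF Ib] homsetD(1)[OF \<delta>]] functor_Idn[OF cat_functor[OF osurjD(2)[OF f]] b]
    by (simp add: e)
  then show ?thesis
    using integ_map_arrow[OF P.Int2_arrows(1)[OF assms]] integ_map_arrow[OF P.Int2_arrows(2)[OF assms]]
      functor_homset[OF mapfib_functor[OF f] \<delta>]
    by (simp add: c Q.Int2_iff)
qed

lemma integ_map_Idn:
  assumes "x \<in> Obj (integ P)"
  shows "T1 (integ_map F) (Idn (integ P) x) = Idn (integ Q) (T0 (integ_map F) x)"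
  using assms functor_Idn[OF cat_functor] map_unit by (auto simp: mapfib_replicate)

lemma integ_map_Idn2:
  assumes "s \<in> int_arrows P"
  shows "T2 (integ_map F) (Idn2 (integ P) s) = Idn2 (integ Q) (T1 (integ_map F) s)"
  using assms by (auto elim!: P.Int1E simp: functor_Idn[OF mapfib_functor])

lemma integ_map_HCmp:
  assumes c: "c \<in> int_cells P" and d: "d \<in> int_cells P" and cd: "src1 (src2 d) = trg1 (src2 c)"
  shows "T2 (integ_map F) (HCmp (integ P) d c) = HCmp (integ Q) (T2 (integ_map F) d) (T2 (integ_map F) c)"
proof -
  obtain m a k b n z where x: "src1 (src2 c) = (m, a)" and y: "trg1 (src2 c) = (k, b)"
    and zz: "trg1 (src2 d) = (n, z)"
    by (metis surj_pair)
  have y': "src1 (src2 d) = (k, b)" using cd y by simp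
  obtain f as \<alpha> as' \<alpha>' \<delta> where
    c_eq: "c = Int2 (Int1 (m, a) (k, b) f as \<alpha>) (Int1 (m, a) (k, b) f as' \<alpha>') \<delta>"
    and f: "osurj m k f" and \<delta>: "\<delta> \<in> homset (fibcat P f) as as'"
    using c x y by (rule P.Int2E)
  obtain g bs \<beta> bs' \<beta>' \<epsilon> where
    d_eq: "d = Int2 (Int1 (k, b) (n, z) g bs \<beta>) (Int1 (k, b) (n, z) g bs' \<beta>') \<epsilon>"
    and g: "osurj k n g" and \<epsilon>: "\<epsilon> \<in> homset (fibcat P g) bs bs'"
    using d y' zz by (rule P.Int2E)
  show ?thesis
    using integ_map_comp[OF P.Int2_arrows(1)[OF c] P.Int2_arrows(1)[OF d] cd]
      integ_map_comp[OF P.Int2_arrows(2)[OF c] P.Int2_arrows(2)[OF d]] P.Int2_arrows[OF c] P.Int2_arrows[OF d]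
      mapfib_mul1[OF f g homsetD(1)[OF \<epsilon>] homsetD(1)[OF \<delta>]]
    by (simp add: c_eq d_eq P.HCmp_integ[OF g] Q.HCmp_integ[OF g])
qed

lemma integ_map_VCmp:
  assumes "c \<in> homset (vert (integ P)) r s" "d \<in> homset (vert (integ P)) s t"
  shows "T2 (integ_map F) (VCmp (integ P) d c) = VCmp (integ Q) (T2 (integ_map F) d) (T2 (integ_map F) c)"
proof -
  from assms(1) obtain m a k b f as \<alpha> as' \<alpha>' \<delta> where c: "c = Int2 r s \<delta>" "r = Int1 (m, a) (k, b) f as \<alpha>"
    "s = Int1 (m, a) (k, b) f as' \<alpha>'" and f: "osurj m k f" and \<delta>: "\<delta> \<in> homset (fibcat P f) as as'"
    by (rule P.homset_vertE)
  from assms(2)[unfolded c] obtain as'' \<delta>' where d: "d = Int2 s t \<delta>'" "\<delta>' \<in> homset (fibcat P f) as' as''"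
    by (rule P.homset_vertE) (auto simp: c)
  show ?thesis
    using functor_Cmp[OF mapfib_functor[OF f] \<delta> d(2)] by (simp add: c d)
qed

lemma integ_map_two_functor: "two_functor (integ P) (integ Q) (integ_map F)"
  unfolding two_functor_def
proof (intro conjI)
  have 0: "T0 (integ_map F) x \<in> Obj (integ Q)" if "x \<in> Obj (integ P)" for x
    using that functor_Obj[OF cat_functor] by auto
  show "is_functor (integ P) (integ Q) (T0 (integ_map F)) (T1 (integ_map F))"
    by (rule is_functorI) (use 0 integ_map_Idn in \<open>auto simp: homset_def integ_map_arrow intro!: integ_map_comp simp del: integ_simps(1,5)\<close>)
  show "is_functor (vert (integ P)) (vert (integ Q)) (T1 (integ_map F)) (T2 (integ_map F))"
  proof (rule is_functorI)
    show "T2 (integ_map F) (Cmp (vert (integ P)) d c) = Cmp (vert (integ Q)) (T2 (integ_map F) d) (T2 (integ_map F) c)"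
      if "c \<in> homset (vert (integ P)) r s" "d \<in> homset (vert (integ P)) s t" for c d r s t
      using integ_map_VCmp[OF that] by simp
  qed (use integ_map_Idn2 in \<open>auto simp: homset_def integ_map_arrow integ_map_cell\<close>)
  show "is_functor (horiz (integ P)) (horiz (integ Q)) (T0 (integ_map F)) (T2 (integ_map F))"
  proof (rule is_functorI)
    fix x assume x: "x \<in> Obj (horiz (integ P))"
    then have x': "x \<in> Obj (integ P)" by simp
    show "T0 (integ_map F) x \<in> Obj (horiz (integ Q))" using 0[OF x'] by simp
    have "Idn (integ P) x \<in> int_arrows P"
      using homsetD(1)[OF Idn_homset[OF P.category_integ x']] by simp
    then show "T2 (integ_map F) (Idn (horiz (integ P)) x) = Idn (horiz (integ Q)) (T0 (integ_map F) x)"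
      unfolding horiz_simps by (simp only: integ_map_Idn2 integ_map_Idn[OF x'])
  next
    fix c x y assume "c \<in> homset (horiz (integ P)) x y"
    then show "T2 (integ_map F) c \<in> homset (horiz (integ Q)) (T0 (integ_map F) x) (T0 (integ_map F) y)"
      by (auto simp: homset_def integ_map_cell)
  next
    fix c d x y z assume "c \<in> homset (horiz (integ P)) x y" "d \<in> homset (horiz (integ P)) y z"
    then show "T2 (integ_map F) (Cmp (horiz (integ P)) d c) =
        Cmp (horiz (integ Q)) (T2 (integ_map F) d) (T2 (integ_map F) c)"
      by (auto simp: homset_def intro!: integ_map_HCmp)
  qed
qed

text \<open>The maps depend on the arity, but the arities inside a fiber are those of the whole map,
  so applying them commutes with cutting into blocks (\<open>block_mapfib\<close>).\<close>

lemma integ_map_fib_tri: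
  assumes t: "t \<in> lax_triangles (integ P) x"
  shows "int_fib_tri (map_tri (T1 (integ_map F)) (T2 (integ_map F)) t) = map (T1 (integ_map F)) (int_fib_tri t)"
proof -
  obtain n c where x: "x = (n, c)" by (cases x)
  have "d0 t \<in> int_arrows P" "trg1 (d0 t) = (n, c)"
    using t by (auto simp: lax_triangles_iff x)
  then obtain k b g bs \<beta> where "d0 t = Int1 (k, b) (n, c) g bs \<beta>" by (rule P.Arr_lslice_d0E)
  with t[unfolded x] obtain m a f as \<alpha> cs \<gamma> \<delta> where t_eq:
      "t = P.lax_tri (Int1 (m, a) (k, b) f as \<alpha>)
          (Int1 (m, a) (n, c) (ocomp g f) cs \<gamma>) (Int1 (k, b) (n, c) g bs \<beta>) \<delta>"
    and f: "osurj m k f" and g: "osurj k n g" and S: "Int1 (m, a) (k, b) f as \<alpha> \<in> int_arrows P"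
    by (rule P.lax_triangleE)
  have l: "length as = k"
    using S tup_length[OF f] by (auto simp: P.Int1_iff Obj_fibcat)
  show ?thesis
    using l osurjD(6)[OF g] osurjD(6)[OF osurj_ocomp[OF f g]]
    by (simp add: t_eq P.fib_tri Q.fib_tri nth_mapfib block_mapfib[OF f g])
qed

lemma integ_map_fib:
  assumes "x \<in> Obj (integ P)"
  shows "teq (lslice (integ P) x) (tcomp (Fib (integ Q) (T0 (integ_map F) x)) (slice_fun (integ_map F)))
    (tcomp (pow_fun (integ_map F)) (Fib (integ P) x))"
proof (rule teqI)
  obtain n c where x: "x = (n, c)" by (cases x)
  fix \<phi> assume "\<phi> \<in> Obj (lslice (integ P) x)"
  then have "\<phi> \<in> int_arrows P" "trg1 \<phi> = (n, c)" by (auto simp: x)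
  then obtain k b g bs \<beta> where "\<phi> = Int1 (k, b) (n, c) g bs \<beta>" "osurj k n g"
    by (rule P.Arr_lslice_d0E)
  then show "T0 (tcomp (Fib (integ Q) (T0 (integ_map F) x)) (slice_fun (integ_map F))) \<phi> =
      T0 (tcomp (pow_fun (integ_map F)) (Fib (integ P) x)) \<phi>"
    using osurjD(6) by (simp add: nth_mapfib)
next
  fix t assume "t \<in> Arr (lslice (integ P) x)"
  then show "T1 (tcomp (Fib (integ Q) (T0 (integ_map F) x)) (slice_fun (integ_map F))) t =
      T1 (tcomp (pow_fun (integ_map F)) (Fib (integ P) x)) t"
    by (simp add: integ_map_fib_tri)
next
  obtain n c where x: "x = (n, c)" by (cases x)
  fix \<tau> assume \<tau>: "\<tau> \<in> Cell (lslice (integ P) x)"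
  note L = \<tau>[unfolded Cell_lslice]
  have "d0 (src_tri \<tau>) \<in> int_arrows P" "trg1 (d0 (src_tri \<tau>)) = (n, c)"
    using L by (auto simp: lax_triangles_iff x)
  then obtain k b g bs \<beta> where d0: "d0 (src_tri \<tau>) = Int1 (k, b) (n, c) g bs \<beta>"
    by (rule P.Arr_lslice_d0E)
  from \<tau>[unfolded x] d0 obtain m a f as \<alpha> as' \<alpha>' \<xi> where f: "osurj m k f" and g: "osurj k n g"
    and d2: "d2 (src_tri \<tau>) = Int1 (m, a) (k, b) f as \<alpha>"
    and c\<tau>: "cell_tri \<tau> = Int2 (Int1 (m, a) (k, b) f as \<alpha>) (Int1 (m, a) (k, b) f as' \<alpha>') \<xi>"
    and \<xi>: "\<xi> \<in> homset (fibcat P f) as as'"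
    by (rule P.slice_cellE) (metis tri.sel(1))
  have i: "imap (int_fib_tri (src_tri \<tau>) ! i) = induced g f i" if "i < n" for i
    using that d0 d2 by (simp add: int_fib_tri_def)
  have ft: "int_fib_tri (map_tri (T1 (integ_map F)) (T2 (integ_map F)) (src_tri \<tau>)) = map (T1 (integ_map F)) (int_fib_tri (src_tri \<tau>))"
    "int_fib_tri (map_tri (T1 (integ_map F)) (T2 (integ_map F)) (trg_tri \<tau>)) = map (T1 (integ_map F)) (int_fib_tri (trg_tri \<tau>))"
    using L by (auto intro: integ_map_fib_tri)
  have d0t: "d0 (trg_tri \<tau>) = Int1 (k, b) (n, c) g bs \<beta>"
    using L d0 by metis
  have ll: "length (int_fib_tri (src_tri \<tau>)) = n" "length (int_fib_tri (trg_tri \<tau>)) = n"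
    using d0 d0t by (simp_all add: P.length_fib_tri)
  show "T2 (tcomp (Fib (integ Q) (T0 (integ_map F) x)) (slice_fun (integ_map F))) \<tau> =
      T2 (tcomp (pow_fun (integ_map F)) (Fib (integ P) x)) \<tau>"
    using ll P.homset_fibcat_length(1)[OF f \<xi>]
    by (simp add: tri2.map_sel tri.map_sel ft d0 c\<tau> block_mapfib[OF f g] i)
qed

lemma integ_map_Lift:
  assumes "lift_data (integ P) g b bs"
  shows "T1 (integ_map F) (Lift (integ P) g b bs) =
    Lift (integ Q) g (T0 (integ_map F) b) (map (T0 (integ_map F)) bs)"
proof -
  obtain n c where b: "b = (n, c)" by (cases b)
  note L = P.lift_dataD[OF assms[unfolded b]]
  have m: "map snd (map (T0 (integ_map F)) bs) = mapfib (O0 F) g (map snd bs)"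
  proof (rule nth_equalityI)
    fix i assume "i < length (map snd (map (T0 (integ_map F)) bs))"
    then have i: "i < n" using L(4) by simp
    \<comment> \<open>The arity recorded in the object \<open>bs ! i\<close> is the one that
      \<open>mapfib\<close> reads off from \<open>g\<close>; this equality is part of the lifting
      data.\<close>
    then have "bs ! i = (psize g i, snd (bs ! i))" using L(5) by (simp add: prod_eq_iff)
    then have "T0 (integ_map F) (bs ! i) = (psize g i, O0 F (psize g i) (snd (bs ! i)))"
      by (metis integ_map_simps(1))
    then show "map snd (map (T0 (integ_map F)) bs) ! i = mapfib (O0 F) g (map snd bs) ! i"
      using i L(4) osurjD(6)[OF L(1)] by (simp add: nth_mapfib)
  qed (use L(4) osurjD(6)[OF L(1)] in simp)
  have "mu0 P g c (map snd bs) \<in> Obj (Cat P (length g))"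
    using P.ob.mu_closed[OF L(1,2)] L(3) by (simp add: Obj_fibcat)
  then show ?thesis
    using map_mu0[OF L(1-3)] functor_Idn[OF cat_functor[OF osurjD(1)[OF L(1)]]]
    unfolding b integ_simps integ_map_simps m by simp
qed

lemma sfib_morphism_integ_map: "sfib_morphism (integ P) (integ Q) (integ_map F)"
proof (rule sfib_morphismI)
  show "teq (integ P) (tcomp (Card (integ Q)) (integ_map F)) (Card (integ P))"
    by (rule teqI) auto
qed (use integ_map_two_functor integ_map_fib integ_map_Lift map_unit in simp_all)

end

section \<open>The category of operads\<close>

lemma operad_morphism_cong:
  assumes P: "operad P" and F: "operad_morphism P Q F"
    and 0: "\<And>n a. 1 \<le> n \<Longrightarrow> a \<in> Obj (Cat P n) \<Longrightarrow> O0 F n a = O0 G n a"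
    and 1: "\<And>n f. 1 \<le> n \<Longrightarrow> f \<in> Arr (Cat P n) \<Longrightarrow> O1 F n f = O1 G n f"
  shows "operad_morphism P Q G"
proof -
  interpret oper P by unfold_locales (rule P)
  show ?thesis
    unfolding operad_morphism_def
  proof (intro conjI allI impI ballI)
    show "is_functor (Cat P n) (Cat Q n) (O0 G n) (O1 G n)" if "1 \<le> n" for n
      using F that 0 1 unfolding operad_morphism_def by (blast intro: is_functor_cong[OF category_Cat])
    show "O0 G 1 (unit P) = unit Q"
      using F 0[of 1 "unit P"] ob.e_closed by (simp add: operad_morphism_def)
    fix k n g assume g: "osurj k n g"
    note kn = osurjD(1,2)[OF g]
    show "O0 G k (mu0 P g c bs) = mu0 Q g (O0 G n c) (mapfib (O0 G) g bs)"
      if c: "c \<in> Obj (Cat P n)" and bs: "bs \<in> Obj (fibcat P g)" for c bs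
    proof -
      have "mapfib (O0 F) g bs = mapfib (O0 G) g bs"
        using bs by (intro mapfib_cong[OF g _ 0]) (auto simp: Obj_fibcat)
      then show ?thesis
        using F g c bs ob.mu_closed[OF g c] kn by (simp add: operad_morphism_def 0[symmetric] Obj_fibcat)
    qed
    show "O1 G k (mu1 P g c bs) = mu1 Q g (O1 G n c) (mapfib (O1 G) g bs)"
      if c: "c \<in> Arr (Cat P n)" and bs: "bs \<in> Arr (fibcat P g)" for c bs
    proof -
      have "mapfib (O1 F) g bs = mapfib (O1 G) g bs"
        using bs by (intro mapfib_cong[OF g _ 1]) (auto simp: Arr_fibcat)
      then show ?thesis
        using F g c bs ar.mu_closed[OF g c] kn by (simp add: operad_morphism_def 1[symmetric] Arr_fibcat)
    qed
  qed
qed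

lemma oprestrict_sel:
  "1 \<le> n \<Longrightarrow> a \<in> Obj (Cat P n) \<Longrightarrow> O0 (oprestrict P F) n a = O0 F n a"
  "1 \<le> n \<Longrightarrow> f \<in> Arr (Cat P n) \<Longrightarrow> O1 (oprestrict P F) n f = O1 F n f"
  by (simp_all add: oprestrict_def)

text \<open>In arity 0 a restricted family is undefined everywhere, so equality of restrictions
  compares only the arities that occur in an operad.\<close>

lemma oprestrict_eq_iff:
  "oprestrict P F = oprestrict P G \<longleftrightarrow>
    (\<forall>n\<ge>1. (\<forall>a\<in>Obj (Cat P n). O0 F n a = O0 G n a) \<and> (\<forall>f\<in>Arr (Cat P n). O1 F n f = O1 G n f))"
proof
  assume "oprestrict P F = oprestrict P G"
  then show "\<forall>n\<ge>1. (\<forall>a\<in>Obj (Cat P n). O0 F n a = O0 G n a) \<and> (\<forall>f\<in>Arr (Cat P n). O1 F n f = O1 G n f)"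
    using oprestrict_sel by metis
qed (auto simp: oprestrict_def fun_eq_iff restrict_def)

lemma oprestrict_idem [simp]: "oprestrict P (oprestrict P F) = oprestrict P F"
  by (simp add: oprestrict_eq_iff oprestrict_sel)

lemma operad_morphism_restrict:
  "operad P \<Longrightarrow> operad_morphism P Q F \<Longrightarrow> operad_morphism P Q (oprestrict P F)"
  by (erule operad_morphism_cong) (simp_all add: oprestrict_sel)

lemma operad_morphism_id:
  assumes "operad P" shows "operad_morphism P P opid"
proof -
  interpret oper P by unfold_locales (rule assms)
  show ?thesis
    unfolding operad_morphism_def
    using is_functor_id by (auto simp: opid_def mapfib_id Obj_fibcat Arr_fibcat tup_def)
qed

lemma opcomp_simps [simp]:
  "O0 (opcomp G F) n a = O0 G n (O0 F n a)" "O1 (opcomp G F) n f = O1 G n (O1 F n f)"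
  by (simp_all add: opcomp_def)

lemma operad_morphism_comp:
  assumes "operad P" "operad Q" "operad R" "operad_morphism P Q F" "operad_morphism Q R G"
  shows "operad_morphism P R (opcomp G F)"
proof -
  interpret F: operad_mor P Q F by unfold_locales (use assms in auto)
  interpret G: operad_mor Q R G by unfold_locales (use assms in auto)
  have m: "mapfib (O0 (opcomp G F)) g xs = mapfib (O0 G) g (mapfib (O0 F) g xs)"
    "mapfib (O1 (opcomp G F)) g ys = mapfib (O1 G) g (mapfib (O1 F) g ys)" for g xs ys
    by (simp_all add: opcomp_def mapfib_comp)
  show ?thesis
    unfolding operad_morphism_def
  proof (intro conjI allI impI ballI)
    show "is_functor (Cat P n) (Cat R n) (O0 (opcomp G F) n) (O1 (opcomp G F) n)" if "1 \<le> n" for n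
      using is_functor_comp[OF F.cat_functor[OF that] G.cat_functor[OF that]] by (simp add: opcomp_def)
    show "O0 (opcomp G F) 1 (unit P) = unit R"
      using F.map_unit G.map_unit by simp
    fix k n g assume g: "osurj k n g"
    note Fn = F.cat_functor[OF osurjD(2)[OF g]] and Ff = F.mapfib_functor[OF g]
    show "O0 (opcomp G F) k (mu0 P g c bs) = mu0 R g (O0 (opcomp G F) n c) (mapfib (O0 (opcomp G F)) g bs)"
      if c: "c \<in> Obj (Cat P n)" and bs: "bs \<in> Obj (fibcat P g)" for c bs
      using F.map_mu0[OF g c bs] G.map_mu0[OF g functor_Obj[OF Fn c] functor_Obj[OF Ff bs]] by (simp add: m)
    show "O1 (opcomp G F) k (mu1 P g c bs) = mu1 R g (O1 (opcomp G F) n c) (mapfib (O1 (opcomp G F)) g bs)"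
      if c: "c \<in> Arr (Cat P n)" and bs: "bs \<in> Arr (fibcat P g)" for c bs
      using F.map_mu1[OF g c bs] G.map_mu1[OF g homsetD(1)[OF functor_homset[OF Fn Arr_homset[OF c]]]
          homsetD(1)[OF functor_homset[OF Ff Arr_homset[OF bs]]]] by (simp add: m)
  qed
qed

lemma Oper_simps [simp]:
  "Obj Oper = {P. operad P}"
  "(P, F, Q) \<in> Arr Oper \<longleftrightarrow> operad P \<and> operad Q \<and> operad_morphism P Q F \<and> oprestrict P F = F"
  "Src Oper (P, F, Q) = P" "Trg Oper (P, F, Q) = Q" "Idn Oper P = (P, oprestrict P opid, P)"
  "Cmp Oper (Q', G, R) (P, F, Q) = (P, oprestrict P (opcomp G F), R)"
  by (simp_all add: Oper_def)

lemma homset_Oper: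
  "A \<in> homset Oper P Q \<longleftrightarrow> (\<exists>F. A = (P, F, Q) \<and> operad P \<and> operad Q \<and>
    operad_morphism P Q F \<and> oprestrict P F = F)"
  by (cases A) (auto simp: homset_def)

lemma operad_morphism_carrier:
  assumes "operad_morphism P Q F" "1 \<le> n"
  shows "a \<in> Obj (Cat P n) \<Longrightarrow> O0 F n a \<in> Obj (Cat Q n)" "f \<in> Arr (Cat P n) \<Longrightarrow> O1 F n f \<in> Arr (Cat Q n)"
  using assms by (auto simp: operad_morphism_def is_functor_def)

lemma category_Oper: "category Oper"
proof (rule categoryI)
  fix A :: "('a, 'b) operad \<times> ('a, 'b, 'a, 'b) opmap \<times> ('a, 'b) operad"
  assume "A \<in> Arr Oper"
  then show "Src Oper A \<in> Obj Oper \<and> Trg Oper A \<in> Obj Oper" by (cases A) simp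
next
  fix P :: "('a, 'b) operad"
  assume "P \<in> Obj Oper"
  then show "Idn Oper P \<in> homset Oper P P"
    by (simp add: homset_Oper operad_morphism_restrict operad_morphism_id)
next
  fix A B and P Q R :: "('a, 'b) operad"
  assume "A \<in> homset Oper P Q" "B \<in> homset Oper Q R"
  then show "Cmp Oper B A \<in> homset Oper P R"
    by (auto simp: homset_Oper intro!: operad_morphism_restrict operad_morphism_comp)
next
  fix A and P Q :: "('a, 'b) operad"
  assume "A \<in> homset Oper P Q"
  then obtain F where F: "A = (P, F, Q)" "operad_morphism P Q F" "oprestrict P F = F"
    by (auto simp: homset_Oper)
  note K = operad_morphism_carrier[OF F(2)]
  have "oprestrict P (opcomp F (oprestrict P opid)) = oprestrict P F"
    "oprestrict P (opcomp (oprestrict Q opid) F) = oprestrict P F"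
    unfolding oprestrict_eq_iff by (simp_all add: oprestrict_sel opid_def K)
  then show "Cmp Oper A (Idn Oper P) = A" "Cmp Oper (Idn Oper Q) A = A" by (simp_all add: F)
next
  fix A B C and P Q R S :: "('a, 'b) operad"
  assume "A \<in> homset Oper P Q" "B \<in> homset Oper Q R" "C \<in> homset Oper R S"
  then obtain F G H where F: "A = (P, F, Q)" "operad_morphism P Q F" and G: "B = (Q, G, R)" and H: "C = (R, H, S)"
    by (auto simp: homset_Oper)
  note K = operad_morphism_carrier[OF F(2)]
  have "oprestrict P (opcomp H (oprestrict P (opcomp G F))) = oprestrict P (opcomp (oprestrict Q (opcomp H G)) F)"
    unfolding oprestrict_eq_iff by (simp add: oprestrict_sel K)
  then show "Cmp Oper C (Cmp Oper B A) = Cmp Oper (Cmp Oper C B) A"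
    by (simp add: F G H)
qed

section \<open>Full faithfulness\<close>

text \<open>A morphism \<open>\<alpha>\<close> from \<open>a'\<close> to \<open>a\<close> gives a 1-cell in the opposite direction.\<close>

definition unary_arrow :: "('o, 'm) operad \<Rightarrow> nat \<Rightarrow> 'm \<Rightarrow> ('o, 'm) int1" where
  "unary_arrow P n \<alpha> =
    Int1 (n, Trg (Cat P n) \<alpha>) (n, Src (Cat P n) \<alpha>) (oid n) (replicate n (unit P)) \<alpha>"

definition underlying_opmap ::
  "('o, 'm) operad \<Rightarrow>
   (nat \<times> 'o, ('o, 'm) int1, ('o, 'm) int2, nat \<times> 'p, ('p, 'n) int1, ('p, 'n) int2) twofun \<Rightarrow>
   ('o, 'm, 'p, 'n) opmap" where
  "underlying_opmap P G =
    \<lparr>O0 = (\<lambda>n a. snd (T0 G (n, a))), O1 = (\<lambda>n \<alpha>. iarr (T1 G (unary_arrow P n \<alpha>)))\<rparr>"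

context oper
begin

lemma unary_arrow_eq:
  "\<alpha> \<in> homset (Cat P n) a' a \<Longrightarrow>
    unary_arrow P n \<alpha> = Int1 (n, a) (n, a') (oid n) (replicate n (unit P)) \<alpha>"
  by (simp add: unary_arrow_def homset_def)

text \<open>Composing \<open>a'\<close> with units returns \<open>a'\<close>, so this is the source
  required of the last component.\<close>

lemma unary_arrow_iff:
  assumes "1 \<le> n" "a \<in> Obj (Cat P n)" "a' \<in> Obj (Cat P n)"
  shows "Int1 (n, a) (n, a') (oid n) (replicate n (unit P)) \<alpha> \<in> int_arrows P \<longleftrightarrow>
    \<alpha> \<in> homset (Cat P n) a' a"
  using assms osurj_oid[OF assms(1)] replicate_unit_fib[OF assms(1)] ob.mu_unit_right[OF assms(1,3)]
  by (simp add: Int1_iff)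

lemma unary_arrow_arrow:
  assumes n: "1 \<le> n" and \<alpha>: "\<alpha> \<in> Arr (Cat P n)"
  shows "unary_arrow P n \<alpha> \<in> int_arrows P"
  using homset_Obj[OF category_Cat[OF n] Arr_homset[OF \<alpha>]] Arr_homset[OF \<alpha>] unary_arrow_iff[OF n]
  by (simp add: unary_arrow_def)

lemma mu1_units:
  "1 \<le> n \<Longrightarrow> \<alpha> \<in> homset (Cat P n) x y \<Longrightarrow>
    mu1 P (oid n) \<alpha> (Idn (fibcat P (oid n)) (replicate n (unit P))) = \<alpha>"
  using ar.mu_unit_right by (simp add: Idn_fib_oid homset_def)

text \<open>The tuple of units is reproduced by \<open>mul\<close>, and whiskering with units does
  nothing; only the last components are composed, in the opposite order.\<close>

lemma unary_arrow_Cmp: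
  assumes n: "1 \<le> n" and \<alpha>: "\<alpha> \<in> homset (Cat P n) x y" and \<beta>: "\<beta> \<in> homset (Cat P n) y z"
  shows "unary_arrow P n (Cmp (Cat P n) \<beta> \<alpha>) = int_comp P (unary_arrow P n \<alpha>) (unary_arrow P n \<beta>)"
proof -
  note o = osurj_oid[OF n]
  have "mul (mu0 P) (oid n) (oid n) (replicate n (unit P)) (replicate n (unit P)) = replicate n (unit P)"
    using ob.mul_unit_right[OF o] replicate_unit_fib[OF n] by (simp add: Obj_fibcat)
  then show ?thesis
    using unary_arrow_eq[OF \<alpha>] unary_arrow_eq[OF \<beta>]
      unary_arrow_eq[OF Cmp_homset[OF category_Cat[OF n] \<alpha> \<beta>]]
    by (simp add: int_comp_Int1[OF o] ocomp_oid_right[OF o] mu1_units[OF n \<alpha>])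
qed

text \<open>The chosen lift in terms of a tuple of objects of the operad: each entry of
  \<open>bs\<close> has to be paired with its arity to become an object of
  \<open>integ P\<close>.\<close>

lemma lift_arrow:
  assumes g: "osurj k n g" and c: "c \<in> Obj (Cat P n)" and bs: "bs \<in> Obj (fibcat P g)"
  shows "Int1 (k, mu0 P g c bs) (n, c) g bs (Idn (Cat P k) (mu0 P g c bs)) \<in> int_arrows P"
    and "lift_data (integ P) g (n, c) (map (\<lambda>i. (psize g i, bs ! i)) [0..<n])"
    and "Lift (integ P) g (n, c) (map (\<lambda>i. (psize g i, bs ! i)) [0..<n]) =
      Int1 (k, mu0 P g c bs) (n, c) g bs (Idn (Cat P k) (mu0 P g c bs))"
proof -
  have l: "length bs = n" using tup_length[OF g] bs by (auto simp: Obj_fibcat)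
  have m: "map snd (map (\<lambda>i. (psize g i, bs ! i)) [0..<n]) = bs"
    by (intro nth_equalityI) (auto simp: l)
  show *: "Int1 (k, mu0 P g c bs) (n, c) g bs (Idn (Cat P k) (mu0 P g c bs)) \<in> int_arrows P"
    using cartesian_lift[OF g c bs] by (simp add: operadic_cartesian_def)
  show "Lift (integ P) g (n, c) (map (\<lambda>i. (psize g i, bs ! i)) [0..<n]) =
      Int1 (k, mu0 P g c bs) (n, c) g bs (Idn (Cat P k) (mu0 P g c bs))"
    unfolding integ_simps m by (simp add: osurjD(3)[OF g])
  show "lift_data (integ P) g (n, c) (map (\<lambda>i. (psize g i, bs ! i)) [0..<n])"
    using Int1_Obj_fib(1)[OF *] c g osurjD[OF g] by (auto simp: lift_data_def)
qed

lemma arrow_factor: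
  assumes s: "Int1 (m, a) (k, b) f as \<alpha> \<in> int_arrows P"
  shows "Int1 (m, a) (k, b) f as \<alpha> =
    int_comp P (Int1 (m, mu0 P f b as) (k, b) f as (Idn (Cat P m) (mu0 P f b as))) (unary_arrow P m \<alpha>)"
proof -
  have f: "osurj m k f" and as: "as \<in> Obj (fibcat P f)" and \<alpha>: "\<alpha> \<in> homset (Cat P m) (mu0 P f b as) a"
    using s by (auto simp: Int1_iff)
  note m = osurjD(1)[OF f]
  note C = category_Cat[OF m]
  have I: "Idn (Cat P m) (mu0 P f b as) \<in> homset (Cat P m) (mu0 P f b as) (mu0 P f b as)"
    using homset_Obj[OF C \<alpha>] Idn_homset[OF C] by simp
  show ?thesis
    using ob.mul_unit_right[OF f] as
    by (simp add: unary_arrow_eq[OF \<alpha>] int_comp_Int1[OF f] ocomp_oid_right[OF f] Obj_fibcat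
        mu1_units[OF m I] Cmp_Idn_right[OF C \<alpha>])
qed

text \<open>The lift contributes an identity and the left unit law leaves the tuple unchanged, so
  the last component is \<gamma> whiskered with \<open>bs\<close>. This makes \<mu> in its first
  variable visible through composition of 1-cells.\<close>

lemma arrow_postcomp:
  assumes g: "osurj k n g" and \<gamma>: "\<gamma> \<in> homset (Cat P n) x y" and bs: "bs \<in> Obj (fibcat P g)"
  shows "Int1 (k, mu0 P g y bs) (n, x) g bs (mu1 P g \<gamma> (Idn (fibcat P g) bs)) =
    int_comp P (unary_arrow P n \<gamma>) (Int1 (k, mu0 P g y bs) (n, y) g bs (Idn (Cat P k) (mu0 P g y bs)))"
proof -
  note n = osurjD(2)[OF g]
  note C = category_Cat[OF osurjD(1)[OF g]]
  show ?thesis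
    using ob.mul_unit_left[OF g] bs mu_homset[OF g \<gamma> Idn_fib_homset[OF g bs]]
    by (simp add: unary_arrow_eq[OF \<gamma>] int_comp_Int1[OF osurj_oid[OF n]] ocomp_oid_left[OF g] Obj_fibcat
        Cmp_Idn_left[OF C])
qed

text \<open>A 2-cell, read as a lax triangle over the target of its source, has unary 1-cells as fibers.\<close>

lemma cell_triangle:
  assumes c: "Int2 (Int1 (m, a) (k, b) f as \<alpha>) (Int1 (m, a) (k, b) f as' \<alpha>') \<delta> \<in> int_cells P"
  defines "t \<equiv> Tri (Idn (integ P) (m, a)) (Int1 (m, a) (k, b) f as' \<alpha>') (Int1 (m, a) (k, b) f as \<alpha>)
    (Int2 (Int1 (m, a) (k, b) f as \<alpha>) (Int1 (m, a) (k, b) f as' \<alpha>') \<delta>)"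
  shows "t \<in> lax_triangles (integ P) (k, b)"
    "int_fib_tri t = map (\<lambda>i. unary_arrow P (psize f i) (\<delta> ! i)) [0..<k]"
proof -
  have s: "Int1 (m, a) (k, b) f as \<alpha> \<in> int_arrows P" and t: "Int1 (m, a) (k, b) f as' \<alpha>' \<in> int_arrows P"
    and f: "osurj m k f" and \<delta>: "\<delta> \<in> homset (fibcat P f) as as'" and a: "a \<in> Obj (Cat P m)"
    using c by (auto simp: Int2_iff Int1_iff)
  have x: "(m, a) \<in> Obj (integ P)" using a osurjD(1)[OF f] by simp
  have I: "Idn (integ P) (m, a) \<in> int_arrows P"
    using homsetD(1)[OF Idn_homset[OF category_integ x]] by simp
  \<comment> \<open>The inner side is an identity, so the 2-cell starts at the composite required in
    a lax triangle.\<close>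
  have "int_comp P (Int1 (m, a) (k, b) f as \<alpha>) (Idn (integ P) (m, a)) = Int1 (m, a) (k, b) f as \<alpha>"
    using Cmp_Idn_right[OF category_integ, of "Int1 (m, a) (k, b) f as \<alpha>" "(m, a)" "(k, b)"] s
    by (simp add: homset_def)
  then show "t \<in> lax_triangles (integ P) (k, b)"
    using s t I c by (simp add: t_def lax_triangles_iff)
  show "int_fib_tri t = map (\<lambda>i. unary_arrow P (psize f i) (\<delta> ! i)) [0..<k]"
    using unary_arrow_eq[OF homset_fibcat_nth[OF f \<delta>]]
    by (auto simp: t_def fib_tri induced_oid_right[OF f] block_replicate[OF f])
qed

end

section \<open>Reconstruction of an operad morphism from a morphism of the integrations\<close>

locale integ_mor = P: oper P + Q: oper Q
  for P :: "('o, 'm) operad" and Q :: "('p, 'n) operad" +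
  fixes G :: "(nat \<times> 'o, ('o, 'm) int1, ('o, 'm) int2, nat \<times> 'p, ('p, 'n) int1, ('p, 'n) int2) twofun"
  assumes mor: "sfib_morphism (integ P) (integ Q) G"
begin

abbreviation "F0 \<equiv> O0 (underlying_opmap P G)"
abbreviation "F1 \<equiv> O1 (underlying_opmap P G)"

lemma F1_eq: "F1 n \<alpha> = iarr (T1 G (unary_arrow P n \<alpha>))"
  by (simp add: underlying_opmap_def)

lemmas carrier = two_functor_carrier[OF P.two_category_integ sfib_morphismD(1)[OF mor]]

lemmas mor_functor = two_functorD(1)[OF sfib_morphismD(1)[OF mor]]

lemma T0_eq: "1 \<le> n \<Longrightarrow> a \<in> Obj (Cat P n) \<Longrightarrow> T0 G (n, a) = (n, F0 n a)"
  using teqD(1)[OF sfib_morphismD(2)[OF mor], of "(n, a)"]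
  by (simp add: underlying_opmap_def prod_eq_iff)

lemma F0_Obj: "1 \<le> n \<Longrightarrow> a \<in> Obj (Cat P n) \<Longrightarrow> F0 n a \<in> Obj (Cat Q n)"
  using carrier(1)[of "(n, a)"] T0_eq[of n a] by simp

lemma F0_unit: "F0 1 (unit P) = unit Q"
  using sfib_morphismD(4)[OF mor, of "(1, unit P)"] P.ob.e_closed by (simp add: underlying_opmap_def)

text \<open>Only the last component of the image is left free: the ends come from functoriality, the
  surjection from preservation of cardinality, and the tuple from preservation of the fibers of the
  1-cell.\<close>

lemma T1_eq:
  assumes s: "Int1 (m, a) (k, b) f as \<alpha> \<in> int_arrows P"
  shows "T1 G (Int1 (m, a) (k, b) f as \<alpha>) =
    Int1 (m, F0 m a) (k, F0 k b) f (mapfib F0 f as) (iarr (T1 G (Int1 (m, a) (k, b) f as \<alpha>)))"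
proof -
  let ?s = "Int1 (m, a) (k, b) f as \<alpha>"
  have f: "osurj m k f" and a: "a \<in> Obj (Cat P m)" and b: "b \<in> Obj (Cat P k)" and as: "as \<in> Obj (fibcat P f)"
    using s by (auto simp: P.Int1_iff)
  have Gs: "T1 G ?s \<in> int_arrows Q" "src1 (T1 G ?s) = (m, F0 m a)" "trg1 (T1 G ?s) = (k, F0 k b)"
    using carrier(2-4)[of ?s] s T0_eq osurjD(1,2)[OF f] a b by simp_all
  have im: "imap (T1 G ?s) = f"
    using teqD(2)[OF sfib_morphismD(2)[OF mor], of ?s] s by simp
  have "(k, b) \<in> Obj (integ P)" using b osurjD(2)[OF f] by simp
  from teqD(1)[OF sfib_morphismD(3)[OF mor this], of ?s]
  have e: "map (\<lambda>i. (psize f i, iobs (T1 G ?s) ! i)) [0..<k] = map (T0 G) (map (\<lambda>i. (psize f i, as ! i)) [0..<k])"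
    using s Gs im by simp
  have "iobs (T1 G ?s) ! i = F0 (psize f i) (as ! i)" if "i < k" for i
    using arg_cong[OF e, of "\<lambda>xs. xs ! i"] that by (simp add: underlying_opmap_def) (metis snd_conv)
  moreover obtain bs \<beta> where "T1 G ?s = Int1 (m, F0 m a) (k, F0 k b) f bs \<beta>" "length bs = k"
    using Gs im by (auto elim!: Q.Int1E dest!: tup_length simp: Obj_fibcat)
  ultimately show ?thesis
    using osurjD(6)[OF f] by (auto intro!: nth_equalityI simp: nth_mapfib)
qed

lemma unary_eq:
  assumes n: "1 \<le> n" and \<alpha>: "\<alpha> \<in> homset (Cat P n) a' a"
  shows "T1 G (unary_arrow P n \<alpha>) = Int1 (n, F0 n a) (n, F0 n a') (oid n) (replicate n (unit Q)) (F1 n \<alpha>)"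
    and "F1 n \<alpha> \<in> homset (Cat Q n) (F0 n a') (F0 n a)"
proof -
  have a: "a \<in> Obj (Cat P n)" "a' \<in> Obj (Cat P n)"
    using homset_Obj[OF P.category_Cat[OF n] \<alpha>] by auto
  have s: "Int1 (n, a) (n, a') (oid n) (replicate n (unit P)) \<alpha> \<in> int_arrows P"
    using \<alpha> P.unary_arrow_iff[OF n a] by simp
  show *: "T1 G (unary_arrow P n \<alpha>) = Int1 (n, F0 n a) (n, F0 n a') (oid n) (replicate n (unit Q)) (F1 n \<alpha>)"
    using T1_eq[OF s] F0_unit
    by (simp add: P.unary_arrow_eq[OF \<alpha>] F1_eq mapfib_replicate[OF n])
  have "Int1 (n, F0 n a) (n, F0 n a') (oid n) (replicate n (unit Q)) (F1 n \<alpha>) \<in> int_arrows Q"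
    using carrier(2) s unfolding *[symmetric] by (simp add: P.unary_arrow_eq[OF \<alpha>])
  then show "F1 n \<alpha> \<in> homset (Cat Q n) (F0 n a') (F0 n a)"
    using Q.unary_arrow_iff[OF n F0_Obj F0_Obj, OF n a(1) n a(2)] by simp
qed

lemma unary_Q:
  assumes n: "1 \<le> n" and \<alpha>: "\<alpha> \<in> homset (Cat P n) a' a"
  shows "T1 G (unary_arrow P n \<alpha>) = unary_arrow Q n (F1 n \<alpha>)"
  using unary_eq[OF n \<alpha>] Q.unary_arrow_eq by simp

lemma T1_comp:
  assumes "s \<in> int_arrows P" "t \<in> int_arrows P" "src1 t = trg1 s"
  shows "T1 G (int_comp P t s) = int_comp Q (T1 G t) (T1 G s)"
  using functor_Cmp[OF mor_functor, of s "src1 s" "trg1 s" t "trg1 t"] assms by (simp add: homset_def)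

lemma F_functor:
  assumes n: "1 \<le> n" shows "is_functor (Cat P n) (Cat Q n) (F0 n) (F1 n)"
proof (rule is_functorI)
  show "F0 n a \<in> Obj (Cat Q n)" if "a \<in> Obj (Cat P n)" for a
    using n that by (rule F0_Obj)
  show "F1 n f \<in> homset (Cat Q n) (F0 n x) (F0 n y)" if "f \<in> homset (Cat P n) x y" for f x y
    using n that by (rule unary_eq(2))
  show "F1 n (Idn (Cat P n) a) = Idn (Cat Q n) (F0 n a)" if a: "a \<in> Obj (Cat P n)" for a
  proof -
    have "unary_arrow P n (Idn (Cat P n) a) = Idn (integ P) (n, a)"
      by (simp add: P.unary_arrow_eq[OF P.Idn_Cat_homset[OF n a]])
    moreover have "T1 G (Idn (integ P) (n, a)) = Idn (integ Q) (n, F0 n a)"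
      using functor_Idn[OF mor_functor, of "(n, a)"] T0_eq[OF n a] n a by simp
    ultimately show ?thesis by (simp add: F1_eq)
  qed
  show "F1 n (Cmp (Cat P n) g f) = Cmp (Cat Q n) (F1 n g) (F1 n f)"
    if f: "f \<in> homset (Cat P n) x y" and g: "g \<in> homset (Cat P n) y z" for f g x y z
  proof -
    \<comment> \<open>The order of composition is reversed on passing to 1-cells in \<open>P\<close>
      and reversed back in \<open>Q\<close>.\<close>
    have "T1 G (unary_arrow P n (Cmp (Cat P n) g f)) = int_comp Q (unary_arrow Q n (F1 n f)) (unary_arrow Q n (F1 n g))"
      using T1_comp[of "unary_arrow P n g" "unary_arrow P n f"] P.unary_arrow_arrow[OF n] f g
      by (simp add: P.unary_arrow_Cmp[OF n f g] unary_Q[OF n] homset_def)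
        (simp add: unary_arrow_def)
    also have "\<dots> = unary_arrow Q n (Cmp (Cat Q n) (F1 n g) (F1 n f))"
      using Q.unary_arrow_Cmp[OF n unary_eq(2)[OF n f] unary_eq(2)[OF n g]] by simp
    finally show ?thesis by (simp add: F1_eq unary_arrow_def)
  qed
qed

lemma mapfib_Obj:
  assumes "osurj m k f" "as \<in> Obj (fibcat P f)"
  shows "mapfib F0 f as \<in> Obj (fibcat Q f)"
  using assms by (auto simp: Obj_fibcat intro: tup_mapfib F0_Obj)

lemma T1_lift:
  assumes g: "osurj k n g" and c: "c \<in> Obj (Cat P n)" and bs: "bs \<in> Obj (fibcat P g)"
  shows "T1 G (Int1 (k, mu0 P g c bs) (n, c) g bs (Idn (Cat P k) (mu0 P g c bs))) =
    Int1 (k, mu0 Q g (F0 n c) (mapfib F0 g bs)) (n, F0 n c) g (mapfib F0 g bs)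
      (Idn (Cat Q k) (mu0 Q g (F0 n c) (mapfib F0 g bs)))"
proof -
  have l: "length bs = n" using tup_length[OF g] bs by (auto simp: Obj_fibcat)
  have m: "map snd (map (T0 G) (map (\<lambda>i. (psize g i, bs ! i)) [0..<n])) = mapfib F0 g bs"
    using osurjD(6)[OF g] by (intro nth_equalityI) (auto simp: nth_mapfib underlying_opmap_def)
  show ?thesis
    using sfib_morphismD(5)[OF mor P.lift_arrow(2)[OF g c bs]]
    unfolding P.lift_arrow(3)[OF g c bs]
    unfolding T0_eq[OF osurjD(2)[OF g] c] integ_simps m osurjD(3)[OF g] .
qed

text \<open>\<open>T1_eq\<close> and \<open>T1_lift\<close> describe the image of the same lift;
  comparing the sources in the two descriptions gives the claim.\<close>

lemma F0_mu:
  assumes g: "osurj k n g" and c: "c \<in> Obj (Cat P n)" and bs: "bs \<in> Obj (fibcat P g)"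
  shows "F0 k (mu0 P g c bs) = mu0 Q g (F0 n c) (mapfib F0 g bs)"
  using T1_eq[OF P.lift_arrow(1)[OF g c bs]] T1_lift[OF g c bs] by simp

lemma T1_integ_map:
  assumes "s \<in> int_arrows P" shows "T1 G s = T1 (integ_map (underlying_opmap P G)) s"
proof -
  obtain m a k b f as \<alpha> where s: "s = Int1 (m, a) (k, b) f as \<alpha>" and b: "b \<in> Obj (Cat P k)"
    and f: "osurj m k f" and as: "as \<in> Obj (fibcat P f)" and \<alpha>: "\<alpha> \<in> homset (Cat P m) (mu0 P f b as) a"
    using assms by (rule P.Int1E)
  note m = osurjD(1)[OF f]
  have "T1 G s = int_comp Q (T1 G (Int1 (m, mu0 P f b as) (k, b) f as (Idn (Cat P m) (mu0 P f b as))))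
      (T1 G (unary_arrow P m \<alpha>))"
    using T1_comp[OF P.unary_arrow_arrow[OF m homsetD(1)[OF \<alpha>]] P.lift_arrow(1)[OF f b as]]
      P.arrow_factor[OF assms[unfolded s]] by (simp add: s P.unary_arrow_eq[OF \<alpha>])
  also have "\<dots> = int_comp Q (Int1 (m, mu0 Q f (F0 k b) (mapfib F0 f as)) (k, F0 k b) f (mapfib F0 f as)
      (Idn (Cat Q m) (mu0 Q f (F0 k b) (mapfib F0 f as)))) (unary_arrow Q m (F1 m \<alpha>))"
    by (simp add: T1_lift[OF f b as] unary_Q[OF m \<alpha>])
  \<comment> \<open>The factorization of 1-cells is now used in \<open>Q\<close>, from right to
    left. It requires \<open>F1 m \<alpha>\<close> to start at the composite of the images, which
    \<open>F0_mu\<close> provides.\<close>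
  also have "\<dots> = Int1 (m, F0 m a) (k, F0 k b) f (mapfib F0 f as) (F1 m \<alpha>)"
    using unary_eq(2)[OF m \<alpha>] F0_mu[OF f b as] f mapfib_Obj[OF f as] F0_Obj[OF osurjD(2)[OF f] b]
      homset_Obj[OF Q.category_Cat[OF m]]
    by (intro Q.arrow_factor[symmetric]) (simp add: Q.Int1_iff)
  finally show ?thesis by (simp add: s)
qed

lemma T2_integ_map:
  assumes c: "c \<in> int_cells P" shows "T2 G c = T2 (integ_map (underlying_opmap P G)) c"
proof -
  obtain m a k b where "src1 (src2 c) = (m, a)" "trg1 (src2 c) = (k, b)" by (metis surj_pair)
  with c obtain f as \<alpha> as' \<alpha>' \<delta> where
    c_eq: "c = Int2 (Int1 (m, a) (k, b) f as \<alpha>) (Int1 (m, a) (k, b) f as' \<alpha>') \<delta>"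
    and b: "b \<in> Obj (Cat P k)" and f: "osurj m k f" and \<delta>: "\<delta> \<in> homset (fibcat P f) as as'"
    by (rule P.Int2E)
  let ?t = "Tri (Idn (integ P) (m, a)) (Int1 (m, a) (k, b) f as' \<alpha>') (Int1 (m, a) (k, b) f as \<alpha>) c"
  note t = P.cell_triangle[OF c[unfolded c_eq], folded c_eq]
  have arr: "Int1 (m, a) (k, b) f as \<alpha> \<in> int_arrows P" "Int1 (m, a) (k, b) f as' \<alpha>' \<in> int_arrows P"
    using P.Int2_arrows[OF c] by (auto simp: c_eq)
  have Gc: "T2 G c \<in> int_cells Q" "src2 (T2 G c) = T1 G (src2 c)" "trg2 (T2 G c) = T1 G (trg2 c)"
    using carrier(5-7)[of c] c by simp_all
  have "(k, b) \<in> Obj (integ P)" using b osurjD(2)[OF f] by simp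
  from teqD(2)[OF sfib_morphismD(3)[OF mor this], of ?t]
  have "int_fib_tri (map_tri (T1 G) (T2 G) ?t) = map (T1 G) (int_fib_tri ?t)"
    using t(1) by simp
  \<comment> \<open>The last component of the \<open>i\<close>-th fiber is the \<open>i\<close>-th
    component of the 2-cell, so comparing last components recovers the components of the
    image.\<close>
  from arg_cong[OF this[unfolded t(2)], of "map iarr"]
  have e: "map iarr (int_fib_tri (map_tri (T1 G) (T2 G) ?t)) = map (\<lambda>i. F1 (psize f i) (\<delta> ! i)) [0..<k]"
    by (simp only: map_map comp_def F1_eq)
  have "icomps (T2 G c) ! i = F1 (psize f i) (\<delta> ! i)" if "i < k" for i
    using arg_cong[OF e, of "\<lambda>xs. xs ! i"] that T1_integ_map[OF arr(1)] by (simp add: int_fib_tri_def)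
  \<comment> \<open>The fibers show the components one at a time but not their number, since
    \<open>int_fib_tri\<close> always lists \<open>k\<close> entries; the length comes from
    membership in \<open>int_cells Q\<close>.\<close>
  moreover have "length (icomps (T2 G c)) = k"
  proof -
    have "src1 (src2 (T2 G c)) = (m, F0 m a)" "trg1 (src2 (T2 G c)) = (k, F0 k b)"
      using Gc T1_integ_map[OF arr(1)] by (simp_all add: c_eq)
    with Gc(1) obtain f' xs ys \<delta>' where "osurj m k f'" "\<delta>' \<in> homset (fibcat Q f') xs ys" "icomps (T2 G c) = \<delta>'"
      by (rule Q.Int2E) (metis int2.sel(3))
    then show ?thesis using Q.homset_fibcat_length by blast
  qed
  ultimately have "icomps (T2 G c) = mapfib F1 f \<delta>"
    using osurjD(6)[OF f] by (intro nth_equalityI) (auto simp: nth_mapfib)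
  then have "T2 G c = Int2 (T1 G (Int1 (m, a) (k, b) f as \<alpha>)) (T1 G (Int1 (m, a) (k, b) f as' \<alpha>')) (mapfib F1 f \<delta>)"
    using Gc by (cases "T2 G c") (simp add: c_eq)
  then show ?thesis
    unfolding T1_integ_map[OF arr(1)] T1_integ_map[OF arr(2)] by (simp add: c_eq)
qed

lemma mapfib_homset:
  assumes f: "osurj m k f" and \<delta>: "\<delta> \<in> homset (fibcat P f) as as'"
  shows "mapfib F1 f \<delta> \<in> homset (fibcat Q f) (mapfib F0 f as) (mapfib F0 f as')"
  using \<delta> osurjD(6)[OF f] functor_homset[OF F_functor[OF psize_pos[OF f]]]
  by (auto simp: homset_fibcat nth_mapfib)

text \<open>\<delta> becomes a 2-cell into a lift once the last component of its source is taken to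
  be \<open>\<mu>(1, \<delta>)\<close>, the one value for which the 2-cell condition holds. The
  condition satisfied by the image 2-cell is the claim, up to an identity.\<close>

lemma F1_mu_Idn_left:
  assumes g: "osurj k n g" and x: "x \<in> Obj (Cat P n)" and \<delta>: "\<delta> \<in> homset (fibcat P g) bs bs'"
  shows "F1 k (mu1 P g (Idn (Cat P n) x) \<delta>) = mu1 Q g (Idn (Cat Q n) (F0 n x)) (mapfib F1 g \<delta>)"
proof -
  note k = osurjD(1)[OF g] and n = osurjD(2)[OF g]
  have bs: "bs \<in> Obj (fibcat P g)" "bs' \<in> Obj (fibcat P g)"
    using homset_Obj[OF P.category_fibcat[OF g] \<delta>] by auto
  let ?y = "mu0 P g x bs'"
  have y: "?y \<in> Obj (Cat P k)"
    using P.ob.mu_closed[OF g x] bs by (simp add: Obj_fibcat)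
  note \<delta>' = P.mu_homset[OF g P.Idn_Cat_homset[OF n x] \<delta>]
  let ?s = "Int1 (k, ?y) (n, x) g bs (mu1 P g (Idn (Cat P n) x) \<delta>)"
  let ?t = "Int1 (k, ?y) (n, x) g bs' (Idn (Cat P k) ?y)"
  have "Int2 ?s ?t \<delta> \<in> int_cells P"
    using P.lift_arrow(1)[OF g x bs(2)] x y g bs \<delta> \<delta>' Cmp_Idn_left[OF P.category_Cat[OF k] \<delta>']
    by (simp add: P.Int2_iff P.Int1_iff)
  then have "T2 (integ_map (underlying_opmap P G)) (Int2 ?s ?t \<delta>) \<in> int_cells Q"
    using T2_integ_map carrier(5)[of "Int2 ?s ?t \<delta>"] by simp
  then have "Cmp (Cat Q k) (F1 k (Idn (Cat P k) ?y)) (mu1 Q g (Idn (Cat Q n) (F0 n x)) (mapfib F1 g \<delta>)) =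
      F1 k (mu1 P g (Idn (Cat P n) x) \<delta>)"
    by (simp add: Q.Int2_iff)
  moreover have "F1 k (Idn (Cat P k) ?y) = Idn (Cat Q k) (mu0 Q g (F0 n x) (mapfib F0 g bs'))"
    using functor_Idn[OF F_functor[OF k] y] F0_mu[OF g x bs(2)] by simp
  ultimately show ?thesis
    using Cmp_Idn_left[OF Q.category_Cat[OF k]
        Q.mu_homset[OF g Q.Idn_Cat_homset[OF n F0_Obj[OF n x]] mapfib_homset[OF g \<delta>]]] by simp
qed

text \<open>The image of one 1-cell is computed in two ways: through \<open>integ_map\<close> its
  last component is the left-hand side; as the image of a unary 1-cell after a lift, it has the
  right-hand side as last component.\<close>

lemma F1_mu_Idn_right:
  assumes g: "osurj k n g" and \<gamma>: "\<gamma> \<in> homset (Cat P n) x y" and bs: "bs \<in> Obj (fibcat P g)"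
  shows "F1 k (mu1 P g \<gamma> (Idn (fibcat P g) bs)) = mu1 Q g (F1 n \<gamma>) (Idn (fibcat Q g) (mapfib F0 g bs))"
proof -
  note k = osurjD(1)[OF g] and n = osurjD(2)[OF g]
  have xy: "x \<in> Obj (Cat P n)" "y \<in> Obj (Cat P n)"
    using homset_Obj[OF P.category_Cat[OF n] \<gamma>] by auto
  let ?s = "Int1 (k, mu0 P g y bs) (n, x) g bs (mu1 P g \<gamma> (Idn (fibcat P g) bs))"
  let ?l = "Int1 (k, mu0 P g y bs) (n, y) g bs (Idn (Cat P k) (mu0 P g y bs))"
  note u = P.unary_arrow_arrow[OF n homsetD(1)[OF \<gamma>]] and l = P.lift_arrow(1)[OF g xy(2) bs]
  have e: "src1 (unary_arrow P n \<gamma>) = trg1 ?l" by (simp add: P.unary_arrow_eq[OF \<gamma>])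
  note p = P.arrow_postcomp[OF g \<gamma> bs]
  have "T1 (integ_map (underlying_opmap P G)) ?s = T1 G ?s"
    unfolding p using T1_integ_map[OF P.int_comp_arrow[OF l u e]] by simp
  also have "\<dots> = int_comp Q (T1 G (unary_arrow P n \<gamma>)) (T1 G ?l)"
    unfolding p by (rule T1_comp[OF l u e])
  also have "\<dots> = Int1 (k, mu0 Q g (F0 n y) (mapfib F0 g bs)) (n, F0 n x) g (mapfib F0 g bs)
      (mu1 Q g (F1 n \<gamma>) (Idn (fibcat Q g) (mapfib F0 g bs)))"
    unfolding unary_Q[OF n \<gamma>] T1_lift[OF g xy(2) bs]
    using Q.arrow_postcomp[OF g unary_eq(2)[OF n \<gamma>] mapfib_Obj[OF g bs]] by simp
  finally show ?thesis by simp
qed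

lemma operad_morphism_underlying: "operad_morphism P Q (underlying_opmap P G)"
  unfolding operad_morphism_def
proof (intro conjI allI impI ballI)
  fix k n g c bs assume g: "osurj k n g" and c: "c \<in> Arr (Cat P n)" and bs: "bs \<in> Arr (fibcat P g)"
  note k = osurjD(1)[OF g] and n = osurjD(2)[OF g]
  obtain x y where c: "c \<in> homset (Cat P n) x y" using Arr_homset[OF c] by blast
  obtain xs ys where bs: "bs \<in> homset (fibcat P g) xs ys" using Arr_homset[OF bs] by blast
  have x: "x \<in> Obj (Cat P n)" and ys: "ys \<in> Obj (fibcat P g)"
    using homset_Obj[OF P.category_Cat[OF n] c] homset_Obj[OF P.category_fibcat[OF g] bs] by auto
  have "F1 k (mu1 P g c bs) = Cmp (Cat Q k) (F1 k (mu1 P g c (Idn (fibcat P g) ys))) (F1 k (mu1 P g (Idn (Cat P n) x) bs))"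
    using functor_Cmp[OF F_functor[OF k] P.mu_homset[OF g P.Idn_Cat_homset[OF n x] bs]
        P.mu_homset[OF g c P.Idn_fib_homset[OF g ys]]] P.mu_split(1)[OF g c bs] by simp
  also have "\<dots> = mu1 Q g (F1 n c) (mapfib F1 g bs)"
    using Q.mu_split(1)[OF g unary_eq(2)[OF n c] mapfib_homset[OF g bs]]
    by (simp add: F1_mu_Idn_left[OF g x bs] F1_mu_Idn_right[OF g c ys])
  finally show "F1 k (mu1 P g c bs) = mu1 Q g (F1 n c) (mapfib F1 g bs)" .
qed (use F_functor F0_unit F0_mu in auto)

lemma teq_underlying: "teq (integ P) (integ_map (underlying_opmap P G)) G"
  using T0_eq T1_integ_map T2_integ_map by (intro teqI) auto

end

section \<open>Functoriality, faithfulness and fullness of integration\<close>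

lemma integ_map_cong:
  assumes "operad P"
    and 0: "\<And>n a. 1 \<le> n \<Longrightarrow> a \<in> Obj (Cat P n) \<Longrightarrow> O0 F n a = O0 G n a"
    and 1: "\<And>n f. 1 \<le> n \<Longrightarrow> f \<in> Arr (Cat P n) \<Longrightarrow> O1 F n f = O1 G n f"
  shows "teq (integ P) (integ_map F) (integ_map G)"
proof (rule teqI)
  interpret oper P by unfold_locales (rule assms)
  show T1: "T1 (integ_map F) s = T1 (integ_map G) s" if s: "s \<in> Arr (integ P)" for s
  proof -
    have "s \<in> int_arrows P" using s by simp
    then obtain m a k b f as \<alpha> where s: "s = Int1 (m, a) (k, b) f as \<alpha>" and *: "a \<in> Obj (Cat P m)"
      "b \<in> Obj (Cat P k)" "osurj m k f" "as \<in> Obj (fibcat P f)" "\<alpha> \<in> homset (Cat P m) (mu0 P f b as) a"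
      by (rule Int1E)
    have "mapfib (O0 F) f as = mapfib (O0 G) f as"
      using * 0 by (intro mapfib_cong[OF *(3)]) (auto simp: Obj_fibcat)
    then show ?thesis
      using 0[OF osurjD(1)[OF *(3)] *(1)] 0[OF osurjD(2)[OF *(3)] *(2)] 1[OF osurjD(1)[OF *(3)] homsetD(1)[OF *(5)]]
      by (simp add: s)
  qed
  show "T2 (integ_map F) c = T2 (integ_map G) c" if c: "c \<in> Cell (integ P)" for c
  proof -
    have c: "c \<in> int_cells P" using c by simp
    obtain m a k b where "src1 (src2 c) = (m, a)" "trg1 (src2 c) = (k, b)" by (metis surj_pair)
    with c obtain f as \<alpha> as' \<alpha>' \<delta> where
      c_eq: "c = Int2 (Int1 (m, a) (k, b) f as \<alpha>) (Int1 (m, a) (k, b) f as' \<alpha>') \<delta>"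
      and f: "osurj m k f" and \<delta>: "\<delta> \<in> homset (fibcat P f) as as'"
      by (rule Int2E)
    have "mapfib (O1 F) f \<delta> = mapfib (O1 G) f \<delta>"
      using homset_fibcat_tup(1)[OF f \<delta>] 1 by (rule mapfib_cong[OF f])
    then show ?thesis
      using T1[of "src2 c"] T1[of "trg2 c"] Int2_arrows(1,2)[OF c]
      by (simp add: c_eq del: integ_map_simps(2))
  qed
qed (use 0 in auto)

lemma integ_map_opid: "operad P \<Longrightarrow> teq (integ P) (integ_map opid) tid"
proof -
  assume "operad P"
  then interpret oper P by unfold_locales
  have 1: "T1 (integ_map opid) s = s" if s: "s \<in> int_arrows P" for s
    using s by (auto elim!: Int1E simp: opid_def mapfib_id Obj_fibcat tup_def)
  have "T2 (integ_map opid) c = c" if c: "c \<in> int_cells P" for c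
  proof -
    obtain m a k b where "src1 (src2 c) = (m, a)" "trg1 (src2 c) = (k, b)" by (metis surj_pair)
    with c obtain f as \<alpha> as' \<alpha>' \<delta> where
      c_eq: "c = Int2 (Int1 (m, a) (k, b) f as \<alpha>) (Int1 (m, a) (k, b) f as' \<alpha>') \<delta>"
      and \<delta>: "\<delta> \<in> homset (fibcat P f) as as'"
      by (rule Int2E)
    then have "mapfib (O1 opid) f \<delta> = \<delta>" by (simp add: opid_def mapfib_id homset_fibcat)
    then show ?thesis
      using 1 Int2_arrows(1,2)[OF c] by (simp add: c_eq del: integ_map_simps(2))
  qed
  then show "teq (integ P) (integ_map opid) tid"
    using 1 by (intro teqI) (auto simp: tid_def, auto simp: opid_def)
qed

text \<open>An equality on the nose rather than only on carriers: both sides apply the maps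
  component by component, with the same arities.\<close>

lemma integ_map_opcomp: "integ_map (opcomp G F) = tcomp (integ_map G) (integ_map F)"
proof -
  have 0: "T0 (integ_map (opcomp G F)) x = T0 (integ_map G) (T0 (integ_map F) x)" for x
    by (cases x) simp
  have m: "mapfib (O0 (opcomp G F)) g xs = mapfib (O0 G) g (mapfib (O0 F) g xs)"
    "mapfib (O1 (opcomp G F)) g ys = mapfib (O1 G) g (mapfib (O1 F) g ys)" for g xs ys
    by (simp_all add: opcomp_def mapfib_comp)
  have 1: "T1 (integ_map (opcomp G F)) s = T1 (integ_map G) (T1 (integ_map F) s)" for s
  proof (cases s)
    case (Int1 x y f as \<alpha>)
    then show ?thesis by (cases x; cases y) (simp add: m)
  qed
  have 2: "T2 (integ_map (opcomp G F)) c = T2 (integ_map G) (T2 (integ_map F) c)" for c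
    by (cases c) (simp add: 1 m)
  show ?thesis
    by (rule twofun.equality) (auto simp: 0 1 2)
qed

lemma integ_arr_simps [simp]: "integ_arr (P, F, Q) = (integ P, trestrict (integ P) (integ_map F), integ Q)"
  by (simp add: integ_arr_def)

lemma split_fibered_integI: "operad P \<Longrightarrow> split_fibered (integ P)"
  by (rule oper.split_fibered_integ) unfold_locales

lemma integ_arr_homset:
  assumes "A \<in> homset Oper P Q" shows "integ_arr A \<in> homset SFib (integ P) (integ Q)"
proof -
  obtain F where A: "A = (P, F, Q)" "operad P" "operad Q" "operad_morphism P Q F"
    using assms by (auto simp: homset_Oper)
  then interpret operad_mor P Q F by unfold_locales
  show ?thesis
    using A split_fibered_integI[OF A(2)] split_fibered_integI[OF A(3)] sfib_morphism_cong[OF _ sfib_morphism_integ_map teq_sym[OF teq_trestrict]]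
    by (simp add: homset_SFib)
qed

lemma integ_functor: "is_functor Oper SFib integ integ_arr"
proof (rule is_functorI)
  fix P :: "('a, 'b) operad" assume "P \<in> Obj Oper"
  then have P: "operad P" by simp
  show "integ P \<in> Obj SFib" using P by (simp add: split_fibered_integI)
  have "teq (integ P) (integ_map (oprestrict P opid)) tid"
    using integ_map_cong[OF P] integ_map_opid[OF P] by (rule teq_trans) (simp_all add: oprestrict_sel)
  then show "integ_arr (Idn Oper P) = Idn SFib (integ P)"
    by (simp add: trestrict_eq_iff)
next
  fix A and P Q :: "('a, 'b) operad" assume "A \<in> homset Oper P Q"
  then show "integ_arr A \<in> homset SFib (integ P) (integ Q)" by (rule integ_arr_homset)
next
  fix A B and P Q R :: "('a, 'b) operad" assume "A \<in> homset Oper P Q" "B \<in> homset Oper Q R"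
  then obtain F G where A: "A = (P, F, Q)" "operad P" "operad Q" "operad_morphism P Q F" and B: "B = (Q, G, R)"
    by (auto simp: homset_Oper)
  then interpret operad_mor P Q F by unfold_locales
  note K = two_functor_carrier[OF P.two_category_integ integ_map_two_functor]
  have "teq (integ P) (integ_map (oprestrict P (opcomp G F))) (integ_map (opcomp G F))"
    using A(2) by (rule integ_map_cong) (simp_all add: oprestrict_sel)
  \<comment> \<open>Restricting each factor changes nothing on the carrier of
    \<open>integ P\<close>, since \<open>integ_map F\<close> maps it into the carrier of
    \<open>integ Q\<close>.\<close>
  moreover have "teq (integ P) (tcomp (integ_map G) (integ_map F))
      (tcomp (trestrict (integ Q) (integ_map G)) (trestrict (integ P) (integ_map F)))"
    using K by (intro teqI) (simp_all add: trestrict_def del: integ_simps)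
  ultimately have "teq (integ P) (integ_map (oprestrict P (opcomp G F)))
      (tcomp (trestrict (integ Q) (integ_map G)) (trestrict (integ P) (integ_map F)))"
    unfolding integ_map_opcomp by (rule teq_trans)
  then show "integ_arr (Cmp Oper B A) = Cmp SFib (integ_arr B) (integ_arr A)"
    by (simp add: A B trestrict_eq_iff)
qed

text \<open>The maps on objects are recovered from the action on pairs \<open>(n, a)\<close> and
  those on morphisms from the last components of unary 1-cells; restricted families that agree there
  are equal.\<close>

lemma integ_arr_faithful:
  assumes "A \<in> homset Oper P Q" "B \<in> homset Oper P Q" "integ_arr A = integ_arr B"
  shows "A = B"
proof -
  obtain F G where A: "A = (P, F, Q)" "operad P" "oprestrict P F = F" and B: "B = (P, G, Q)" "oprestrict P G = G"
    using assms(1,2) by (auto simp: homset_Oper)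
  then interpret oper P by unfold_locales
  have e: "teq (integ P) (integ_map F) (integ_map G)"
    using assms(3) by (simp add: A B trestrict_eq_iff)
  have "O0 F n a = O0 G n a" if "1 \<le> n" "a \<in> Obj (Cat P n)" for n a
    using teqD(1)[OF e, of "(n, a)"] that by simp
  moreover have "O1 F n f = O1 G n f" if "1 \<le> n" "f \<in> Arr (Cat P n)" for n f
    using teqD(2)[OF e, of "unary_arrow P n f"] unary_arrow_arrow[OF that] by (simp add: unary_arrow_def)
  ultimately have "oprestrict P F = oprestrict P G" by (simp add: oprestrict_eq_iff)
  then show ?thesis using A B by simp
qed

lemma integ_arr_full:
  assumes "operad P" "operad Q" "B \<in> homset SFib (integ P) (integ Q)"
  shows "\<exists>A\<in>homset Oper P Q. integ_arr A = B"
proof -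
  obtain G where B: "B = (integ P, G, integ Q)" "sfib_morphism (integ P) (integ Q) G" "trestrict (integ P) G = G"
    using assms(3) by (auto simp: homset_SFib)
  interpret integ_mor P Q G by unfold_locales (use assms B in auto)
  \<comment> \<open>Restriction gives the canonical representative required of an arrow of
    \<open>Oper\<close>, and on the carrier of \<open>integ P\<close> it does not change the induced
    2-functor.\<close>
  let ?F = "oprestrict P (underlying_opmap P G)"
  have "(P, ?F, Q) \<in> homset Oper P Q"
    using assms operad_morphism_restrict[OF assms(1) operad_morphism_underlying] by (simp add: homset_Oper)
  moreover have "teq (integ P) (integ_map ?F) G"
    using integ_map_cong[OF assms(1)] teq_underlying by (rule teq_trans) (simp_all add: oprestrict_sel)
  then have "integ_arr (P, ?F, Q) = B"
    using B(1,3) trestrict_eq_iff[of "integ P" "integ_map ?F" G] by simp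
  ultimately show ?thesis by blast
qed

theorem proposition3p4:
  shows "fully_faithful_functor (Oper :: (('o, 'm) operad, _) cat) SFib integ integ_arr"
  unfolding fully_faithful_functor_def
proof (intro conjI ballI)
  fix P Q :: "('o, 'm) operad" assume "P \<in> Obj Oper" "Q \<in> Obj Oper"
  then have PQ: "operad P" "operad Q" by simp_all
  show "bij_betw integ_arr (homset Oper P Q) (homset SFib (integ P) (integ Q))"
    unfolding bij_betw_def
  proof (intro conjI equalityI subsetI)
    show "inj_on integ_arr (homset Oper P Q)"
      using integ_arr_faithful by (rule inj_onI)
    show "B \<in> homset SFib (integ P) (integ Q)" if "B \<in> integ_arr ` homset Oper P Q" for B
      using that integ_arr_homset by blast
    show "B \<in> integ_arr ` homset Oper P Q" if "B \<in> homset SFib (integ P) (integ Q)" for B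
      using integ_arr_full[OF PQ that] by blast
  qed
qed (rule category_Oper category_SFib integ_functor)+

end
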